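(* Let $G=\mathbb{Z}_8\rtimes \mathrm{Aut}(\mathbb{Z}_8)$ (with the natural action of $\mathrm{Aut}(\mathbb{Z}_8)$ on $\mathbb{Z}_8$), and let $C^{*}(G)$ be its group algebra, regarded as a finite-dimensional Hopf algebra. Then the invariant second cohomology group $H^{2}_{inv}(C^{*}(G),\mathbb{C}\setminus\{0\})$ is isomorphic to $\mathbb{Z}_2$, the cyclic group of order $2$.
   Context: The group $G$ has order $32$ and is generated by $s,t,u$ subject to $s^2=t^2=u^8=1$, $st=ts$, $sus^{-1}=u^3$, $tut^{-1}=u^5$. The group algebra $C^{*}(G)=\mathbb{C}[G]$ has coproduct $\Delta(g)=g\otimes g$ for $g\in G$. For a finite-dimensional Hopf algebra $(\mathcal{Q},\Delta)$ over $\mathbb{C}$: a (left) 2-cocycle is an invertible element $\Omega\in\mathcal{Q}\otimes\mathcal{Q}$ such that $(1\otimes\Omega)(\mathrm{id}\otimes\Delta)(\Omega)=(\Omega\otimes 1)(\Delta\otimes\mathrm{id})(\Omega)$. It is called invariant if it commutes with $\Delta(a)$ for every $a\in\mathcal{Q}$. Let $A^{1}(\mathcal{Q})$ be the group of central invertible elements of $\mathcal{Q}$ and let $A^{2}(\mathcal{Q})$ be the set of invariant (invertible) 2-cocycles, which is a group under multiplication in $\mathcal{Q}\otimes\mathcal{Q}$. The map $\delta:A^{1}(\mathcal{Q})\to A^{2}(\mathcal{Q})$, $\delta(v)=(v\otimes v)\Delta(v^{-1})$, is a group homomorphism whose image is a central subgroup. Define $H^{2}_{inv}(\mathcal{Q},\mathbb{C}\setminus\{0\})=A^{2}(\mathcal{Q})/\delta(A^{1}(\mathcal{Q}))$.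 *)

theory Defs
  imports Complex_Main "HOL-Algebra.Algebra"
begin

section \<open>Semidirect products and the group $G$\<close>

definition semidirect_product ::
    "('n, 'x) monoid_scheme \<Rightarrow> ('h, 'y) monoid_scheme \<Rightarrow> ('h \<Rightarrow> 'n \<Rightarrow> 'n) \<Rightarrow> ('n \<times> 'h) monoid" where
  "semidirect_product N H \<phi> =
     \<lparr>carrier = carrier N \<times> carrier H,
      monoid.mult = (\<lambda>(n, h) (n', h'). (n \<otimes>\<^bsub>N\<^esub> \<phi> h n', h \<otimes>\<^bsub>H\<^esub> h')),
      one = (\<one>\<^bsub>N\<^esub>, \<one>\<^bsub>H\<^esub>)\<rparr>"

definition Z8_rtimes_Aut :: "(int \<times> (int \<Rightarrow> int)) monoid" where
  "Z8_rtimes_Aut =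
     semidirect_product (integer_mod_group 8) (AutoGroup (integer_mod_group 8)) (\<lambda>\<alpha> n. \<alpha> n)"


section \<open>Finite-dimensional algebras with a chosen basis and their tensor products\<close>

text \<open>
  A finite-dimensional complex vector space is represented as the space of functions supported
  on a finite set \<open>B\<close> (the basis); the tensor product of the spaces on \<open>B\<close> and \<open>C\<close> is the space
  on \<open>B \<times> C\<close>.  Products and coproducts are given by their values on basis elements and extended
  (bi)linearly.
\<close>

definition vecs :: "'b set \<Rightarrow> ('b \<Rightarrow> complex) set" where
  "vecs B = {f. \<forall>x. x \<notin> B \<longrightarrow> f x = 0}"

definition single :: "'b \<Rightarrow> 'b \<Rightarrow> complex" where
  "single b = (\<lambda>x. if x = b then 1 else 0)"

definition lin_ext :: "'b set \<Rightarrow> ('b \<Rightarrow> 'c \<Rightarrow> complex) \<Rightarrow> ('b \<Rightarrow> complex) \<Rightarrow> 'c \<Rightarrow> complex" where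
  "lin_ext B F f = (\<lambda>y. \<Sum>b\<in>B. f b * F b y)"

definition tensor :: "('b \<Rightarrow> complex) \<Rightarrow> ('c \<Rightarrow> complex) \<Rightarrow> 'b \<times> 'c \<Rightarrow> complex" (infixr \<open>\<boxtimes>\<close> 75)
  where "f \<boxtimes> g = (\<lambda>(x, y). f x * g y)"

text \<open>The tensor product \<open>S \<otimes> T\<close> of linear maps defined on \<open>vecs B\<close> and \<open>vecs C\<close>.\<close>

definition tensor_map ::
    "'b set \<Rightarrow> 'c set \<Rightarrow> (('b \<Rightarrow> complex) \<Rightarrow> 'd \<Rightarrow> complex) \<Rightarrow> (('c \<Rightarrow> complex) \<Rightarrow> 'e \<Rightarrow> complex)
      \<Rightarrow> ('b \<times> 'c \<Rightarrow> complex) \<Rightarrow> 'd \<times> 'e \<Rightarrow> complex" where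
  "tensor_map B C S T = lin_ext (B \<times> C) (\<lambda>(b, c). S (single b) \<boxtimes> T (single c))"

text \<open>The canonical identification of \<open>(U \<otimes> V) \<otimes> W\<close> with \<open>U \<otimes> (V \<otimes> W)\<close>.\<close>

definition reassoc :: "(('b \<times> 'c) \<times> 'd \<Rightarrow> complex) \<Rightarrow> 'b \<times> ('c \<times> 'd) \<Rightarrow> complex" where
  "reassoc f = (\<lambda>(x, y, z). f ((x, y), z))"

record 'b based_algebra =
  basis :: "'b set"
  basis_mult :: "'b \<Rightarrow> 'b \<Rightarrow> 'b \<Rightarrow> complex"
  unit_vec :: "'b \<Rightarrow> complex"

definition mult_monoid :: "('b, 'x) based_algebra_scheme \<Rightarrow> ('b \<Rightarrow> complex) monoid" where
  "mult_monoid A =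
     \<lparr>carrier = vecs (basis A),
      monoid.mult = (\<lambda>f g z. \<Sum>x\<in>basis A. \<Sum>y\<in>basis A. f x * g y * basis_mult A x y z),
      one = unit_vec A\<rparr>"

definition tensor_algebra ::
    "('b, 'x) based_algebra_scheme \<Rightarrow> ('c, 'y) based_algebra_scheme \<Rightarrow> ('b \<times> 'c) based_algebra" where
  "tensor_algebra A A' =
     \<lparr>basis = basis A \<times> basis A',
      basis_mult = (\<lambda>(a, a') (b, b'). basis_mult A a b \<boxtimes> basis_mult A' a' b'),
      unit_vec = unit_vec A \<boxtimes> unit_vec A'\<rparr>"


section \<open>Finite-dimensional Hopf algebras\<close>

record 'b based_hopf_algebra = "'b based_algebra" +
  basis_comult :: "'b \<Rightarrow> 'b \<times> 'b \<Rightarrow> complex"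
  basis_counit :: "'b \<Rightarrow> complex"
  basis_antipode :: "'b \<Rightarrow> 'b \<Rightarrow> complex"

definition comult ::
    "('b, 'x) based_hopf_algebra_scheme \<Rightarrow> ('b \<Rightarrow> complex) \<Rightarrow> 'b \<times> 'b \<Rightarrow> complex" where
  "comult Q = lin_ext (basis Q) (basis_comult Q)"

definition counit :: "('b, 'x) based_hopf_algebra_scheme \<Rightarrow> ('b \<Rightarrow> complex) \<Rightarrow> complex" where
  "counit Q f = (\<Sum>b\<in>basis Q. f b * basis_counit Q b)"

definition antipode ::
    "('b, 'x) based_hopf_algebra_scheme \<Rightarrow> ('b \<Rightarrow> complex) \<Rightarrow> 'b \<Rightarrow> complex" where
  "antipode Q = lin_ext (basis Q) (basis_antipode Q)"

definition mult_map ::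
    "('b, 'x) based_algebra_scheme \<Rightarrow> ('b \<times> 'b \<Rightarrow> complex) \<Rightarrow> 'b \<Rightarrow> complex" where
  "mult_map A = lin_ext (basis A \<times> basis A) (\<lambda>(a, b). basis_mult A a b)"

definition id_comult ::
    "('b, 'x) based_hopf_algebra_scheme \<Rightarrow> ('b \<times> 'b \<Rightarrow> complex) \<Rightarrow> 'b \<times> ('b \<times> 'b) \<Rightarrow> complex" where
  "id_comult Q = tensor_map (basis Q) (basis Q) id (comult Q)"

definition comult_id ::
    "('b, 'x) based_hopf_algebra_scheme \<Rightarrow> ('b \<times> 'b \<Rightarrow> complex) \<Rightarrow> 'b \<times> ('b \<times> 'b) \<Rightarrow> complex" where
  "comult_id Q = reassoc \<circ> tensor_map (basis Q) (basis Q) (comult Q) id"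

locale finite_dim_hopf_algebra =
  fixes Q :: "('b, 'x) based_hopf_algebra_scheme"
  assumes finite_basis: "finite (basis Q)"
    and monoid_mult: "monoid (mult_monoid Q)"
    and comult_hom: "comult Q \<in> hom (mult_monoid Q) (mult_monoid (tensor_algebra Q Q))"
    and comult_unit: "comult Q (unit_vec Q) = unit_vec Q \<boxtimes> unit_vec Q"
    and coassoc: "f \<in> vecs (basis Q) \<Longrightarrow> id_comult Q (comult Q f) = comult_id Q (comult Q f)"
    and counit_mult: "\<lbrakk>f \<in> vecs (basis Q); g \<in> vecs (basis Q)\<rbrakk>
          \<Longrightarrow> counit Q (f \<otimes>\<^bsub>mult_monoid Q\<^esub> g) = counit Q f * counit Q g"
    and counit_unit: "counit Q (unit_vec Q) = 1"
    and counit_left: "f \<in> vecs (basis Q)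
          \<Longrightarrow> (\<Sum>b\<in>basis Q. basis_counit Q b * comult Q f (b, c)) = f c"
    and counit_right: "f \<in> vecs (basis Q)
          \<Longrightarrow> (\<Sum>c\<in>basis Q. comult Q f (b, c) * basis_counit Q c) = f b"
    and antipode_closed: "f \<in> vecs (basis Q) \<Longrightarrow> antipode Q f \<in> vecs (basis Q)"
    and antipode_left: "f \<in> vecs (basis Q) \<Longrightarrow>
          mult_map Q (tensor_map (basis Q) (basis Q) (antipode Q) id (comult Q f))
            = (\<lambda>x. counit Q f * unit_vec Q x)"
    and antipode_right: "f \<in> vecs (basis Q) \<Longrightarrow>
          mult_map Q (tensor_map (basis Q) (basis Q) id (antipode Q) (comult Q f))
            = (\<lambda>x. counit Q f * unit_vec Q x)"


section \<open>Invariant second cohomology\<close>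

abbreviation algebra2 :: "('b, 'x) based_hopf_algebra_scheme \<Rightarrow> ('b \<times> 'b \<Rightarrow> complex) monoid" where
  "algebra2 Q \<equiv> mult_monoid (tensor_algebra Q Q)"

abbreviation algebra3 ::
    "('b, 'x) based_hopf_algebra_scheme \<Rightarrow> ('b \<times> ('b \<times> 'b) \<Rightarrow> complex) monoid" where
  "algebra3 Q \<equiv> mult_monoid (tensor_algebra Q (tensor_algebra Q Q))"

definition two_cocycle ::
    "('b, 'x) based_hopf_algebra_scheme \<Rightarrow> ('b \<times> 'b \<Rightarrow> complex) \<Rightarrow> bool" where
  "two_cocycle Q \<Omega> \<longleftrightarrow>
     \<Omega> \<in> Units (algebra2 Q) \<and>
     (unit_vec Q \<boxtimes> \<Omega>) \<otimes>\<^bsub>algebra3 Q\<^esub> id_comult Q \<Omega>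
       = reassoc (\<Omega> \<boxtimes> unit_vec Q) \<otimes>\<^bsub>algebra3 Q\<^esub> comult_id Q \<Omega>"

definition invariant :: "('b, 'x) based_hopf_algebra_scheme \<Rightarrow> ('b \<times> 'b \<Rightarrow> complex) \<Rightarrow> bool" where
  "invariant Q \<Omega> \<longleftrightarrow>
     (\<forall>a \<in> vecs (basis Q). \<Omega> \<otimes>\<^bsub>algebra2 Q\<^esub> comult Q a = comult Q a \<otimes>\<^bsub>algebra2 Q\<^esub> \<Omega>)"

definition A1 :: "('b, 'x) based_hopf_algebra_scheme \<Rightarrow> ('b \<Rightarrow> complex) set" where
  "A1 Q = {v \<in> Units (mult_monoid Q).
             \<forall>a \<in> vecs (basis Q). v \<otimes>\<^bsub>mult_monoid Q\<^esub> a = a \<otimes>\<^bsub>mult_monoid Q\<^esub> v}"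

definition A2 :: "('b, 'x) based_hopf_algebra_scheme \<Rightarrow> ('b \<times> 'b \<Rightarrow> complex) monoid" where
  "A2 Q = (algebra2 Q) \<lparr>carrier := {\<Omega>. two_cocycle Q \<Omega> \<and> invariant Q \<Omega>}\<rparr>"

definition coboundary ::
    "('b, 'x) based_hopf_algebra_scheme \<Rightarrow> ('b \<Rightarrow> complex) \<Rightarrow> 'b \<times> 'b \<Rightarrow> complex" where
  "coboundary Q v = (v \<boxtimes> v) \<otimes>\<^bsub>algebra2 Q\<^esub> comult Q (inv\<^bsub>mult_monoid Q\<^esub> v)"

definition H2_inv :: "('b, 'x) based_hopf_algebra_scheme \<Rightarrow> ('b \<times> 'b \<Rightarrow> complex) set monoid" where
  "H2_inv Q = A2 Q Mod (coboundary Q ` A1 Q)"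


section \<open>The group algebra of a finite group\<close>

definition group_algebra :: "('g, 'x) monoid_scheme \<Rightarrow> 'g based_hopf_algebra" where
  "group_algebra G =
     \<lparr>basis = carrier G,
      basis_mult = (\<lambda>g h. single (g \<otimes>\<^bsub>G\<^esub> h)),
      unit_vec = single \<one>\<^bsub>G\<^esub>,
      basis_comult = (\<lambda>g. single g \<boxtimes> single g),
      basis_counit = (\<lambda>g. 1),
      basis_antipode = (\<lambda>g. single (inv\<^bsub>G\<^esub> g))\<rparr>"

lemma lin_ext_single:
  assumes "finite B" "b \<in> B"
  shows "lin_ext B F (single b) = F b"
  using assms by (auto simp: lin_ext_def single_def fun_eq_iff if_distrib[of "\<lambda>c. c * _"] cong: if_cong)

lemma single_in_vecs: "b \<in> B \<Longrightarrow> single b \<in> vecs B"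
  by (auto simp: single_def vecs_def)

lemma tensor_single: "single a \<boxtimes> single b = single (a, b)"
  by (auto simp: tensor_def single_def fun_eq_iff)


lemma sum_single:
  assumes "finite B"
  shows "(\<Sum>b\<in>B. F b * single b y) = (if y \<in> B then F y else (0::complex))"
    and "(\<Sum>b\<in>B. single b y * F b) = (if y \<in> B then F y else (0::complex))"
    and "(\<Sum>b\<in>B. F b * single y b) = (if y \<in> B then F y else (0::complex))"
    and "(\<Sum>b\<in>B. single y b * F b) = (if y \<in> B then F y else (0::complex))"
  using assms by (auto simp: single_def if_distrib[of "\<lambda>c. _ * c"] if_distrib[of "\<lambda>c. c * _"] cong: if_cong)

lemma sum_diag:
  fixes F :: "'b \<times> 'b \<Rightarrow> complex"
  assumes "finite B"
  shows "(\<Sum>p\<in>B \<times> B. (case p of (a, b) \<Rightarrow> if a = b then f a else 0) * F p) = (\<Sum>a\<in>B. f a * F (a, a))"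
proof -
  have "(\<Sum>p\<in>B \<times> B. (case p of (a, b) \<Rightarrow> if a = b then f a else 0) * F p)
     = (\<Sum>a\<in>B. \<Sum>b\<in>B. (if a = b then f a * F (a, b) else 0))"
    by (subst sum.cartesian_product) (auto intro!: sum.cong)
  also have "\<dots> = (\<Sum>a\<in>B. f a * F (a, a))" using assms by simp
  finally show ?thesis .
qed

context
  fixes G :: "('g, 'x) monoid_scheme" 
  assumes G: "group G" and fin: "finite (carrier G)"
begin

interpretation group G by (rule G)

lemma ga_comult: "f \<in> vecs (carrier G) \<Longrightarrow> comult (group_algebra G) f = (\<lambda>(a, b). if a = b then f a else 0)"
proof -
  assume f: "f \<in> vecs (carrier G)"
  have "comult (group_algebra G) f (a,b) = (if a = b then f a else 0)" for a b
  proof -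
    have "comult (group_algebra G) f (a,b) = (\<Sum>g\<in>carrier G. (f g * single g a) * single g b)"
      by (simp add: comult_def lin_ext_def group_algebra_def tensor_def mult.assoc)
    also have "\<dots> = (if a = b then f a else 0)"
      using f by (auto simp: sum_single[OF fin]) (auto simp: vecs_def single_def)
    finally show ?thesis .
  qed
  then show ?thesis by (auto simp: fun_eq_iff)
qed

lemma ga_mult: "(f \<otimes>\<^bsub>mult_monoid (group_algebra G)\<^esub> g) z =
   (\<Sum>x\<in>carrier G. \<Sum>y\<in>carrier G. f x * g y * single (x \<otimes>\<^bsub>G\<^esub> y) z)"
  by (simp add: mult_monoid_def group_algebra_def)

lemma ga_mult_closed: "f \<otimes>\<^bsub>mult_monoid (group_algebra G)\<^esub> g \<in> vecs (carrier G)"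
  by (auto simp: vecs_def ga_mult single_def intro!: sum.neutral)

lemma ga_sum_mult:
  "(\<Sum>p\<in>carrier G. (f \<otimes>\<^bsub>mult_monoid (group_algebra G)\<^esub> g) p * F p) =
   (\<Sum>x\<in>carrier G. \<Sum>y\<in>carrier G. f x * g y * F (x \<otimes>\<^bsub>G\<^esub> y))"
proof -
  have "(\<Sum>p\<in>carrier G. (f \<otimes>\<^bsub>mult_monoid (group_algebra G)\<^esub> g) p * F p) =
    (\<Sum>p\<in>carrier G. \<Sum>x\<in>carrier G. \<Sum>y\<in>carrier G. f x * g y * (F p * single (x \<otimes>\<^bsub>G\<^esub> y) p))"
    by (simp add: ga_mult sum_distrib_left sum_distrib_right mult_ac)
  also have "\<dots> = (\<Sum>x\<in>carrier G. \<Sum>p\<in>carrier G. \<Sum>y\<in>carrier G. f x * g y * (F p * single (x \<otimes>\<^bsub>G\<^esub> y) p))"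
    by (rule sum.swap)
  also have "\<dots> = (\<Sum>x\<in>carrier G. \<Sum>y\<in>carrier G. \<Sum>p\<in>carrier G. f x * g y * (F p * single (x \<otimes>\<^bsub>G\<^esub> y) p))"
    by (intro sum.cong refl sum.swap)
  also have "\<dots> = (\<Sum>x\<in>carrier G. \<Sum>y\<in>carrier G. f x * g y * F (x \<otimes>\<^bsub>G\<^esub> y))"
    by (simp add: sum_distrib_left[symmetric] sum_single[OF fin])
  finally show ?thesis .
qed

lemma ga_mult_assoc:
  "(f \<otimes>\<^bsub>mult_monoid (group_algebra G)\<^esub> g) \<otimes>\<^bsub>mult_monoid (group_algebra G)\<^esub> h = f \<otimes>\<^bsub>mult_monoid (group_algebra G)\<^esub> (g \<otimes>\<^bsub>mult_monoid (group_algebra G)\<^esub> h)"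
proof
  fix z
  let ?T = "\<lambda>x y w. f x * g y * h w * single (x \<otimes>\<^bsub>G\<^esub> y \<otimes>\<^bsub>G\<^esub> w) z"
  have "((f \<otimes>\<^bsub>mult_monoid (group_algebra G)\<^esub> g) \<otimes>\<^bsub>mult_monoid (group_algebra G)\<^esub> h) z
    = (\<Sum>p\<in>carrier G. (f \<otimes>\<^bsub>mult_monoid (group_algebra G)\<^esub> g) p * (\<Sum>w\<in>carrier G. h w * single (p \<otimes>\<^bsub>G\<^esub> w) z))"
    by (subst ga_mult) (simp add: sum_distrib_left mult_ac)
  also have "\<dots> = (\<Sum>x\<in>carrier G. \<Sum>y\<in>carrier G. \<Sum>w\<in>carrier G. ?T x y w)"
    by (subst ga_sum_mult) (simp add: sum_distrib_left mult_ac)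
  also have "\<dots> = (\<Sum>x\<in>carrier G. f x * (\<Sum>p\<in>carrier G. (g \<otimes>\<^bsub>mult_monoid (group_algebra G)\<^esub> h) p * single (x \<otimes>\<^bsub>G\<^esub> p) z))"
    by (subst ga_sum_mult) (simp add: sum_distrib_left mult_ac m_assoc cong: sum.cong)
  also have "\<dots> = (f \<otimes>\<^bsub>mult_monoid (group_algebra G)\<^esub> (g \<otimes>\<^bsub>mult_monoid (group_algebra G)\<^esub> h)) z"
    by (subst (2) ga_mult) (simp add: sum_distrib_left mult_ac)
  finally show "((f \<otimes>\<^bsub>mult_monoid (group_algebra G)\<^esub> g) \<otimes>\<^bsub>mult_monoid (group_algebra G)\<^esub> h) z = (f \<otimes>\<^bsub>mult_monoid (group_algebra G)\<^esub> (g \<otimes>\<^bsub>mult_monoid (group_algebra G)\<^esub> h)) z" .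
qed

lemma ga_basis [simp]: "basis (group_algebra G) = carrier G" "unit_vec (group_algebra G) = single \<one>\<^bsub>G\<^esub>"
   "carrier (mult_monoid (group_algebra G)) = vecs (carrier G)"  "\<one>\<^bsub>mult_monoid (group_algebra G)\<^esub> = single \<one>\<^bsub>G\<^esub>"
   "basis_counit (group_algebra G) = (\<lambda>g. 1)"
  by (simp_all add: group_algebra_def mult_monoid_def)

lemma ga_monoid: "monoid (mult_monoid (group_algebra G))"
proof (rule monoidI)
  fix f assume f: "f \<in> carrier (mult_monoid (group_algebra G))"
  have "(\<one>\<^bsub>mult_monoid (group_algebra G)\<^esub> \<otimes>\<^bsub>mult_monoid (group_algebra G)\<^esub> f) z = f z" for z
  proof -
    have "(\<one>\<^bsub>mult_monoid (group_algebra G)\<^esub> \<otimes>\<^bsub>mult_monoid (group_algebra G)\<^esub> f) z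
       = (\<Sum>x\<in>carrier G. single \<one>\<^bsub>G\<^esub> x * (\<Sum>y\<in>carrier G. f y * single (x \<otimes>\<^bsub>G\<^esub> y) z))"
      by (simp add: ga_mult sum_distrib_left mult_ac)
    also have "\<dots> = (\<Sum>y\<in>carrier G. f y * single y z)"
      by (simp add: sum_single[OF fin])
    also have "\<dots> = f z" using f by (auto simp: sum_single[OF fin] vecs_def)
    finally show ?thesis .
  qed
  then show "\<one>\<^bsub>mult_monoid (group_algebra G)\<^esub> \<otimes>\<^bsub>mult_monoid (group_algebra G)\<^esub> f = f" by auto
  have "(f \<otimes>\<^bsub>mult_monoid (group_algebra G)\<^esub> \<one>\<^bsub>mult_monoid (group_algebra G)\<^esub>) z = f z" for z
  proof -
    have "(f \<otimes>\<^bsub>mult_monoid (group_algebra G)\<^esub> \<one>\<^bsub>mult_monoid (group_algebra G)\<^esub>) z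
       = (\<Sum>x\<in>carrier G. f x * (\<Sum>y\<in>carrier G. single \<one>\<^bsub>G\<^esub> y * single (x \<otimes>\<^bsub>G\<^esub> y) z))"
      by (simp add: ga_mult sum_distrib_left mult_ac)
    also have "\<dots> = (\<Sum>y\<in>carrier G. f y * single y z)"
      by (simp add: sum_single[OF fin])
    also have "\<dots> = f z" using f by (auto simp: sum_single[OF fin] vecs_def)
    finally show ?thesis .
  qed
  then show "f \<otimes>\<^bsub>mult_monoid (group_algebra G)\<^esub> \<one>\<^bsub>mult_monoid (group_algebra G)\<^esub> = f" by auto
qed (auto simp: ga_mult_closed ga_mult_assoc single_in_vecs)

lemma ga_mult2: "(p \<otimes>\<^bsub>algebra2 (group_algebra G)\<^esub> q) w =
  (\<Sum>x\<in>carrier G \<times> carrier G. \<Sum>y\<in>carrier G \<times> carrier G. p x * q y *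
     (case x of (a, a') \<Rightarrow> \<lambda>(b, b'). single (a \<otimes>\<^bsub>G\<^esub> b) \<boxtimes> single (a' \<otimes>\<^bsub>G\<^esub> b')) y w)"
  by (simp add: mult_monoid_def tensor_algebra_def group_algebra_def)

lemma ga_comult_mult:
  assumes f: "f \<in> vecs (carrier G)" and g: "g \<in> vecs (carrier G)"
  shows "comult (group_algebra G) (f \<otimes>\<^bsub>mult_monoid (group_algebra G)\<^esub> g) = comult (group_algebra G) f \<otimes>\<^bsub>algebra2 (group_algebra G)\<^esub> comult (group_algebra G) g"
proof
  fix w :: "'g \<times> 'g"
  obtain u v where w: "w = (u, v)" by force
  let ?D = "\<lambda>f::'g \<Rightarrow> complex. \<lambda>(a, b). if a = b then f a else 0"
  let ?F = "\<lambda>p q. (case p of (a, a') \<Rightarrow> \<lambda>(b, b'). single (a \<otimes>\<^bsub>G\<^esub> b) \<boxtimes> single (a' \<otimes>\<^bsub>G\<^esub> b')) q w"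
  have "(comult (group_algebra G) f \<otimes>\<^bsub>algebra2 (group_algebra G)\<^esub> comult (group_algebra G) g) w =
      (\<Sum>p\<in>carrier G \<times> carrier G. ?D f p * (\<Sum>q\<in>carrier G \<times> carrier G. ?D g q * ?F p q))"
    by (subst ga_comult[OF f, symmetric], subst ga_comult[OF g, symmetric])
      (simp add: ga_mult2 sum_distrib_left mult.assoc)
  also have "\<dots> = (\<Sum>a\<in>carrier G. f a * (\<Sum>b\<in>carrier G. g b * ?F (a,a) (b,b)))"
    by (simp only: sum_diag[OF fin])
  also have "\<dots> = (\<Sum>a\<in>carrier G. \<Sum>b\<in>carrier G. f a * g b * (single (a \<otimes>\<^bsub>G\<^esub> b) u * single (a \<otimes>\<^bsub>G\<^esub> b) v))"
    by (simp add: sum_distrib_left mult.assoc tensor_def w)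
  also have "\<dots> = (if u = v then (f \<otimes>\<^bsub>mult_monoid (group_algebra G)\<^esub> g) u else 0)"
    by (auto simp: ga_mult single_def intro!: sum.cong sum.neutral)
  also have "\<dots> = comult (group_algebra G) (f \<otimes>\<^bsub>mult_monoid (group_algebra G)\<^esub> g) w"
    by (simp add: ga_comult[OF ga_mult_closed] w)
  finally show "comult (group_algebra G) (f \<otimes>\<^bsub>mult_monoid (group_algebra G)\<^esub> g) w = (comult (group_algebra G) f \<otimes>\<^bsub>algebra2 (group_algebra G)\<^esub> comult (group_algebra G) g) w" ..
qed

lemma ga_comult_single: "a \<in> carrier G \<Longrightarrow> comult (group_algebra G) (single a) = single a \<boxtimes> single a"
  by (simp add: comult_def lin_ext_single fin) (simp add: group_algebra_def)

lemma ga_antipode_single: "a \<in> carrier G \<Longrightarrow> antipode (group_algebra G) (single a) = single (inv\<^bsub>G\<^esub> a)"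
  by (simp add: antipode_def lin_ext_single fin) (simp add: group_algebra_def)

lemma ga_tensor_map_comult:
  assumes f: "f \<in> vecs (carrier G)"
  shows "tensor_map (carrier G) (carrier G) S T (comult (group_algebra G) f)
    = (\<lambda>y. \<Sum>a\<in>carrier G. f a * (S (single a) \<boxtimes> T (single a)) y)"
  by (simp add: tensor_map_def lin_ext_def ga_comult[OF f] sum_diag[OF fin])

lemma ga_mult_map_sum:
  assumes "\<And>a. a \<in> carrier G \<Longrightarrow> s a \<in> carrier G \<and> t a \<in> carrier G \<and> s a \<otimes>\<^bsub>G\<^esub> t a = \<one>\<^bsub>G\<^esub>"
  shows "mult_map (group_algebra G) (\<lambda>y. \<Sum>a\<in>carrier G. f a * (single (s a) \<boxtimes> single (t a)) y)
    = (\<lambda>x. counit (group_algebra G) f * single \<one>\<^bsub>G\<^esub> x)"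
proof
  fix x
  have "mult_map (group_algebra G) (\<lambda>y. \<Sum>a\<in>carrier G. f a * (single (s a) \<boxtimes> single (t a)) y) x
   = (\<Sum>p\<in>carrier G \<times> carrier G. \<Sum>a\<in>carrier G. f a * (single (s a, t a) p * single (fst p \<otimes>\<^bsub>G\<^esub> snd p) x))"
    by (simp add: mult_map_def lin_ext_def tensor_single group_algebra_def sum_distrib_left sum_distrib_right mult_ac case_prod_unfold)
  also have "\<dots> = (\<Sum>a\<in>carrier G. \<Sum>p\<in>carrier G \<times> carrier G. f a * (single (s a, t a) p * single (fst p \<otimes>\<^bsub>G\<^esub> snd p) x))"
    by (rule sum.swap)
  also have "\<dots> = (\<Sum>a\<in>carrier G. f a * single \<one>\<^bsub>G\<^esub> x)"
    by (intro sum.cong refl) (simp add: sum_distrib_left[symmetric] sum_single fin assms)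
  also have "\<dots> = counit (group_algebra G) f * single \<one>\<^bsub>G\<^esub> x"
    by (simp add: counit_def sum_distrib_right)
  finally show "mult_map (group_algebra G) (\<lambda>y. \<Sum>a\<in>carrier G. f a * (single (s a) \<boxtimes> single (t a)) y) x
    = counit (group_algebra G) f * single \<one>\<^bsub>G\<^esub> x" .
qed

lemma group_algebra_hopf: "finite_dim_hopf_algebra (group_algebra G)"
proof (rule finite_dim_hopf_algebra.intro)
  show "finite (basis (group_algebra G))" by (simp add: fin)
  show "monoid (mult_monoid (group_algebra G))" by (rule ga_monoid)
  have "comult (group_algebra G) f \<in> carrier (algebra2 (group_algebra G))" if "f \<in> vecs (carrier G)" for f
    using that by (auto simp: ga_comult mult_monoid_def tensor_algebra_def vecs_def)
  then show "comult (group_algebra G) \<in> hom (mult_monoid (group_algebra G)) (algebra2 (group_algebra G))"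
    by (auto simp: hom_def ga_comult_mult)
  show "comult (group_algebra G) (unit_vec (group_algebra G)) = unit_vec (group_algebra G) \<boxtimes> unit_vec (group_algebra G)"
    by (simp add: ga_comult_single)
  show "counit (group_algebra G) (unit_vec (group_algebra G)) = 1"
    using sum_single(4)[OF fin, of "\<one>\<^bsub>G\<^esub>" "\<lambda>_. 1"] by (simp add: counit_def)
next
  fix f assume "f \<in> vecs (basis (group_algebra G))"
  then have f: "f \<in> vecs (carrier G)" by simp
  show "id_comult (group_algebra G) (comult (group_algebra G) f) = comult_id (group_algebra G) (comult (group_algebra G) f)"
    by (auto simp: id_comult_def comult_id_def ga_tensor_map_comult[OF f] ga_comult_single reassoc_def
         tensor_def fun_eq_iff mult_ac intro!: sum.cong)
  show "(\<Sum>b\<in>basis (group_algebra G). basis_counit (group_algebra G) b * comult (group_algebra G) f (b, c)) = f c" for c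
    using f fin by (auto simp: ga_comult[OF f] vecs_def)
  show "(\<Sum>c\<in>basis (group_algebra G). comult (group_algebra G) f (b, c) * basis_counit (group_algebra G) c) = f b" for b
    using f fin by (auto simp: ga_comult[OF f] vecs_def)
  show "antipode (group_algebra G) f \<in> vecs (basis (group_algebra G))"
    by (auto simp: antipode_def lin_ext_def vecs_def group_algebra_def single_def intro!: sum.neutral)
  show "mult_map (group_algebra G) (tensor_map (basis (group_algebra G)) (basis (group_algebra G)) (antipode (group_algebra G)) id (comult (group_algebra G) f))
            = (\<lambda>x. counit (group_algebra G) f * unit_vec (group_algebra G) x)"
    using ga_mult_map_sum[of "\<lambda>a. inv\<^bsub>G\<^esub> a" "\<lambda>a. a" f]
    by (simp add: ga_tensor_map_comult[OF f] ga_antipode_single cong: sum.cong)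
  show "mult_map (group_algebra G) (tensor_map (basis (group_algebra G)) (basis (group_algebra G)) id (antipode (group_algebra G)) (comult (group_algebra G) f))
            = (\<lambda>x. counit (group_algebra G) f * unit_vec (group_algebra G) x)"
    using ga_mult_map_sum[of "\<lambda>a. a" "\<lambda>a. inv\<^bsub>G\<^esub> a" f]
    by (simp add: ga_tensor_map_comult[OF f] ga_antipode_single cong: sum.cong)
next
  fix f g assume "f \<in> vecs (basis (group_algebra G))" "g \<in> vecs (basis (group_algebra G))"
  show "counit (group_algebra G) (f \<otimes>\<^bsub>mult_monoid (group_algebra G)\<^esub> g) = counit (group_algebra G) f * counit (group_algebra G) g"
    using ga_sum_mult[of f g "\<lambda>_. 1"] by (simp add: counit_def sum_product)
qed

end

section \<open>The group is well defined and finite\<close>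

lemma semidirect_product_group:
  assumes "group N" "group H"
    and hom: "\<And>h. h \<in> carrier H \<Longrightarrow> \<phi> h \<in> hom N N"
    and act: "\<And>h h' n. \<lbrakk>h \<in> carrier H; h' \<in> carrier H; n \<in> carrier N\<rbrakk> \<Longrightarrow> \<phi> (h \<otimes>\<^bsub>H\<^esub> h') n = \<phi> h (\<phi> h' n)"
    and one: "\<And>n. n \<in> carrier N \<Longrightarrow> \<phi> \<one>\<^bsub>H\<^esub> n = n"
  shows "group (semidirect_product N H \<phi>)"
proof -
  interpret N: group N by fact
  interpret H: group H by fact
  have cl: "\<phi> h n \<in> carrier N" if "h \<in> carrier H" "n \<in> carrier N" for h n
    using hom[OF that(1)] that(2) by (rule hom_in_carrier)
  have mu: "\<phi> h (n \<otimes>\<^bsub>N\<^esub> n') = \<phi> h n \<otimes>\<^bsub>N\<^esub> \<phi> h n'" 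
    if "h \<in> carrier H" "n \<in> carrier N" "n' \<in> carrier N" for h n n'
    using hom[OF that(1)] that(2,3) by (rule hom_mult)
  show ?thesis
  proof (rule groupI)
    fix x assume "x \<in> carrier (semidirect_product N H \<phi>)"
    then obtain n h where x: "x = (n, h)" "n \<in> carrier N" "h \<in> carrier H"
      by (auto simp: semidirect_product_def)
    show "\<exists>y\<in>carrier (semidirect_product N H \<phi>). y \<otimes>\<^bsub>semidirect_product N H \<phi>\<^esub> x = \<one>\<^bsub>semidirect_product N H \<phi>\<^esub>"
      using x by (intro bexI[of _ "(inv\<^bsub>N\<^esub> (\<phi> (inv\<^bsub>H\<^esub> h) n), inv\<^bsub>H\<^esub> h)"])
         (auto simp: semidirect_product_def cl)
  qed (auto simp: semidirect_product_def cl mu act one N.m_assoc H.m_assoc)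
qed

lemma group_Z8_rtimes_Aut: "group Z8_rtimes_Aut"
proof -
  interpret Z: group "integer_mod_group 8" by (rule group_integer_mod_group)
  show ?thesis unfolding Z8_rtimes_Aut_def
    by (rule semidirect_product_group[OF Z.is_group Z.AutoGroup])
       (auto simp: AutoGroup_def BijGroup_def auto_def compose_def)
qed

lemma finite_Z8_rtimes_Aut: "finite (carrier Z8_rtimes_Aut)"
proof -
  have "auto (integer_mod_group 8) \<subseteq> carrier (integer_mod_group 8) \<rightarrow>\<^sub>E carrier (integer_mod_group 8)"
    by (auto simp: auto_def Bij_def hom_def PiE_def)
  moreover have "finite (carrier (integer_mod_group 8) \<rightarrow>\<^sub>E carrier (integer_mod_group 8))"
    by (intro finite_PiE) (auto simp: carrier_integer_mod_group)
  ultimately show ?thesis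
    by (auto simp: Z8_rtimes_Aut_def semidirect_product_def AutoGroup_def carrier_integer_mod_group
       intro: finite_subset)
qed

lemma hopf_group_algebra_Z8_rtimes_Aut:
  "finite_dim_hopf_algebra (group_algebra Z8_rtimes_Aut)"
  by (rule group_algebra_hopf[OF group_Z8_rtimes_Aut finite_Z8_rtimes_Aut])

end

theory Submission
  imports Defs "HOL-Computational_Algebra.Fundamental_Theorem_Algebra"
begin

text \<open>
  Tensor powers of a group algebra are group algebras of direct powers.  For an invariant cocycle
  \<open>\<Omega>\<close> consider the R-matrix \<open>R = \<Omega>\<^sup>-\<^sup>1 \<Omega>\<^sub>2\<^sub>1\<close>.  It satisfies the hexagon identities, and these force
  it to be supported on \<open>A \<times> A\<close> for an abelian normal subgroup \<open>A\<close>, where it is given by a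
  nondegenerate alternating bicharacter (\<open>R_outside\<close>, \<open>beta_nondegenerate\<close>, \<open>beta_alternating\<close>).
  As \<open>R\<close> followed by the flip is conjugate to the flip, it also satisfies a trace identity for every
  group element (\<open>R_trace\<close>).

  In the group of order 32 the only nontrivial candidate for \<open>A\<close> is the Klein four-group generated by
  \<open>z = u\<^sup>4\<close> and \<open>t\<close>, and the trace identity at \<open>u s\<close> excludes it (\<open>Supp_trivial\<close>).  Hence \<open>R\<close> is
  trivial and \<open>\<Omega>\<close> is symmetric.

  A symmetric \<open>\<Omega>\<close> defines a commutative algebra structure on the functions on the group.  A character
  of this algebra is a unit \<open>v\<close> of the group algebra with \<open>\<Omega> = (v \<otimes> v) \<Delta>(v\<^sup>-\<^sup>1)\<close>, and invariance of \<open>\<Omega>\<close>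
  means that \<open>v\<close> normalises the group (\<open>symmetric_coboundary\<close>).  Thus the cohomology group is the group
  of automorphisms induced by such units modulo inner automorphisms (\<open>cob_mult\<close>, \<open>cob_inner\<close>).
  They preserve conjugacy classes.

  Up to inner automorphisms the only class-preserving automorphisms are the identity and the one that
  fixes \<open>u\<close> and \<open>s\<close> and maps \<open>t\<close> to \<open>z t\<close> (\<open>normalisers_classification\<close>).  The second is not inner
  (\<open>v0_outer\<close>), and it is induced by an explicit unit \<open>v0\<close> whose square is central.  So there are
  exactly two classes.
\<close>

section \<open>Group algebras and push-forward along homomorphisms\<close>

abbreviation conv (infixl \<open>\<star>\<index>\<close> 70) where
  "f \<star>\<^bsub>G\<^esub> g \<equiv> f \<otimes>\<^bsub>mult_monoid (group_algebra G)\<^esub> g"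

text \<open>  The coproduct on one leg, the embeddings of legs and the permutations of legs of a tensor power of
  a group algebra are all linear extensions of group homomorphisms.  Multiplicativity and
  functoriality of \<open>push\<close> therefore replace most computations with pure tensors.
\<close>

definition push :: "('a, 'x) monoid_scheme \<Rightarrow> ('a \<Rightarrow> 'b) \<Rightarrow> ('a \<Rightarrow> complex) \<Rightarrow> 'b \<Rightarrow> complex" where
  "push K \<phi> f = (\<lambda>y. \<Sum>x\<in>carrier K. f x * single (\<phi> x) y)"

locale fin_group = group G for G (structure) +
  assumes fin [simp]: "finite (carrier G)"
begin

abbreviation "alg \<equiv> mult_monoid (group_algebra G)"
abbreviation "vec \<equiv> vecs (carrier G)"

lemma conv_sum: "(f \<star> g) z = (\<Sum>x\<in>carrier G. \<Sum>y\<in>carrier G. f x * g y * single (x \<otimes> y) z)"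
  by (rule ga_mult[OF group_axioms fin])

lemma conv_closed [simp]: "f \<star> g \<in> vec"
  by (rule ga_mult_closed[OF group_axioms fin])

lemma conv_sum_mult: "(\<Sum>p\<in>carrier G. (f \<star> g) p * F p) =
   (\<Sum>x\<in>carrier G. \<Sum>y\<in>carrier G. f x * g y * F (x \<otimes> y))"
  by (rule ga_sum_mult[OF group_axioms fin])

lemma conv_assoc: "f \<star> g \<star> h = f \<star> (g \<star> h)"
  by (rule ga_mult_assoc[OF group_axioms fin])

sublocale A: monoid alg
  rewrites "carrier alg = vec" and "\<one>\<^bsub>alg\<^esub> = single \<one>"
  using ga_monoid[OF group_axioms fin] by (simp_all add: ga_basis[OF group_axioms fin])

lemma vec_outside: "f \<in> vec \<Longrightarrow> x \<notin> carrier G \<Longrightarrow> f x = 0"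
  by (simp add: vecs_def)

lemma vec_eqI: "f \<in> vec \<Longrightarrow> g \<in> vec \<Longrightarrow> (\<And>x. x \<in> carrier G \<Longrightarrow> f x = g x) \<Longrightarrow> f = g"
  unfolding vecs_def fun_eq_iff by (metis (mono_tags) mem_Collect_eq)

lemma single_vec [simp]: "a \<in> carrier G \<Longrightarrow> single a \<in> vec"
  by (rule single_in_vecs)

lemma conv_left: "z \<in> carrier G \<Longrightarrow> (f \<star> g) z = (\<Sum>x\<in>carrier G. f x * g (inv x \<otimes> z))"
proof -
  assume z: "z \<in> carrier G"
  have "(\<Sum>y\<in>carrier G. f x * g y * single (x \<otimes> y) z) = f x * g (inv x \<otimes> z)" if x: "x \<in> carrier G" for x
  proof -
    have "single (x \<otimes> y) z = single (inv x \<otimes> z) y" if "y \<in> carrier G" for y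
      using x z that by (auto simp: single_def inv_solve_left inv_solve_left')
    then have "(\<Sum>y\<in>carrier G. f x * g y * single (x \<otimes> y) z) = (\<Sum>y\<in>carrier G. (f x * g y) * single (inv x \<otimes> z) y)"
      by (intro sum.cong) auto
    then show ?thesis using x z by (simp add: sum_single(3)[OF fin])
  qed
  then show ?thesis by (simp add: conv_sum)
qed

lemma conv_right: "z \<in> carrier G \<Longrightarrow> (f \<star> g) z = (\<Sum>y\<in>carrier G. f (z \<otimes> inv y) * g y)"
proof -
  assume z: "z \<in> carrier G"
  show ?thesis unfolding conv_left[OF z]
    by (rule sum.reindex_bij_witness[where i="\<lambda>y. z \<otimes> inv y" and j="\<lambda>x. inv x \<otimes> z"])
       (use z in \<open>auto simp: inv_mult_group m_assoc[symmetric]\<close>, auto simp: m_assoc)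
qed

lemma single_conv: "a \<in> carrier G \<Longrightarrow> z \<in> carrier G \<Longrightarrow> (single a \<star> f) z = f (inv a \<otimes> z)"
  by (simp add: conv_left sum_single(4)[OF fin])

lemma conv_single: "a \<in> carrier G \<Longrightarrow> z \<in> carrier G \<Longrightarrow> (f \<star> single a) z = f (z \<otimes> inv a)"
  by (simp add: conv_right sum_single(3)[OF fin])

lemma single_conv_single: 
  assumes "a \<in> carrier G" "b \<in> carrier G" shows "single a \<star> single b = single (a \<otimes> b)"
  by (rule vec_eqI) (use assms in \<open>auto simp: single_conv, auto simp: single_def inv_solve_left'\<close>)

lemma commute_single_iff:
  assumes f: "f \<in> vec" and k: "k \<in> carrier G"
  shows "f \<star> single k = single k \<star> f \<longleftrightarrow> (\<forall>z\<in>carrier G. f (k \<otimes> z \<otimes> inv k) = f z)"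
proof
  assume h: "f \<star> single k = single k \<star> f"
  show "\<forall>z\<in>carrier G. f (k \<otimes> z \<otimes> inv k) = f z"
  proof
    fix z assume z: "z \<in> carrier G"
    have "(f \<star> single k) (k \<otimes> z) = (single k \<star> f) (k \<otimes> z)" using h by simp
    then show "f (k \<otimes> z \<otimes> inv k) = f z"
      using z k by (simp add: conv_single single_conv m_assoc[symmetric])
  qed
next
  assume h: "\<forall>z\<in>carrier G. f (k \<otimes> z \<otimes> inv k) = f z"
  show "f \<star> single k = single k \<star> f"
  proof (rule vec_eqI)
    fix z assume z: "z \<in> carrier G"
    have "f (k \<otimes> (inv k \<otimes> z) \<otimes> inv k) = f (inv k \<otimes> z)" using h z k by auto
    then show "(f \<star> single k) z = (single k \<star> f) z"
      using z k by (simp add: conv_single single_conv m_assoc[symmetric])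
  qed auto
qed

lemma conv_add: "f \<star> (\<lambda>x. a * g x + b * h x) = (\<lambda>z. a * (f \<star> g) z + b * (f \<star> h) z)"
   "(\<lambda>x. a * g x + b * h x) \<star> f = (\<lambda>z. a * (g \<star> f) z + b * (h \<star> f) z)"
  by (auto simp: conv_sum sum_distrib_left sum.distrib[symmetric] algebra_simps fun_eq_iff)

lemma conv_scale: "f \<star> (\<lambda>x. a * g x) = (\<lambda>z. a * (f \<star> g) z)"
   "(\<lambda>x. a * g x) \<star> f = (\<lambda>z. a * (g \<star> f) z)"
  by (auto simp: conv_sum sum_distrib_left algebra_simps fun_eq_iff)

lemma conv_sum_right: "(f \<star> (\<lambda>x. \<Sum>i\<in>I. c i * g i x)) z = (\<Sum>i\<in>I. c i * (f \<star> g i) z)"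
proof (cases "finite I")
  case True
  then show ?thesis
  proof induction
    case (insert i I)
    then show ?case using conv_add(1)[of f "c i" "g i" 1 "\<lambda>x. \<Sum>i\<in>I. c i * g i x"]
      by (simp add: fun_eq_iff)
  qed (simp add: conv_sum)
qed (simp add: conv_sum)

lemma conv_sum_left: "((\<lambda>x. \<Sum>i\<in>I. c i * g i x) \<star> f) z = (\<Sum>i\<in>I. c i * (g i \<star> f) z)"
proof (cases "finite I")
  case True
  then show ?thesis
  proof induction
    case (insert i I)
    then show ?case using conv_add(2)[of "c i" "g i" 1 "\<lambda>x. \<Sum>i\<in>I. c i * g i x" f]
      by (simp add: fun_eq_iff)
  qed (simp add: conv_sum)
qed (simp add: conv_sum)

lemma vec_expand: "f \<in> vec \<Longrightarrow> f = (\<lambda>x. \<Sum>a\<in>carrier G. f a * single a x)"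
  by (rule ext) (auto simp: sum_single(1)[OF fin] vecs_def)

lemma conv_push: "f \<star> push K \<phi> g = (\<lambda>z. \<Sum>x\<in>carrier K. g x * (f \<star> single (\<phi> x)) z)"
  unfolding push_def by (rule ext) (rule conv_sum_right)

lemma push_conv: "push K \<phi> g \<star> f = (\<lambda>z. \<Sum>x\<in>carrier K. g x * (single (\<phi> x) \<star> f) z)"
  unfolding push_def by (rule ext) (rule conv_sum_left)

lemma commute_push:
  assumes "\<And>x. x \<in> carrier K \<Longrightarrow> f \<star> single (\<phi> x) = single (\<phi> x) \<star> f"
  shows "f \<star> push K \<phi> g = push K \<phi> g \<star> f"
  by (simp add: conv_push push_conv assms cong: sum.cong)

lemma commute_all:
  assumes "\<And>x. x \<in> carrier G \<Longrightarrow> f \<star> single x = single x \<star> f" and "g \<in> vec"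
  shows "f \<star> g = g \<star> f"
proof -
  have "g = push G (\<lambda>x. x) g" unfolding push_def by (rule vec_expand[OF assms(2)])
  then show ?thesis using commute_push[of G f "\<lambda>x. x" g] assms(1) by simp
qed

text \<open>
  Class functions are the traces of the group algebra; hence they cannot distinguish a group element
  from its conjugates under units of the group algebra.
\<close>

lemma class_function_trace:
  assumes F: "\<And>x y. x \<in> carrier G \<Longrightarrow> y \<in> carrier G \<Longrightarrow> F (x \<otimes> y) = F (y \<otimes> x)"
  shows "(\<Sum>p\<in>carrier G. (f \<star> g) p * F p) = (\<Sum>p\<in>carrier G. (g \<star> f) p * F p)"
  by (simp only: conv_sum_mult, subst sum.swap) (auto intro!: sum.cong simp: F mult_ac)

end

lemma fin_group_DirProd: "fin_group G \<Longrightarrow> fin_group H \<Longrightarrow> fin_group (G \<times>\<times> H)"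
  by (simp add: fin_group_def fin_group_axioms_def DirProd_group)

lemma push_closed: "(\<And>x. x \<in> carrier K \<Longrightarrow> \<phi> x \<in> B) \<Longrightarrow> push K \<phi> f \<in> vecs B"
  by (auto simp: push_def vecs_def single_def intro!: sum.neutral)

lemma push_push:
  assumes "finite (carrier L)" "\<And>x. x \<in> carrier K \<Longrightarrow> \<phi> x \<in> carrier L"
  shows "push L \<psi> (push K \<phi> f) = push K (\<lambda>x. \<psi> (\<phi> x)) f"
proof
  fix y
  have "push L \<psi> (push K \<phi> f) y = (\<Sum>w\<in>carrier L. \<Sum>x\<in>carrier K. f x * (single (\<phi> x) w * single (\<psi> w) y))"
    by (simp add: push_def sum_distrib_right sum_distrib_left mult_ac)
  also have "\<dots> = (\<Sum>x\<in>carrier K. f x * (\<Sum>w\<in>carrier L. single (\<phi> x) w * single (\<psi> w) y))"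
    by (subst sum.swap) (simp add: sum_distrib_left)
  also have "\<dots> = push K (\<lambda>x. \<psi> (\<phi> x)) f y"
    using assms by (auto simp: push_def sum_single(4) intro!: sum.cong)
  finally show "push L \<psi> (push K \<phi> f) y = push K (\<lambda>x. \<psi> (\<phi> x)) f y" .
qed

lemma push_inj:
  assumes "finite (carrier K)" "inj_on \<phi> (carrier K)" "x \<in> carrier K"
  shows "push K \<phi> f (\<phi> x) = f x"
proof -
  have "push K \<phi> f (\<phi> x) = (\<Sum>w\<in>carrier K. f w * single x w)"
    unfolding push_def using assms(2,3) by (intro sum.cong) (auto simp: single_def inj_on_def)
  then show ?thesis using assms by (simp add: sum_single(3))
qed

lemma push_outside: "y \<notin> \<phi> ` carrier K \<Longrightarrow> push K \<phi> f y = 0"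
  by (auto simp: push_def single_def intro!: sum.neutral)

lemma push_single: "finite (carrier K) \<Longrightarrow> a \<in> carrier K \<Longrightarrow> push K \<phi> (single a) = single (\<phi> a)"
  by (rule ext) (simp add: push_def sum_single(4))

lemma push_mult:
  assumes K: "fin_group K" and L: "fin_group L" and \<phi>: "\<phi> \<in> hom K L"
  shows "push K \<phi> (f \<star>\<^bsub>K\<^esub> g) = push K \<phi> f \<star>\<^bsub>L\<^esub> push K \<phi> g"
proof
  fix z
  interpret K: fin_group K by fact
  interpret L: fin_group L by fact
  have "push K \<phi> (f \<star>\<^bsub>K\<^esub> g) z = (\<Sum>x\<in>carrier K. \<Sum>y\<in>carrier K. f x * g y * single (\<phi> (x \<otimes>\<^bsub>K\<^esub> y)) z)"
    by (simp add: push_def K.conv_sum_mult)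
  also have "\<dots> = (\<Sum>x\<in>carrier K. \<Sum>y\<in>carrier K. f x * g y * (single (\<phi> x) \<star>\<^bsub>L\<^esub> single (\<phi> y)) z)"
    using \<phi> by (auto intro!: sum.cong simp: hom_def L.single_conv_single Pi_iff)
  also have "\<dots> = (push K \<phi> f \<star>\<^bsub>L\<^esub> push K \<phi> g) z"
    by (subst L.push_conv) (simp add: L.conv_push sum_distrib_left mult_ac)
  finally show "push K \<phi> (f \<star>\<^bsub>K\<^esub> g) z = (push K \<phi> f \<star>\<^bsub>L\<^esub> push K \<phi> g) z" .
qed

lemma push_one:
  assumes K: "fin_group K" and L: "fin_group L" and \<phi>: "\<phi> \<in> hom K L"
  shows "push K \<phi> (single \<one>\<^bsub>K\<^esub>) = single \<one>\<^bsub>L\<^esub>"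
proof -
  interpret K: fin_group K by fact
  interpret L: fin_group L by fact
  show ?thesis using push_single[OF K.fin, of "\<one>\<^bsub>K\<^esub>" \<phi>] hom_one[OF \<phi> K.group_axioms L.group_axioms] by simp
qed

section \<open>The Hopf algebra structure of a group algebra in terms of push-forwards\<close>

lemma mult_monoid_tensor_cong:
  assumes "basis A = basis A'" "basis_mult A = basis_mult A'" "unit_vec A = unit_vec A'"
    "basis B = basis B'" "basis_mult B = basis_mult B'" "unit_vec B = unit_vec B'"
  shows "mult_monoid (tensor_algebra A B) = mult_monoid (tensor_algebra A' B')"
  using assms by (simp add: mult_monoid_def tensor_algebra_def)

lemma tensor_group_algebra:
  "basis (tensor_algebra (group_algebra G) (group_algebra H)) = basis (group_algebra (G \<times>\<times> H))"
  "basis_mult (tensor_algebra (group_algebra G) (group_algebra H)) = basis_mult (group_algebra (G \<times>\<times> H))"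
  "unit_vec (tensor_algebra (group_algebra G) (group_algebra H)) = unit_vec (group_algebra (G \<times>\<times> H))"
  by (auto simp: tensor_algebra_def group_algebra_def DirProd_def tensor_single fun_eq_iff)

lemma mult_monoid_tensor_group_algebra:
  "mult_monoid (tensor_algebra (group_algebra G) (group_algebra H)) = mult_monoid (group_algebra (G \<times>\<times> H))"
  by (simp add: mult_monoid_def tensor_group_algebra)

lemma algebra3_group_algebra:
  "algebra3 (group_algebra G) = mult_monoid (group_algebra (G \<times>\<times> (G \<times>\<times> G)))"
  by (subst mult_monoid_tensor_group_algebra[symmetric], rule mult_monoid_tensor_cong)
     (simp_all add: tensor_group_algebra)

text \<open>  This is a locale of its own because making the square a sublocale of \<open>fin_group\<close> would
  produce squares of squares without end.
\<close>

locale fin_group_hopf = fin_group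
begin

abbreviation "G2 \<equiv> G \<times>\<times> G"
abbreviation "G3 \<equiv> G \<times>\<times> (G \<times>\<times> G)"

abbreviation conv2 (infixl \<open>\<star>\<^sub>2\<close> 70) where "f \<star>\<^sub>2 g \<equiv> f \<star>\<^bsub>G2\<^esub> g"
abbreviation conv3 (infixl \<open>\<star>\<^sub>3\<close> 70) where "f \<star>\<^sub>3 g \<equiv> f \<star>\<^bsub>G3\<^esub> g"

lemma fin_group_G: "fin_group G" by unfold_locales

lemma fin_group_G2: "fin_group G2" by (simp add: fin_group_DirProd fin_group_G)
lemma fin_group_G3: "fin_group G3" by (simp add: fin_group_DirProd fin_group_G)

sublocale G2: fin_group G2 by (rule fin_group_G2)
sublocale G3: fin_group G3 by (rule fin_group_G3)

definition Delta :: "('a \<Rightarrow> complex) \<Rightarrow> 'a \<times> 'a \<Rightarrow> complex" where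
  "Delta = push G (\<lambda>x. (x, x))"

lemma comult_eq: "comult (group_algebra G) = Delta"
  by (auto simp: comult_def lin_ext_def Delta_def push_def group_algebra_def tensor_single fun_eq_iff)

lemma id_comult_eq: "id_comult (group_algebra G) = push G2 (\<lambda>(x, y). (x, y, y))"
proof (intro ext)
  fix f :: "'a \<times> 'a \<Rightarrow> complex" and w
  have "(case p of (b, c) \<Rightarrow> id (single b) \<boxtimes> Delta (single c)) = single (case p of (x, y) \<Rightarrow> (x, y, y))"
    if "p \<in> carrier G \<times> carrier G" for p
    using that by (auto simp: Delta_def push_single tensor_single)
  then show "id_comult (group_algebra G) f w = push G2 (\<lambda>(x, y). (x, y, y)) f w"
    by (simp add: id_comult_def tensor_map_def lin_ext_def comult_eq push_def ga_basis[OF group_axioms fin])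
qed

lemma comult_id_eq: "comult_id (group_algebra G) = push G2 (\<lambda>(x, y). (x, x, y))"
proof (intro ext)
  fix f :: "'a \<times> 'a \<Rightarrow> complex" and w :: "'a \<times> 'a \<times> 'a"
  have "(case p of (b, c) \<Rightarrow> Delta (single b) \<boxtimes> id (single c)) = single (case p of (x, y) \<Rightarrow> ((x, x), y))"
    if "p \<in> carrier G \<times> carrier G" for p
    using that by (auto simp: Delta_def push_single tensor_single)
  moreover obtain a b c where "w = (a, b, c)" by (cases w)
  moreover have "single (case p of (x, y) \<Rightarrow> ((x, x), y)) ((a, b), c) = single (case p of (x, y) \<Rightarrow> (x, x, y)) (a, b, c)"
    for a b c and p :: "'a \<times> 'a"
    by (auto simp: single_def split: prod.splits)
  ultimately show "comult_id (group_algebra G) f w = push G2 (\<lambda>(x, y). (x, x, y)) f w"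
    by (simp add: comult_id_def tensor_map_def lin_ext_def comult_eq push_def reassoc_def ga_basis[OF group_axioms fin])
qed

lemma push_leg:
  assumes \<Omega>: "\<Omega> \<in> vecs (carrier G2)"
  shows "push G2 (\<lambda>(x, y). (x, y, \<one>)) \<Omega> = (\<lambda>(a, b, c). if c = \<one> then \<Omega> (a, b) else 0)"
    "push G2 (\<lambda>(x, y). (\<one>, x, y)) \<Omega> = (\<lambda>(a, b, c). if a = \<one> then \<Omega> (b, c) else 0)"
    "push G2 (\<lambda>(x, y). (x, \<one>, y)) \<Omega> = (\<lambda>(a, b, c). if b = \<one> then \<Omega> (a, c) else 0)"
proof -
  have ex: "push G2 \<phi> \<Omega> y = (\<Sum>p\<in>carrier G2. if \<phi> p = y then \<Omega> p else 0)" for \<phi> :: "'a \<times> 'a \<Rightarrow> 'a \<times> 'a \<times> 'a" and y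
    by (auto simp: push_def single_def intro!: sum.cong)
  have pr: "(\<Sum>p\<in>carrier G2. if p = q \<and> P then \<Omega> p else 0) = (if P then \<Omega> q else 0)" for q P
    using sum.delta[OF G2.fin, of q \<Omega>] G2.vec_outside[OF \<Omega>, of q] by (cases P) auto
  have "push G2 (\<lambda>(x, y). (x, y, \<one>)) \<Omega> (a, b, c) = (\<Sum>p\<in>carrier G2. if p = (a, b) \<and> c = \<one> then \<Omega> p else 0)" for a b c
    unfolding ex by (intro sum.cong) auto
  then show "push G2 (\<lambda>(x, y). (x, y, \<one>)) \<Omega> = (\<lambda>(a, b, c). if c = \<one> then \<Omega> (a, b) else 0)"
    unfolding pr by auto
  have "push G2 (\<lambda>(x, y). (\<one>, x, y)) \<Omega> (a, b, c) = (\<Sum>p\<in>carrier G2. if p = (b, c) \<and> a = \<one> then \<Omega> p else 0)" for a b c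
    unfolding ex by (intro sum.cong) auto
  then show "push G2 (\<lambda>(x, y). (\<one>, x, y)) \<Omega> = (\<lambda>(a, b, c). if a = \<one> then \<Omega> (b, c) else 0)"
    unfolding pr by auto
  have "push G2 (\<lambda>(x, y). (x, \<one>, y)) \<Omega> (a, b, c) = (\<Sum>p\<in>carrier G2. if p = (a, c) \<and> b = \<one> then \<Omega> p else 0)" for a b c
    unfolding ex by (intro sum.cong) auto
  then show "push G2 (\<lambda>(x, y). (x, \<one>, y)) \<Omega> = (\<lambda>(a, b, c). if b = \<one> then \<Omega> (a, c) else 0)"
    unfolding pr by auto
qed

lemma two_cocycle_iff:
  "two_cocycle (group_algebra G) \<Omega> \<longleftrightarrow> \<Omega> \<in> Units G2.alg \<and>
    push G2 (\<lambda>(x, y). (\<one>, x, y)) \<Omega> \<star>\<^sub>3 push G2 (\<lambda>(x, y). (x, y, y)) \<Omega> =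
    push G2 (\<lambda>(x, y). (x, y, \<one>)) \<Omega> \<star>\<^sub>3 push G2 (\<lambda>(x, y). (x, x, y)) \<Omega>"
proof -
  have "single \<one> \<boxtimes> \<Omega> = push G2 (\<lambda>(x, y). (\<one>, x, y)) \<Omega>"
    "reassoc (\<Omega> \<boxtimes> single \<one>) = push G2 (\<lambda>(x, y). (x, y, \<one>)) \<Omega>" if "\<Omega> \<in> Units G2.alg"
    unfolding push_leg[OF G2.A.Units_closed[OF that]]
    by (auto simp: tensor_def reassoc_def single_def fun_eq_iff)
  then show ?thesis
    by (auto simp: two_cocycle_def id_comult_eq comult_id_eq algebra3_group_algebra
        mult_monoid_tensor_group_algebra ga_basis[OF group_axioms fin])
qed

lemma invariant_iff:
  assumes \<Omega>: "\<Omega> \<in> vecs (carrier G2)"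
  shows "invariant (group_algebra G) \<Omega> \<longleftrightarrow>
    (\<forall>g\<in>carrier G. \<Omega> \<star>\<^sub>2 single (g, g) = single (g, g) \<star>\<^sub>2 \<Omega>)" (is "?l \<longleftrightarrow> ?r")
proof
  assume l: ?l
  show ?r
  proof
    fix g assume g: "g \<in> carrier G"
    show "\<Omega> \<star>\<^sub>2 single (g, g) = single (g, g) \<star>\<^sub>2 \<Omega>"
      using bspec[OF l[unfolded invariant_def ga_basis[OF group_axioms fin]] single_vec[OF g]]
        push_single[OF fin g, of "\<lambda>x. (x, x)"]
      by (simp add: comult_eq Delta_def mult_monoid_tensor_group_algebra)
  qed
next
  assume ?r
  then show ?l
    by (simp add: invariant_def ga_basis[OF group_axioms fin] comult_eq Delta_def mult_monoid_tensor_group_algebra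
      G2.commute_push)
qed

end

section \<open>The universal R-matrix of an invariant cocycle\<close>

context fin_group_hopf
begin

lemmas vec_prod_simps [simp] = G2.conv_closed[unfolded carrier_DirProd] G3.conv_closed[unfolded carrier_DirProd]

text \<open>  The map \<open>\<phi>\<close> lists the legs into which the two tensor factors are put.  In the abbreviations,
  an underscore separates the factors, and several digits on one side mean that the coproduct is
  applied to that factor.
\<close>

definition legs :: "('a \<Rightarrow> 'a \<Rightarrow> 'c) \<Rightarrow> ('a \<times> 'a \<Rightarrow> complex) \<Rightarrow> 'c \<Rightarrow> complex" where
  "legs \<phi> = push G2 (\<lambda>p. \<phi> (fst p) (snd p))"

abbreviation "leg12 \<equiv> legs (\<lambda>x y. (x, y, \<one>))"
abbreviation "leg23 \<equiv> legs (\<lambda>x y. (\<one>, x, y))"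
abbreviation "leg13 \<equiv> legs (\<lambda>x y. (x, \<one>, y))"
abbreviation "leg12_3 \<equiv> legs (\<lambda>x y. (x, x, y))"
abbreviation "leg1_23 \<equiv> legs (\<lambda>x y. (x, y, y))"

definition diag_invariant :: "('a \<times> 'a \<Rightarrow> complex) \<Rightarrow> bool" where
  "diag_invariant Z \<longleftrightarrow> Z \<in> G2.vec \<and> (\<forall>g\<in>carrier G. Z \<star>\<^sub>2 single (g, g) = single (g, g) \<star>\<^sub>2 Z)"

lemma two_cocycle_legs:
  "two_cocycle (group_algebra G) \<Omega> \<longleftrightarrow> \<Omega> \<in> Units G2.alg \<and>
    leg23 \<Omega> \<star>\<^sub>3 leg1_23 \<Omega> =
    leg12 \<Omega> \<star>\<^sub>3 leg12_3 \<Omega>"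
  unfolding two_cocycle_iff legs_def case_prod_unfold ..

lemma invariant_diag: "\<Omega> \<in> G2.vec \<Longrightarrow> invariant (group_algebra G) \<Omega> \<longleftrightarrow> diag_invariant \<Omega>"
  by (simp add: invariant_iff diag_invariant_def)

lemma legs_mult3:
  assumes "\<And>x y x' y'. \<lbrakk>x \<in> carrier G; y \<in> carrier G; x' \<in> carrier G; y' \<in> carrier G\<rbrakk>
    \<Longrightarrow> \<phi> x y \<in> carrier G3 \<and> \<phi> (x \<otimes> x') (y \<otimes> y') = \<phi> x y \<otimes>\<^bsub>G3\<^esub> \<phi> x' y'"
  shows "legs \<phi> (Z \<star>\<^sub>2 Y) = legs \<phi> Z \<star>\<^sub>3 legs \<phi> Y"
  unfolding legs_def
  by (rule push_mult[OF fin_group_G2 fin_group_G3]) (use assms in \<open>auto simp: hom_def DirProd_def\<close>)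

lemma legs_mult2:
  assumes "\<And>x y x' y'. \<lbrakk>x \<in> carrier G; y \<in> carrier G; x' \<in> carrier G; y' \<in> carrier G\<rbrakk>
    \<Longrightarrow> \<phi> x y \<in> carrier G2 \<and> \<phi> (x \<otimes> x') (y \<otimes> y') = \<phi> x y \<otimes>\<^bsub>G2\<^esub> \<phi> x' y'"
  shows "legs \<phi> (Z \<star>\<^sub>2 Y) = legs \<phi> Z \<star>\<^sub>2 legs \<phi> Y"
  unfolding legs_def
  by (rule push_mult[OF fin_group_G2 fin_group_G2]) (use assms in \<open>auto simp: hom_def DirProd_def\<close>)

lemma legs_vec3:
  assumes "\<And>x y. \<lbrakk>x \<in> carrier G; y \<in> carrier G\<rbrakk> \<Longrightarrow> \<phi> x y \<in> carrier G3"
  shows "legs \<phi> Z \<in> G3.vec"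
  unfolding legs_def by (rule push_closed) (use assms in auto)

lemma legs_vec2:
  assumes "\<And>x y. \<lbrakk>x \<in> carrier G; y \<in> carrier G\<rbrakk> \<Longrightarrow> \<phi> x y \<in> carrier G2"
  shows "legs \<phi> Z \<in> G2.vec"
  unfolding legs_def by (rule push_closed) (use assms in auto)

lemma push_legs3:
  assumes "\<And>x y. \<lbrakk>x \<in> carrier G; y \<in> carrier G\<rbrakk> \<Longrightarrow> \<phi> x y \<in> carrier G3"
  shows "push G3 \<rho> (legs \<phi> Z) = legs (\<lambda>x y. \<rho> (\<phi> x y)) Z"
  unfolding legs_def by (rule push_push) (use assms in auto)

lemma legs_legs:
  assumes "\<And>x y. \<lbrakk>x \<in> carrier G; y \<in> carrier G\<rbrakk> \<Longrightarrow> \<phi> x y \<in> carrier G2"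
  shows "legs \<psi> (legs \<phi> Z) = legs (\<lambda>x y. \<psi> (fst (\<phi> x y)) (snd (\<phi> x y))) Z"
  unfolding legs_def by (rule push_push) (use assms in auto)

lemma legs_one: "legs \<phi> (single (\<one>, \<one>)) = single (\<phi> \<one> \<one>)"
  unfolding legs_def by (subst push_single) auto

lemma legs_single: "x \<in> carrier G \<Longrightarrow> y \<in> carrier G \<Longrightarrow> legs \<phi> (single (x, y)) = single (\<phi> x y)"
  unfolding legs_def by (subst push_single) auto

lemma legs_id: "Z \<in> G2.vec \<Longrightarrow> legs Pair Z = Z"
  unfolding legs_def push_def using G2.vec_expand[of Z] by simp

lemma legs_at:
  assumes Z: "Z \<in> G2.vec"
  shows "leg12 Z (a, b, c) = (if c = \<one> then Z (a, b) else 0)"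
    "leg23 Z (a, b, c) = (if a = \<one> then Z (b, c) else 0)"
    "leg13 Z (a, b, c) = (if b = \<one> then Z (a, c) else 0)"
  using push_leg[OF Z] unfolding legs_def case_prod_unfold by auto

lemma diag_invariant_at:
  assumes "diag_invariant Z" "g \<in> carrier G" "a \<in> carrier G" "b \<in> carrier G"
  shows "Z (g \<otimes> a \<otimes> inv g, g \<otimes> b \<otimes> inv g) = Z (a, b)"
  using assms G2.commute_single_iff[of Z "(g, g)"]
  by (auto simp: diag_invariant_def inv_DirProd group_axioms)

lemma conj_one_iff: "g \<in> carrier G \<Longrightarrow> a \<in> carrier G \<Longrightarrow> g \<otimes> a \<otimes> inv g = \<one> \<longleftrightarrow> a = \<one>"
  by (metis inv_closed inv_solve_right' l_one m_closed r_inv r_one l_cancel one_closed)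

text \<open>  An invariant tensor commutes with everything that is diagonal on the two legs which it occupies.
\<close>

lemma diag_invariant_commute23:
  assumes "diag_invariant Z"
  shows "leg23 Z \<star>\<^sub>3 leg1_23 Y = leg1_23 Y \<star>\<^sub>3 leg23 Z"
  unfolding legs_def[of "\<lambda>x y. (x, y, y)"]
proof (rule G3.commute_push)
  fix p assume p: "p \<in> carrier G2"
  have Z: "Z \<in> G2.vec" using assms by (simp add: diag_invariant_def)
  show "leg23 Z \<star>\<^sub>3 single (fst p, snd p, snd p) = single (fst p, snd p, snd p) \<star>\<^sub>3 leg23 Z"
    using p legs_vec3[unfolded carrier_DirProd] by (subst G3.commute_single_iff)
      (auto simp: legs_at[OF Z] inv_DirProd group_axioms DirProd_group conj_one_iff diag_invariant_at[OF assms])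
qed

lemma diag_invariant_commute13:
  assumes "diag_invariant Z"
  shows "leg13 Z \<star>\<^sub>3 legs (\<lambda>x y. (x, y, x)) Y = legs (\<lambda>x y. (x, y, x)) Y \<star>\<^sub>3 leg13 Z"
  unfolding legs_def[of "\<lambda>x y. (x, y, x)"]
proof (rule G3.commute_push)
  fix p assume p: "p \<in> carrier G2"
  have Z: "Z \<in> G2.vec" using assms by (simp add: diag_invariant_def)
  show "leg13 Z \<star>\<^sub>3 single (fst p, snd p, fst p) = single (fst p, snd p, fst p) \<star>\<^sub>3 leg13 Z"
    using p legs_vec3[unfolded carrier_DirProd] by (subst G3.commute_single_iff)
      (auto simp: legs_at[OF Z] inv_DirProd group_axioms DirProd_group conj_one_iff diag_invariant_at[OF assms])
qed

definition flip :: "('a \<times> 'a \<Rightarrow> complex) \<Rightarrow> 'a \<times> 'a \<Rightarrow> complex" where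
  "flip = legs (\<lambda>x y. (y, x))"

lemma flip_vec [simp]: "flip Z \<in> G2.vec"
  unfolding flip_def by (rule legs_vec2) auto

lemmas flip_vec' [simp] = flip_vec[unfolded carrier_DirProd]

lemma flip_mult: "flip (Z \<star>\<^sub>2 Y) = flip Z \<star>\<^sub>2 flip Y"
  unfolding flip_def by (rule legs_mult2) auto

lemma legs_flip: "legs \<phi> (flip Z) = legs (\<lambda>x y. \<phi> y x) Z"
  unfolding flip_def by (subst legs_legs) auto

lemma flip_flip: "Z \<in> G2.vec \<Longrightarrow> flip (flip Z) = Z"
  by (subst flip_def, subst legs_flip) (rule legs_id)

lemma flip_single: "x \<in> carrier G \<Longrightarrow> y \<in> carrier G \<Longrightarrow> flip (single (x, y)) = single (y, x)"
  by (simp add: flip_def legs_single)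

lemma flip_at: "Z \<in> G2.vec \<Longrightarrow> flip Z (x, y) = Z (y, x)"
proof (cases "x \<in> carrier G \<and> y \<in> carrier G")
  case True
  then show ?thesis unfolding flip_def legs_def
    using push_inj[of G2 "\<lambda>p. (snd p, fst p)" "(y, x)" Z] by (auto simp: inj_on_def)
next
  case False
  assume "Z \<in> G2.vec"
  with False show ?thesis using G2.vec_outside[of Z "(y, x)"] G2.vec_outside[OF flip_vec, of "(x, y)" Z] by auto
qed

lemma diag_invariant_flip: "diag_invariant Z \<Longrightarrow> diag_invariant (flip Z)"
  unfolding diag_invariant_def
proof safe
  fix g assume g: "g \<in> carrier G" and h: "\<forall>g\<in>carrier G. Z \<star>\<^sub>2 single (g, g) = single (g, g) \<star>\<^sub>2 Z"
  have "flip (Z \<star>\<^sub>2 single (g, g)) = flip (single (g, g) \<star>\<^sub>2 Z)" using h g by simp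
  then show "flip Z \<star>\<^sub>2 single (g, g) = single (g, g) \<star>\<^sub>2 flip Z"
    using g by (simp add: flip_mult flip_single)
qed simp

lemma diag_invariant_mult: "diag_invariant Z \<Longrightarrow> diag_invariant Y \<Longrightarrow> diag_invariant (Z \<star>\<^sub>2 Y)"
  unfolding diag_invariant_def by (metis G2.conv_assoc G2.conv_closed)

lemma diag_invariant_inv:
  assumes Z: "diag_invariant Z" and I: "I \<in> G2.vec" "Z \<star>\<^sub>2 I = single (\<one>, \<one>)" "I \<star>\<^sub>2 Z = single (\<one>, \<one>)"
  shows "diag_invariant I"
  unfolding diag_invariant_def
proof (intro conjI ballI)
  fix g assume g: "g \<in> carrier G"
  have one: "single (\<one>, \<one>) \<star>\<^sub>2 Y = Y" "Y \<star>\<^sub>2 single (\<one>, \<one>) = Y" if "Y \<in> G2.vec" for Y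
    using G2.A.l_one[OF that] G2.A.r_one[OF that] by auto
  let ?s = "single (g, g)"
  have "I \<star>\<^sub>2 ?s = I \<star>\<^sub>2 (?s \<star>\<^sub>2 Z) \<star>\<^sub>2 I"
    using g I by (simp add: G2.conv_assoc one single_in_vecs)
  also have "\<dots> = I \<star>\<^sub>2 (Z \<star>\<^sub>2 ?s) \<star>\<^sub>2 I"
    using Z g by (simp add: diag_invariant_def)
  also have "\<dots> = ?s \<star>\<^sub>2 I"
    by (simp add: G2.conv_assoc[symmetric] I) (simp add: G2.conv_assoc one)
  finally show "I \<star>\<^sub>2 ?s = ?s \<star>\<^sub>2 I" .
qed (rule I)

end

text \<open>  The inverse is a parameter so that all identities below are equations between explicit products.
\<close>

locale invariant_cocycle = fin_group_hopf +
  fixes \<Omega> \<Omega>i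
  assumes \<Omega>_vec: "\<Omega> \<in> G2.vec" and \<Omega>i_vec: "\<Omega>i \<in> G2.vec"
    and \<Omega>_\<Omega>i: "\<Omega> \<star>\<^sub>2 \<Omega>i = single (\<one>, \<one>)" and \<Omega>i_\<Omega>: "\<Omega>i \<star>\<^sub>2 \<Omega> = single (\<one>, \<one>)"
    and cocycle: "leg23 \<Omega> \<star>\<^sub>3 leg1_23 \<Omega> =
      leg12 \<Omega> \<star>\<^sub>3 leg12_3 \<Omega>"
    and \<Omega>_inv: "diag_invariant \<Omega>"
begin

text \<open>  Conjugation by an invariant cocycle does not change the coproduct, but it carries the trivial
  triangular structure of the cocommutative group algebra to \<open>R\<close>.  Writing \<open>\<tau>\<close> for the flip
  of the two tensor factors, \<open>R \<tau> = \<Omega>\<^sup>-\<^sup>1 \<tau> \<Omega>\<close>.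
\<close>

definition R :: "'a \<times> 'a \<Rightarrow> complex" where
  "R = \<Omega>i \<star>\<^sub>2 flip \<Omega>"

lemma R_vec [simp]: "R \<in> G2.vec" by (simp add: R_def)

lemmas R_vec' [simp] = R_vec[unfolded carrier_DirProd]

lemma one2 [simp]: "Z \<in> G2.vec \<Longrightarrow> single (\<one>, \<one>) \<star>\<^sub>2 Z = Z" "Z \<in> G2.vec \<Longrightarrow> Z \<star>\<^sub>2 single (\<one>, \<one>) = Z"
  using G2.A.l_one[of Z] G2.A.r_one[of Z] by auto

lemmas one2' [simp] = one2[unfolded carrier_DirProd]

lemma one3 [simp]: "Z \<in> G3.vec \<Longrightarrow> single (\<one>, \<one>, \<one>) \<star>\<^sub>3 Z = Z" "Z \<in> G3.vec \<Longrightarrow> Z \<star>\<^sub>3 single (\<one>, \<one>, \<one>) = Z"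
  using G3.A.l_one[of Z] G3.A.r_one[of Z] by auto

lemmas one3' [simp] = one3[unfolded carrier_DirProd]

lemma \<Omega>_R: "\<Omega> \<star>\<^sub>2 R = flip \<Omega>"
  by (simp add: R_def G2.conv_assoc[symmetric] \<Omega>_\<Omega>i)

lemma R_inv: "diag_invariant R"
  unfolding R_def
  by (intro diag_invariant_mult diag_invariant_flip \<Omega>_inv diag_invariant_inv[OF \<Omega>_inv \<Omega>i_vec \<Omega>_\<Omega>i \<Omega>i_\<Omega>])

lemma R_flip: "R \<star>\<^sub>2 flip R = single (\<one>, \<one>)"
proof -
  have "flip \<Omega> \<star>\<^sub>2 flip \<Omega>i = single (\<one>, \<one>)"
    using flip_mult[of \<Omega> \<Omega>i] by (simp add: \<Omega>_\<Omega>i flip_single)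
  then have "R \<star>\<^sub>2 flip R = \<Omega>i \<star>\<^sub>2 (single (\<one>, \<one>) \<star>\<^sub>2 flip (flip \<Omega>))"
    by (simp add: R_def flip_mult G2.conv_assoc) (simp add: G2.conv_assoc[symmetric])
  then show ?thesis using \<Omega>_vec by (simp add: flip_flip[OF \<Omega>_vec] \<Omega>i_\<Omega>)
qed

lemma flip_R: "flip R \<star>\<^sub>2 R = single (\<one>, \<one>)"
  using arg_cong[OF R_flip, of flip] by (simp add: flip_mult flip_flip[OF R_vec] flip_single)

text \<open>  The cocycle identity and its images under two permutations of the legs express \<open>\<Omega>\<close> on
  \<open>(y, y, x)\<close>, that is the flipped \<open>\<Omega>\<close> after coproduct, through \<open>\<Omega>\<close> on pairs of legs.  Invariance
  allows the factors to be reordered so that everything except two copies of \<open>R\<close> cancels.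
\<close>

lemma R_hexagon1:
  "leg12_3 R = leg23 R \<star>\<^sub>3 leg13 R"
proof -
  let ?L = legs
  note m = legs_mult3
  let ?a = "leg12 \<Omega> \<star>\<^sub>3 leg12_3 \<Omega>"
  have c2: "leg12 \<Omega> \<star>\<^sub>3 legs (\<lambda>x y. (y, y, x)) \<Omega> =
      legs (\<lambda>x y. (y, \<one>, x)) \<Omega> \<star>\<^sub>3 legs (\<lambda>x y. (x, y, x)) \<Omega>"
  proof -
    have h: "(\<lambda>p. (fst (snd p), snd (snd p), fst p)) \<in> hom G3 G3" by (auto simp: hom_def)
    show ?thesis
      using arg_cong[OF cocycle, of "push G3 (\<lambda>p. (fst (snd p), snd (snd p), fst p))"]
      by (simp add: push_mult[OF fin_group_G3 fin_group_G3 h] push_legs3)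
  qed
  have c3: "legs (\<lambda>x y. (\<one>, y, x)) \<Omega> \<star>\<^sub>3 leg1_23 \<Omega> =
      leg13 \<Omega> \<star>\<^sub>3 legs (\<lambda>x y. (x, y, x)) \<Omega>"
  proof -
    have h: "(\<lambda>p. (fst p, snd (snd p), fst (snd p))) \<in> hom G3 G3" by (auto simp: hom_def)
    show ?thesis
      using arg_cong[OF cocycle, of "push G3 (\<lambda>p. (fst p, snd (snd p), fst (snd p)))"]
      by (simp add: push_mult[OF fin_group_G3 fin_group_G3 h] push_legs3)
  qed
  have R23: "leg23 \<Omega> \<star>\<^sub>3 leg23 R = legs (\<lambda>x y. (\<one>, y, x)) \<Omega>"
    by (subst m[symmetric]) (auto simp: \<Omega>_R legs_flip)
  have R13: "leg13 \<Omega> \<star>\<^sub>3 leg13 R = legs (\<lambda>x y. (y, \<one>, x)) \<Omega>"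
    by (subst m[symmetric]) (auto simp: \<Omega>_R legs_flip)
  have R12_3: "leg12_3 \<Omega> \<star>\<^sub>3 leg12_3 R = legs (\<lambda>x y. (y, y, x)) \<Omega>"
    by (subst m[symmetric]) (auto simp: \<Omega>_R legs_flip)
  have k1: "leg13 \<Omega> \<star>\<^sub>3 legs (\<lambda>x y. (x, y, x)) \<Omega> = legs (\<lambda>x y. (x, y, x)) \<Omega> \<star>\<^sub>3 leg13 \<Omega>"
    by (rule diag_invariant_commute13[OF \<Omega>_inv])
  have k2: "legs (\<lambda>x y. (y, \<one>, x)) \<Omega> \<star>\<^sub>3 legs (\<lambda>x y. (x, y, x)) \<Omega> = legs (\<lambda>x y. (x, y, x)) \<Omega> \<star>\<^sub>3 legs (\<lambda>x y. (y, \<one>, x)) \<Omega>"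
    using diag_invariant_commute13[OF diag_invariant_flip[OF \<Omega>_inv], of \<Omega>] by (simp add: legs_flip)
  have k3: "leg23 R \<star>\<^sub>3 leg1_23 \<Omega> = leg1_23 \<Omega> \<star>\<^sub>3 leg23 R"
    by (rule diag_invariant_commute23[OF R_inv])
  have "?a \<star>\<^sub>3 leg12_3 R = legs (\<lambda>x y. (x, y, x)) \<Omega> \<star>\<^sub>3 legs (\<lambda>x y. (y, \<one>, x)) \<Omega>"
    by (simp add: G3.conv_assoc R12_3 c2 k2)
  also have "\<dots> = legs (\<lambda>x y. (\<one>, y, x)) \<Omega> \<star>\<^sub>3 leg1_23 \<Omega> \<star>\<^sub>3 leg13 R"
    by (simp add: c3 k1 G3.conv_assoc R13)
  also have "\<dots> = leg23 \<Omega> \<star>\<^sub>3 (leg23 R \<star>\<^sub>3 leg1_23 \<Omega>) \<star>\<^sub>3 leg13 R"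
    by (simp add: R23[symmetric] G3.conv_assoc)
  also have "\<dots> = ?a \<star>\<^sub>3 (leg23 R \<star>\<^sub>3 leg13 R)"
    by (simp add: k3 cocycle[symmetric] G3.conv_assoc)
  finally have e: "?a \<star>\<^sub>3 leg12_3 R = ?a \<star>\<^sub>3 (leg23 R \<star>\<^sub>3 leg13 R)" .
  have i1: "leg12 \<Omega>i \<star>\<^sub>3 leg12 \<Omega> = single (\<one>, \<one>, \<one>)"
    by (subst m[symmetric]) (auto simp: \<Omega>i_\<Omega> legs_one)
  have i2: "leg12_3 \<Omega>i \<star>\<^sub>3 leg12_3 \<Omega> = single (\<one>, \<one>, \<one>)"
    by (subst m[symmetric]) (auto simp: \<Omega>i_\<Omega> legs_one)
  have u: "leg12_3 \<Omega>i \<star>\<^sub>3 leg12 \<Omega>i \<star>\<^sub>3 ?a = single (\<one>, \<one>, \<one>)"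
  proof -
    have "leg12_3 \<Omega>i \<star>\<^sub>3 leg12 \<Omega>i \<star>\<^sub>3 ?a =
      leg12_3 \<Omega>i \<star>\<^sub>3 ((leg12 \<Omega>i \<star>\<^sub>3 leg12 \<Omega>) \<star>\<^sub>3 leg12_3 \<Omega>)"
      by (simp add: G3.conv_assoc)
    then show ?thesis unfolding i1 by (simp add: i2 legs_vec3[unfolded carrier_DirProd])
  qed
  have "leg12_3 \<Omega>i \<star>\<^sub>3 leg12 \<Omega>i \<star>\<^sub>3 (?a \<star>\<^sub>3 leg12_3 R)
    = leg12_3 \<Omega>i \<star>\<^sub>3 leg12 \<Omega>i \<star>\<^sub>3 (?a \<star>\<^sub>3 (leg23 R \<star>\<^sub>3 leg13 R))"
    by (simp only: e)
  then show ?thesis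
    unfolding G3.conv_assoc[symmetric, of _ ?a] u by (simp add: legs_vec3[unfolded carrier_DirProd])
qed

text \<open>  A cyclic permutation of the legs turns the first hexagon into one for the flip of \<open>R\<close>, which is
  the inverse of \<open>R\<close>; inverting both sides reverses the product.
\<close>

lemma R_hexagon2:
  "leg1_23 R = leg12 R \<star>\<^sub>3 leg13 R"
proof -
  have h: "(\<lambda>p. (snd (snd p), fst p, fst (snd p))) \<in> hom G3 G3" by (auto simp: hom_def)
  have f: "legs (\<lambda>x y. (y, x, x)) R = legs (\<lambda>x y. (y, \<one>, x)) R \<star>\<^sub>3 legs (\<lambda>x y. (y, x, \<one>)) R"
    using arg_cong[OF R_hexagon1, of "push G3 (\<lambda>p. (snd (snd p), fst p, fst (snd p)))"]
    by (simp add: push_mult[OF fin_group_G3 fin_group_G3 h] push_legs3)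
  have i: "legs \<phi> R \<star>\<^sub>3 legs (\<lambda>x y. \<phi> y x) R = single (\<phi> \<one> \<one>)" 
    "legs (\<lambda>x y. \<phi> y x) R \<star>\<^sub>3 legs \<phi> R = single (\<phi> \<one> \<one>)" 
    if "\<And>x y x' y'. \<lbrakk>x \<in> carrier G; y \<in> carrier G; x' \<in> carrier G; y' \<in> carrier G\<rbrakk>
    \<Longrightarrow> \<phi> x y \<in> carrier G3 \<and> \<phi> (x \<otimes> x') (y \<otimes> y') = \<phi> x y \<otimes>\<^bsub>G3\<^esub> \<phi> x' y'" for \<phi>
    using legs_mult3[of \<phi> R "flip R", OF that] legs_mult3[of \<phi> "flip R" R, OF that] 
    by (auto simp: R_flip flip_R legs_flip legs_one)
  let ?P = "leg1_23 R" and ?Q = "legs (\<lambda>x y. (y, x, x)) R"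
  let ?S = "leg12 R \<star>\<^sub>3 leg13 R"
  have 1: "?P \<star>\<^sub>3 ?Q = single (\<one>, \<one>, \<one>)" by (subst i(1)) auto
  have 2: "?Q \<star>\<^sub>3 ?S = single (\<one>, \<one>, \<one>)"
  proof -
    have a: "legs (\<lambda>x y. (y, x, \<one>)) R \<star>\<^sub>3 leg12 R = single (\<one>, \<one>, \<one>)"
      by (subst i(2)) auto
    have b: "legs (\<lambda>x y. (y, \<one>, x)) R \<star>\<^sub>3 leg13 R = single (\<one>, \<one>, \<one>)"
      by (subst i(2)) auto
    have "?Q \<star>\<^sub>3 ?S = legs (\<lambda>x y. (y, \<one>, x)) R \<star>\<^sub>3 (legs (\<lambda>x y. (y, x, \<one>)) R \<star>\<^sub>3 leg12 R) \<star>\<^sub>3 leg13 R"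
      by (simp add: f G3.conv_assoc)
    then show ?thesis unfolding a by (simp add: b legs_vec3[unfolded carrier_DirProd])
  qed
  have "?P = ?P \<star>\<^sub>3 (?Q \<star>\<^sub>3 ?S)" by (simp add: 2 legs_vec3[unfolded carrier_DirProd])
  also have "\<dots> = ?S" by (simp add: G3.conv_assoc[symmetric] 1) (simp add: G3.conv_assoc)
  finally show ?thesis .
qed

end

section \<open>The structure of the R-matrix\<close>

context fin_group_hopf
begin

lemma mult_eq_one_iff: "x \<in> carrier G \<Longrightarrow> y \<in> carrier G \<Longrightarrow> x \<otimes> y = \<one> \<longleftrightarrow> y = inv x"
  using inv_solve_left[of y x \<one>] by (simp only: r_one inv_closed one_closed) (rule eq_commute)

lemma conv_23_13:
  assumes "U \<in> G2.vec" "V \<in> G2.vec" and abh: "a \<in> carrier G" "b \<in> carrier G" "h \<in> carrier G"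
  shows "(leg23 U \<star>\<^sub>3 leg13 V) (a, b, h) =
    ((\<lambda>y. U (b, y)) \<star> (\<lambda>y. V (a, y))) h"
proof -
  have "(leg23 U \<star>\<^sub>3 leg13 V) (a, b, h) =
    (\<Sum>x\<in>carrier G. \<Sum>y\<in>carrier G. \<Sum>z\<in>carrier G. (if x = \<one> then U (y, z) else 0) * (if inv y \<otimes> b = \<one> then V (inv x \<otimes> a, inv z \<otimes> h) else 0))"
    using abh by (subst G3.conv_left)
      (auto simp: sum.cartesian_product legs_at[OF assms(1)] legs_at[OF assms(2)] inv_DirProd group_axioms DirProd_group split_def intro!: sum.cong)
  also have "\<dots> = (\<Sum>x\<in>carrier G. \<Sum>y\<in>carrier G. if y = b then if x = \<one> then (\<Sum>z\<in>carrier G. U (b, z) * V (a, inv z \<otimes> h)) else 0 else 0)"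
  proof (intro sum.cong refl)
    fix x y assume x: "x \<in> carrier G" and y: "y \<in> carrier G"
    have "inv y \<otimes> b = \<one> \<longleftrightarrow> y = b"
      using y abh by (auto simp: mult_eq_one_iff)
    then show "(\<Sum>z\<in>carrier G. (if x = \<one> then U (y, z) else 0) * (if inv y \<otimes> b = \<one> then V (inv x \<otimes> a, inv z \<otimes> h) else 0)) =
      (if y = b then if x = \<one> then (\<Sum>z\<in>carrier G. U (b, z) * V (a, inv z \<otimes> h)) else 0 else 0)"
      using abh by simp
  qed
  also have "\<dots> = ((\<lambda>y. U (b, y)) \<star> (\<lambda>y. V (a, y))) h"
    using abh by (simp add: conv_left)
  finally show ?thesis .
qed

lemma conv_12_13:
  assumes "U \<in> G2.vec" "V \<in> G2.vec" and ghk: "g \<in> carrier G" "h \<in> carrier G" "k \<in> carrier G"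
  shows "(leg12 U \<star>\<^sub>3 leg13 V) (g, h, k) =
    ((\<lambda>x. U (x, h)) \<star> (\<lambda>x. V (x, k))) g"
proof -
  have "(leg12 U \<star>\<^sub>3 leg13 V) (g, h, k) =
    (\<Sum>x\<in>carrier G. \<Sum>y\<in>carrier G. \<Sum>z\<in>carrier G. (if z = \<one> then U (x, y) else 0) * (if inv y \<otimes> h = \<one> then V (inv x \<otimes> g, inv z \<otimes> k) else 0))"
    using ghk by (subst G3.conv_left)
      (auto simp: sum.cartesian_product legs_at[OF assms(1)] legs_at[OF assms(2)] inv_DirProd group_axioms DirProd_group split_def intro!: sum.cong)
  also have "\<dots> = (\<Sum>x\<in>carrier G. \<Sum>y\<in>carrier G. if y = h then U (x, h) * V (inv x \<otimes> g, k) else 0)"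
  proof (intro sum.cong refl)
    fix x y assume x: "x \<in> carrier G" and y: "y \<in> carrier G"
    have "inv y \<otimes> h = \<one> \<longleftrightarrow> y = h"
      using y ghk by (auto simp: mult_eq_one_iff)
    then show "(\<Sum>z\<in>carrier G. (if z = \<one> then U (x, y) else 0) * (if inv y \<otimes> h = \<one> then V (inv x \<otimes> g, inv z \<otimes> k) else 0)) =
      (if y = h then U (x, h) * V (inv x \<otimes> g, k) else 0)"
      using x ghk by (simp add: if_distrib[of "\<lambda>c. c * _"] cong: if_cong)
  qed
  also have "\<dots> = ((\<lambda>x. U (x, h)) \<star> (\<lambda>x. V (x, k))) g"
    using ghk by (simp add: conv_left)
  finally show ?thesis .
qed

text \<open>  Up to the factor \<open>card (carrier G)\<close> this is the trace of \<open>\<tau> Z\<close> on the square of the regular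
  representation.
\<close>

definition bitrace :: "('a \<times> 'a \<Rightarrow> complex) \<Rightarrow> complex" where
  "bitrace Z = (\<Sum>p\<in>carrier G2. Z p * (if fst p \<otimes> snd p = \<one> then 1 else 0))"

lemma conj_eq_one: 
  assumes "x \<in> carrier G" "y \<in> carrier G" shows "x \<otimes> y = \<one> \<longleftrightarrow> y \<otimes> x = \<one>"
  using assms by (auto simp: mult_eq_one_iff)

text \<open>  Cyclicity of the trace: \<open>\<tau> U V\<close> and \<open>V \<tau> U\<close> have the same trace, and the latter is \<open>\<tau> (flip V) U\<close>.
\<close>

lemma bitrace_conv:
  assumes "U \<in> G2.vec" "V \<in> G2.vec"
  shows "bitrace (U \<star>\<^sub>2 V) = bitrace (flip V \<star>\<^sub>2 U)"
proof -
  let ?d = "\<lambda>x. if x = \<one> then 1 else (0 :: complex)"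
  have "bitrace (flip V \<star>\<^sub>2 U) =
    (\<Sum>x\<in>carrier G2. \<Sum>y\<in>carrier G2. flip V x * U y * ?d (fst (x \<otimes>\<^bsub>G2\<^esub> y) \<otimes> snd (x \<otimes>\<^bsub>G2\<^esub> y)))"
    unfolding bitrace_def by (rule G2.conv_sum_mult)
  also have "\<dots> = (\<Sum>x\<in>carrier G2. \<Sum>y\<in>carrier G2. V x * U y * ?d (snd x \<otimes> fst y \<otimes> (fst x \<otimes> snd y)))"
    by (rule sum.reindex_bij_witness[where i="\<lambda>p. (snd p, fst p)" and j="\<lambda>p. (snd p, fst p)"])
       (auto simp: flip_at[OF assms(2)] mult_DirProd')
  also have "\<dots> = (\<Sum>y\<in>carrier G2. \<Sum>x\<in>carrier G2. V x * U y * ?d (snd x \<otimes> fst y \<otimes> (fst x \<otimes> snd y)))"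
    by (rule sum.swap)
  also have "\<dots> = (\<Sum>y\<in>carrier G2. \<Sum>x\<in>carrier G2. U y * V x * ?d (fst (y \<otimes>\<^bsub>G2\<^esub> x) \<otimes> snd (y \<otimes>\<^bsub>G2\<^esub> x)))"
  proof (intro sum.cong refl)
    fix x y assume "x \<in> carrier G2" "y \<in> carrier G2"
    then have "snd x \<otimes> fst y \<otimes> (fst x \<otimes> snd y) = \<one> \<longleftrightarrow> fst y \<otimes> (fst x \<otimes> snd y) \<otimes> snd x = \<one>"
      by (subst conj_eq_one[of "fst y \<otimes> (fst x \<otimes> snd y)"]) (auto simp: m_assoc)
    then show "V x * U y * ?d (snd x \<otimes> fst y \<otimes> (fst x \<otimes> snd y)) = U y * V x * ?d (fst (y \<otimes>\<^bsub>G2\<^esub> x) \<otimes> snd (y \<otimes>\<^bsub>G2\<^esub> x))"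
      using \<open>x \<in> carrier G2\<close> \<open>y \<in> carrier G2\<close> by (auto simp: m_assoc)
  qed
  also have "\<dots> = bitrace (U \<star>\<^sub>2 V)"
    unfolding bitrace_def by (rule G2.conv_sum_mult[symmetric])
  finally show ?thesis ..
qed

end

context invariant_cocycle
begin

lemma R_row_vec [simp]: "(\<lambda>y. R (a, y)) \<in> vec"
  using R_vec by (auto simp: vecs_def)

lemma R_col_vec [simp]: "(\<lambda>x. R (x, h)) \<in> vec"
  using R_vec by (auto simp: vecs_def)

text \<open>  The hexagons say that the rows of \<open>R\<close>, as elements of the group algebra, are orthogonal
  idempotents, and likewise the columns.
\<close>

lemma R_row_conv:
  assumes ab: "a \<in> carrier G" "b \<in> carrier G"
  shows "(\<lambda>y. R (b, y)) \<star> (\<lambda>y. R (a, y)) = (if a = b then (\<lambda>y. R (a, y)) else (\<lambda>y. 0))"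
proof (rule vec_eqI)
  fix h assume h: "h \<in> carrier G"
  have "leg12_3 R (a, b, h) = (if a = b then R (a, h) else 0)"
  proof (cases "a = b")
    case True
    then show ?thesis using ab h unfolding legs_def
      using push_inj[of G2 "\<lambda>p. (fst p, fst p, snd p)" "(a, h)" R] by (auto simp: inj_on_def)
  next
    case False
    then show ?thesis unfolding legs_def by (auto intro!: push_outside)
  qed
  then show "((\<lambda>y. R (b, y)) \<star> (\<lambda>y. R (a, y))) h = (if a = b then (\<lambda>y. R (a, y)) else (\<lambda>y. 0)) h"
    using conv_23_13[OF R_vec R_vec ab h] by (simp add: R_hexagon1)
qed (simp_all, simp add: vecs_def)

lemma R_col_conv:
  assumes hk: "h \<in> carrier G" "k \<in> carrier G"
  shows "(\<lambda>x. R (x, h)) \<star> (\<lambda>x. R (x, k)) = (if h = k then (\<lambda>x. R (x, h)) else (\<lambda>x. 0))"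
proof (rule vec_eqI)
  fix g assume g: "g \<in> carrier G"
  have "leg1_23 R (g, h, k) = (if h = k then R (g, h) else 0)"
  proof (cases "h = k")
    case True
    then show ?thesis using hk g unfolding legs_def
      using push_inj[of G2 "\<lambda>p. (fst p, snd p, snd p)" "(g, h)" R] by (auto simp: inj_on_def)
  next
    case False
    then show ?thesis unfolding legs_def by (auto intro!: push_outside)
  qed
  then show "((\<lambda>x. R (x, h)) \<star> (\<lambda>x. R (x, k))) g = (if h = k then (\<lambda>x. R (x, h)) else (\<lambda>x. 0)) g"
    using conv_12_13[OF R_vec R_vec g hk] by (simp add: R_hexagon2)
qed (simp_all, simp add: vecs_def)

text \<open>  Deleting one leg of a hexagon leaves an identity in which the invertible \<open>R\<close> cancels.
\<close>

lemma R_row_sum: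
  assumes g: "g \<in> carrier G"
  shows "(\<Sum>h\<in>carrier G. R (g, h)) = (if g = \<one> then 1 else 0)"
proof -
  have h: "(\<lambda>p. (fst p, snd (snd p))) \<in> hom G3 G2" by (auto simp: hom_def)
  have "legs Pair R = legs (\<lambda>x y. (x, \<one>)) R \<star>\<^sub>2 legs Pair R"
    using arg_cong[OF R_hexagon2, of "push G3 (\<lambda>p. (fst p, snd (snd p)))"]
    by (simp add: push_mult[OF fin_group_G3 fin_group_G2 h] push_legs3)
  then have "R \<star>\<^sub>2 flip R = legs (\<lambda>x y. (x, \<one>)) R \<star>\<^sub>2 (R \<star>\<^sub>2 flip R)"
    by (simp add: legs_id G2.conv_assoc[symmetric])
  then have "legs (\<lambda>x y. (x, \<one>)) R = single (\<one>, \<one>)"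
    using legs_vec2[of "\<lambda>x y. (x, \<one>)" R] by (simp add: R_flip)
  then have "legs (\<lambda>x y. (x, \<one>)) R (g, \<one>) = single (\<one>, \<one>) (g, \<one>)" by simp
  moreover have "legs (\<lambda>x y. (x, \<one>)) R (g, \<one>) = (\<Sum>x\<in>carrier G. \<Sum>h\<in>carrier G. R (x, h) * single x g)"
    unfolding legs_def push_def by (subst sum.cartesian_product) (auto intro!: sum.cong simp: single_def)
  moreover have "\<dots> = (\<Sum>h\<in>carrier G. R (g, h))"
    using g by (simp add: sum_distrib_right[symmetric] sum_single(1))
  ultimately show ?thesis by (simp add: single_def)
qed

lemma R_col_sum:
  assumes h: "h \<in> carrier G"
  shows "(\<Sum>g\<in>carrier G. R (g, h)) = (if h = \<one> then 1 else 0)"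
proof -
  have hom: "(\<lambda>p. (fst (snd p), snd (snd p))) \<in> hom G3 G2" by (auto simp: hom_def)
  have "legs Pair R = legs Pair R \<star>\<^sub>2 legs (\<lambda>x y. (\<one>, y)) R"
    using arg_cong[OF R_hexagon1, of "push G3 (\<lambda>p. (fst (snd p), snd (snd p)))"]
    unfolding push_mult[OF fin_group_G3 fin_group_G2 hom] by (subst (asm) (1 2 3) push_legs3) auto
  then have "flip R \<star>\<^sub>2 R = (flip R \<star>\<^sub>2 R) \<star>\<^sub>2 legs (\<lambda>x y. (\<one>, y)) R"
    by (simp add: legs_id G2.conv_assoc)
  then have "legs (\<lambda>x y. (\<one>, y)) R = single (\<one>, \<one>)"
    using legs_vec2[of "\<lambda>x y. (\<one>, y)" R] by (simp add: flip_R)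
  then have "legs (\<lambda>x y. (\<one>, y)) R (\<one>, h) = single (\<one>, \<one>) (\<one>, h)" by simp
  moreover have "legs (\<lambda>x y. (\<one>, y)) R (\<one>, h) = (\<Sum>x\<in>carrier G. \<Sum>y\<in>carrier G. R (x, y) * single y h)"
    unfolding legs_def push_def by (subst sum.cartesian_product) (auto intro!: sum.cong simp: single_def)
  moreover have "\<dots> = (\<Sum>g\<in>carrier G. R (g, h))"
    using h by (simp add: sum_single(1))
  ultimately show ?thesis by (simp add: single_def)
qed

lemma sum_inv: "(\<Sum>x\<in>carrier G. f (inv x)) = (\<Sum>x\<in>carrier G. f x)"
  by (rule sum.reindex_bij_witness[where i="\<lambda>x. inv x" and j="\<lambda>x. inv x"]) auto

text \<open>  By orthogonality of the rows the antipode on the first leg also gives an inverse of \<open>R\<close>,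
  so it must agree with the flip.
\<close>

lemma R_inv_left:
  assumes xy: "x \<in> carrier G" "y \<in> carrier G"
  shows "R (inv x, y) = R (y, x)"
proof -
  define S where "S = legs (\<lambda>x y. (inv x, y)) R"
  have S_vec: "S \<in> G2.vec" unfolding S_def by (rule legs_vec2) auto
  have S_at: "S (x, y) = R (inv x, y)" if "x \<in> carrier G" "y \<in> carrier G" for x y
  proof -
    have "inj_on (\<lambda>p. (inv (fst p), snd p)) (carrier G2)"
      by (rule inj_onI) (auto simp: prod_eq_iff dest: inv_inj[THEN inj_onD])
    then show ?thesis
      using push_inj[of G2 "\<lambda>p. (inv (fst p), snd p)" "(inv x, y)" R] that
      by (simp add: S_def legs_def)
  qed
  have "S \<star>\<^sub>2 R = single (\<one>, \<one>)"
  proof (rule G2.vec_eqI)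
    fix p assume "p \<in> carrier G2"
    then obtain g h where p: "p = (g, h)" "g \<in> carrier G" "h \<in> carrier G" by auto
    have "(S \<star>\<^sub>2 R) (g, h) = (\<Sum>x\<in>carrier G. \<Sum>y\<in>carrier G. R (inv x, y) * R (inv x \<otimes> g, inv y \<otimes> h))"
      using p by (subst G2.conv_left)
       (auto simp: sum.cartesian_product S_at inv_DirProd group_axioms split_def intro!: sum.cong)
    also have "\<dots> = (\<Sum>x\<in>carrier G. ((\<lambda>y. R (inv x, y)) \<star> (\<lambda>y. R (inv x \<otimes> g, y))) h)"
      using p by (simp add: conv_left)
    also have "\<dots> = (\<Sum>x\<in>carrier G. if g = \<one> then R (inv x, h) else 0)"
    proof (intro sum.cong refl)
      fix x assume x: "x \<in> carrier G"
      then have "inv x \<otimes> g = inv x \<longleftrightarrow> g = \<one>" using p by simp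
      then show "((\<lambda>y. R (inv x, y)) \<star> (\<lambda>y. R (inv x \<otimes> g, y))) h = (if g = \<one> then R (inv x, h) else 0)"
        using x p by (subst R_row_conv) auto
    qed
    also have "\<dots> = single (\<one>, \<one>) (g, h)"
      using sum_inv[of "\<lambda>x. R (x, h)"] R_col_sum[OF p(3)] by (cases "g = \<one>") (auto simp: single_def)
    finally show "(S \<star>\<^sub>2 R) p = single (\<one>, \<one>) p" by (simp add: p)
  qed (simp_all add: single_in_vecs)
  then have "S \<star>\<^sub>2 R \<star>\<^sub>2 flip R = flip R" by simp
  then have "S = flip R" using S_vec by (simp add: G2.conv_assoc R_flip)
  then show ?thesis using S_at[OF xy] flip_at[OF R_vec, of x y] by simp
qed

text \<open>  A purely combinatorial substitute for the minimal Hopf subalgebra carrying \<open>R\<close>: this set will turn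
  out to be an abelian normal subgroup outside of which \<open>R\<close> vanishes.
\<close>

definition Supp :: "'a set" where "Supp = {h \<in> carrier G. R (\<one>, h) \<noteq> 0}"

lemma Supp_carrier: "h \<in> Supp \<Longrightarrow> h \<in> carrier G" by (simp add: Supp_def)

text \<open>  The coefficient at the neutral element of the orthogonality relation for columns.  It writes every
  element of \<open>Supp\<close> as a combination of the rows.  These commute, which is why \<open>Supp\<close> is abelian.
\<close>

lemma single_from_rows:
  assumes h: "h \<in> carrier G"
  shows "(\<lambda>k. R (\<one>, h) * single h k) = (\<lambda>k. \<Sum>g\<in>carrier G. R (inv g, h) * R (g, k))"
proof
  fix k
  show "R (\<one>, h) * single h k = (\<Sum>g\<in>carrier G. R (inv g, h) * R (g, k))"
  proof (cases "k \<in> carrier G")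
    case True
    have "(\<Sum>g\<in>carrier G. R (inv g, h) * R (g, k)) = ((\<lambda>x. R (x, h)) \<star> (\<lambda>x. R (x, k))) \<one>"
      by (subst conv_right) auto
    then show ?thesis using R_col_conv[OF h True] by (simp add: single_def)
  next
    case False
    then have "R (g, k) = 0" for g using vec_outside[OF R_row_vec] by blast
    then show ?thesis using False h by (auto simp: single_def)
  qed
qed

lemma single_row:
  assumes h: "h \<in> carrier G" and g: "g \<in> carrier G"
  shows "(\<lambda>k. R (\<one>, h) * (single h \<star> (\<lambda>y. R (g, y))) k) = (\<lambda>k. R (inv g, h) * R (g, k))" (is ?a)
    and "(\<lambda>k. R (\<one>, h) * ((\<lambda>y. R (g, y)) \<star> single h) k) = (\<lambda>k. R (inv g, h) * R (g, k))" (is ?b)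
proof -
  have "((\<lambda>k. R (\<one>, h) * single h k) \<star> (\<lambda>y. R (g, y))) k = (\<Sum>x\<in>carrier G. R (inv x, h) * ((\<lambda>y. R (x, y)) \<star> (\<lambda>y. R (g, y))) k)" for k
    unfolding single_from_rows[OF h] by (rule conv_sum_left)
  also have "(\<Sum>x\<in>carrier G. R (inv x, h) * ((\<lambda>y. R (x, y)) \<star> (\<lambda>y. R (g, y))) k) =
      (\<Sum>x\<in>carrier G. if x = g then R (inv x, h) * R (g, k) else 0)" for k
    using g by (intro sum.cong) (auto simp: R_row_conv)
  finally show ?a using g by (simp add: conv_scale fun_eq_iff)
  have "((\<lambda>y. R (g, y)) \<star> (\<lambda>k. R (\<one>, h) * single h k)) k = (\<Sum>x\<in>carrier G. R (inv x, h) * ((\<lambda>y. R (g, y)) \<star> (\<lambda>y. R (x, y))) k)" for k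
    unfolding single_from_rows[OF h] by (rule conv_sum_right)
  also have "(\<Sum>x\<in>carrier G. R (inv x, h) * ((\<lambda>y. R (g, y)) \<star> (\<lambda>y. R (x, y))) k) =
      (\<Sum>x\<in>carrier G. if x = g then R (inv x, h) * R (g, k) else 0)" for k
    using g by (intro sum.cong) (auto simp: R_row_conv)
  finally show ?b using g by (simp add: conv_scale fun_eq_iff)
qed

lemma R_translate:
  assumes h: "h \<in> carrier G" and g: "g \<in> carrier G" and k: "k \<in> carrier G"
  shows "R (\<one>, h) * R (g, inv h \<otimes> k) = R (inv g, h) * R (g, k)"
  using fun_cong[OF single_row(1)[OF h g], of k] h k by (simp add: single_conv)

lemma R_one_translate: "h \<in> Supp \<Longrightarrow> k \<in> carrier G \<Longrightarrow> R (\<one>, inv h \<otimes> k) = R (\<one>, k)"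
  using R_translate[of h \<one> k] by (auto simp: Supp_def)

lemma Supp_subgroup: "subgroup Supp G"
proof (rule subgroupI)
  show "Supp \<subseteq> carrier G" by (auto simp: Supp_def)
  show "Supp \<noteq> {}"
    using R_row_sum[of \<one>] sum.neutral[of "carrier G" "\<lambda>h. R (\<one>, h)"] by (force simp: Supp_def)
  then obtain h where h: "h \<in> Supp" by auto
  have one: "\<one> \<in> Supp" using R_one_translate[OF h, of h] h by (auto simp: Supp_def)
  show "inv a \<in> Supp" if "a \<in> Supp" for a
    using R_one_translate[OF that, of \<one>] one that by (auto simp: Supp_def)
  show "a \<otimes> b \<in> Supp" if "a \<in> Supp" "b \<in> Supp" for a b
    using R_one_translate[OF that(1), of "a \<otimes> b"] that by (auto simp: Supp_def m_assoc[symmetric])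
qed

lemma Supp_comm:
  assumes h: "h \<in> Supp" and k: "k \<in> Supp"
  shows "h \<otimes> k = k \<otimes> h"
proof -
  have hc: "h \<in> carrier G" and kc: "k \<in> carrier G" using h k by (auto simp: Supp_def)
  have "R (\<one>, h) * (single h \<star> (\<lambda>y. R (g, y))) z = R (\<one>, h) * ((\<lambda>y. R (g, y)) \<star> single h) z" if "g \<in> carrier G" for g z
    using fun_cong[OF single_row(1)[OF hc that], of z] fun_cong[OF single_row(2)[OF hc that], of z] by simp
  then have c: "(single h \<star> (\<lambda>y. R (g, y))) z = ((\<lambda>y. R (g, y)) \<star> single h) z" if "g \<in> carrier G" for g z
    using h that by (auto simp: Supp_def)
  have "(single h \<star> (\<lambda>z. R (\<one>, k) * single k z)) z = ((\<lambda>z. R (\<one>, k) * single k z) \<star> single h) z" for z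
    unfolding single_from_rows[OF kc] by (simp add: conv_sum_left conv_sum_right c)
  then have "R (\<one>, k) * (single h \<star> single k) z = R (\<one>, k) * (single k \<star> single h) z" for z
    by (simp add: conv_scale)
  then have "single (h \<otimes> k) z = single (k \<otimes> h) z" for z
    using k hc kc by (auto simp: Supp_def single_conv_single)
  from this[of "h \<otimes> k"] show ?thesis by (auto simp: single_def split: if_splits)
qed

lemma Supp_normal:
  assumes g: "g \<in> carrier G" and h: "h \<in> Supp"
  shows "g \<otimes> h \<otimes> inv g \<in> Supp"
  using diag_invariant_at[OF R_inv g, of \<one> h] g h by (auto simp: Supp_def)

lemma finite_Supp [simp]: "finite Supp" by (simp add: Supp_def)

lemma card_Supp: "card Supp > 0"
  using Supp_subgroup subgroup.one_closed card_gt_0_iff finite_Supp by blast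

lemma Supp_nonempty [simp]: "Supp \<noteq> {}"
  using Supp_subgroup subgroup.one_closed by blast

lemma R_one_Supp:
  assumes h: "h \<in> Supp" shows "R (\<one>, h) = 1 / card Supp"
proof -
  have c: "R (\<one>, k) = R (\<one>, \<one>)" if "k \<in> Supp" for k
    using R_one_translate[OF that, of k] that by (auto simp: Supp_def)
  have "(\<Sum>k\<in>Supp. R (\<one>, k)) = (\<Sum>k\<in>carrier G. R (\<one>, k))"
    by (rule sum.mono_neutral_left) (auto simp: Supp_def)
  then have "1 = (\<Sum>k\<in>Supp. R (\<one>, k))"
    by (simp add: R_row_sum)
  also have "\<dots> = card Supp * R (\<one>, \<one>)" by (simp add: c)
  finally show ?thesis using c[OF h] card_Supp by (simp add: field_simps)
qed

lemma R_inv_inv: "x \<in> carrier G \<Longrightarrow> y \<in> carrier G \<Longrightarrow> R (inv x, inv y) = R (x, y)"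
  using R_inv_left[of x "inv y"] R_inv_left[of y x] by simp

text \<open>  The row at \<open>\<one>\<close> is the averaging idempotent of \<open>Supp\<close>, and it is orthogonal to all other rows.
\<close>

lemma R_sum_Supp:
  assumes g: "g \<in> carrier G"
  shows "(\<Sum>h\<in>Supp. R (g, h)) = (if g = \<one> then 1 else 0)"
proof (cases "g = \<one>")
  case True
  then show ?thesis using R_one_Supp card_Supp by simp
next
  case False
  let ?g = "inv g"
  have one: "(\<lambda>y. R (\<one>, y)) = (\<lambda>y. \<Sum>h\<in>Supp. R (\<one>, h) * single h y)"
  proof
    fix y show "R (\<one>, y) = (\<Sum>h\<in>Supp. R (\<one>, h) * single h y)"
      using vec_outside[OF R_row_vec, of y \<one>] by (simp add: sum_single(1)[OF finite_Supp]) (auto simp: Supp_def)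
  qed
  have "(\<Sum>h\<in>Supp. R (\<one>, h) * (single h \<star> (\<lambda>y. R (?g, y))) k) = 0" for k
  proof -
    have "((\<lambda>y. R (\<one>, y)) \<star> (\<lambda>y. R (?g, y))) k = 0" using g False by (simp add: R_row_conv)
    then show ?thesis by (simp only: one conv_sum_left)
  qed
  moreover have "(\<Sum>h\<in>Supp. R (\<one>, h) * (single h \<star> (\<lambda>y. R (?g, y))) k) = (\<Sum>h\<in>Supp. R (g, h) * R (?g, k))" for k
  proof (intro sum.cong refl)
    fix h assume "h \<in> Supp"
    then show "R (\<one>, h) * (single h \<star> (\<lambda>y. R (?g, y))) k = R (g, h) * R (?g, k)"
      using fun_cong[OF single_row(1)[OF Supp_carrier, of h ?g], of k] g by simp
  qed
  ultimately have "(\<Sum>h\<in>Supp. R (g, h)) * R (?g, k) = 0" for k by (simp add: sum_distrib_right)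
  moreover have "(\<Sum>h\<in>Supp. R (g, h)) = 0" if "\<And>k. R (?g, k) = 0"
  proof (rule sum.neutral, rule ballI)
    fix h assume "h \<in> Supp"
    then show "R (g, h) = 0" using that[of "inv h"] R_inv_inv[of g h] g Supp_carrier by simp
  qed
  ultimately show ?thesis using False by auto
qed

text \<open>  By the previous lemma the columns indexed by \<open>Supp\<close> sum to \<open>\<one>\<close>; every other column is orthogonal
  to all of them and therefore zero.
\<close>

lemma R_outside: 
  assumes "g \<notin> Supp \<or> h \<notin> Supp" shows "R (g, h) = 0"
proof (cases "g \<in> carrier G \<and> h \<in> carrier G")
  case True
  have col: "R (x, k) = 0" if k: "k \<in> carrier G" "k \<notin> Supp" for x k
  proof -
    have one: "single \<one> = (\<lambda>x. \<Sum>h\<in>Supp. 1 * R (x, h))"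
    proof
      fix x show "single \<one> x = (\<Sum>h\<in>Supp. 1 * R (x, h))"
        using R_sum_Supp[of x] vec_outside[OF R_col_vec, of x]
        by (cases "x \<in> carrier G") (auto simp: single_def intro!: sum.neutral)
    qed
    have "(\<lambda>x. R (x, k)) = (\<lambda>x. R (x, k)) \<star> single \<one>" by simp
    also have "\<dots> = (\<lambda>x. \<Sum>h\<in>Supp. 1 * ((\<lambda>x. R (x, k)) \<star> (\<lambda>x. R (x, h))) x)"
      unfolding one by (rule ext) (rule conv_sum_right)
    also have "\<dots> = (\<lambda>x. 0)"
      using k Supp_carrier by (auto simp: R_col_conv intro!: sum.neutral ext)
    finally show ?thesis by (rule fun_cong)
  qed
  from assms show ?thesis
  proof
    assume "h \<notin> Supp" then show ?thesis using col True by simp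
  next
    assume "g \<notin> Supp"
    then have "R (inv h, g) = 0" using col True by simp
    then show ?thesis using R_inv_left[of h g] True by simp
  qed
next
  case False
  then show ?thesis using G2.vec_outside[OF R_vec, of "(g, h)"] by auto
qed

text \<open>  The matrix of \<open>R\<close> is a bicharacter on \<open>Supp\<close> divided by the order of \<open>Supp\<close>.
\<close>

definition beta :: "'a \<Rightarrow> 'a \<Rightarrow> complex" where "beta x y = card Supp * R (x, y)"

lemma R_eq_beta: "R (x, y) = beta x y / card Supp"
  using card_Supp by (simp add: beta_def)

lemma Supp_inv [simp]: "x \<in> Supp \<Longrightarrow> inv x \<in> Supp" using Supp_subgroup by (rule subgroup.m_inv_closed)
lemma Supp_mult [simp]: "x \<in> Supp \<Longrightarrow> y \<in> Supp \<Longrightarrow> x \<otimes> y \<in> Supp" using Supp_subgroup by (rule subgroup.m_closed)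
lemma Supp_one [simp]: "\<one> \<in> Supp" using Supp_subgroup by (rule subgroup.one_closed)

lemma beta_mult_right:
  assumes "g \<in> Supp" "h \<in> Supp" "k \<in> Supp"
  shows "beta g (h \<otimes> k) = beta g h * beta g k"
proof -
  have c: "g \<in> carrier G" "h \<in> carrier G" "k \<in> carrier G" using assms Supp_carrier by auto
  have "R (\<one>, inv h) * R (g, h \<otimes> k) = R (g, h) * R (g, k)"
    using R_translate[of "inv h" g k] R_inv_inv[of g h] c by simp
  then show ?thesis using card_Supp R_one_Supp[of "inv h"] assms by (simp add: beta_def field_simps)
qed

lemma beta_inv_left: "g \<in> Supp \<Longrightarrow> h \<in> Supp \<Longrightarrow> beta (inv g) h = beta h g"
  using R_inv_left Supp_carrier by (simp add: beta_def)

lemma beta_mult_left: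
  assumes "g \<in> Supp" "h \<in> Supp" "k \<in> Supp"
  shows "beta (g \<otimes> h) k = beta g k * beta h k"
  using assms beta_inv_left[of "k" "g \<otimes> h"] beta_inv_left[of "k" g] beta_inv_left[of k h] beta_mult_right[of "inv k" g h] by simp

lemma beta_one_left: "g \<in> Supp \<Longrightarrow> beta \<one> g = 1"
  using R_one_Supp card_Supp by (simp add: beta_def)

lemma beta_one_right: "g \<in> Supp \<Longrightarrow> beta g \<one> = 1"
  using beta_inv_left[of g \<one>] beta_inv_left[of "inv g" \<one>] beta_one_left[of "inv g"] Supp_carrier by simp

lemma beta_skew: 
  assumes "g \<in> Supp" "h \<in> Supp" shows "beta g h * beta h g = 1"
proof -
  have "beta g h * beta (inv g) h = beta (g \<otimes> inv g) h" using assms by (simp only: beta_mult_left Supp_inv)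
  then show ?thesis using assms beta_inv_left[of g h] beta_one_left[of h] Supp_carrier by simp
qed

lemma beta_nondegenerate:
  assumes g: "g \<in> Supp" and "\<And>h. h \<in> Supp \<Longrightarrow> beta g h = 1"
  shows "g = \<one>"
proof -
  have "(\<Sum>h\<in>Supp. R (g, h)) = 1" using assms card_Supp by (simp add: R_eq_beta)
  then show ?thesis using R_sum_Supp[of g] g Supp_carrier by (auto split: if_splits)
qed

text \<open>  \<open>R \<tau>\<close> is conjugate to \<open>\<tau>\<close> by \<open>\<Omega>\<close>, which commutes with \<open>\<Delta>(g)\<close>; so both have the same trace
  against \<open>\<Delta>(g)\<close>.  For \<open>\<tau>\<close> this is the regular character at the square of \<open>g\<close>, the summand of a
  Frobenius-Schur indicator.
\<close>

lemma R_trace: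
  assumes g: "g \<in> carrier G"
  shows "(\<Sum>a\<in>carrier G. R (a, inv g \<otimes> inv a \<otimes> inv g)) = (if g \<otimes> g = \<one> then 1 else 0)"
proof -
  let ?s = "single (g, g)"
  have bt: "bitrace Z = (\<Sum>a\<in>carrier G. Z (a, inv a))" for Z
  proof -
    have "bitrace Z = (\<Sum>a\<in>carrier G. \<Sum>c\<in>carrier G. Z (a, c) * (if a \<otimes> c = \<one> then 1 else 0))"
      unfolding bitrace_def by (subst sum.cartesian_product) (auto intro!: sum.cong)
    also have "\<dots> = (\<Sum>a\<in>carrier G. \<Sum>c\<in>carrier G. if c = inv a then Z (a, c) else 0)"
    proof (intro sum.cong refl)
      fix a c assume "a \<in> carrier G" "c \<in> carrier G"
      then have "a \<otimes> c = \<one> \<longleftrightarrow> c = inv a" by (rule mult_eq_one_iff)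
      then show "Z (a, c) * (if a \<otimes> c = \<one> then 1 else 0) = (if c = inv a then Z (a, c) else 0)" by simp
    qed
    also have "\<dots> = (\<Sum>a\<in>carrier G. Z (a, inv a))" by simp
    finally show ?thesis .
  qed
  have "(\<Sum>a\<in>carrier G. R (a, inv g \<otimes> inv a \<otimes> inv g)) = (\<Sum>a\<in>carrier G. R (a \<otimes> inv g, inv a \<otimes> inv g))"
    by (rule sum.reindex_bij_witness[where i="\<lambda>a. a \<otimes> inv g" and j="\<lambda>a. a \<otimes> g"])
       (use g in \<open>auto simp: m_assoc inv_mult_group\<close>)
  also have "\<dots> = bitrace (R \<star>\<^sub>2 ?s)"
    using g by (simp add: bt G2.conv_single inv_DirProd group_axioms)
  also have "\<dots> = bitrace (\<Omega>i \<star>\<^sub>2 (flip \<Omega> \<star>\<^sub>2 ?s))" by (simp add: R_def G2.conv_assoc)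
  also have "\<dots> = bitrace (flip (flip \<Omega> \<star>\<^sub>2 ?s) \<star>\<^sub>2 \<Omega>i)"
    by (rule bitrace_conv) (simp_all add: \<Omega>i_vec[unfolded carrier_DirProd])
  also have "flip (flip \<Omega> \<star>\<^sub>2 ?s) \<star>\<^sub>2 \<Omega>i = ?s \<star>\<^sub>2 \<Omega> \<star>\<^sub>2 \<Omega>i"
    using g \<Omega>_inv by (simp add: flip_mult flip_flip[OF \<Omega>_vec] flip_single diag_invariant_def)
  also have "\<dots> = ?s" using g by (simp add: G2.conv_assoc \<Omega>_\<Omega>i single_in_vecs)
  also have "bitrace ?s = (if g \<otimes> g = \<one> then 1 else 0)"
    using g by (simp add: bitrace_def sum_single)
  finally show ?thesis .
qed

text \<open>  Skew symmetry only gives values \<open>\<plusminus>1\<close> on the diagonal.  The trace formula at \<open>\<one>\<close> says that they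
  add up to the order of \<open>Supp\<close>, which excludes a supersymmetric \<open>R\<close>.
\<close>

lemma beta_alternating:
  assumes a: "a \<in> Supp" shows "beta a a = 1"
proof -
  have pm: "beta x x = 1 \<or> beta x x = -1" if "x \<in> Supp" for x
    using beta_skew[OF that that] by (metis power2_eq_1_iff power2_eq_square)
  have e: "beta x (inv x) = beta x x" if "x \<in> Supp" for x
  proof -
    have "beta x x * beta x (inv x) = 1"
      using beta_mult_right[of x x "inv x"] beta_one_right[of x] that Supp_carrier[OF that] by simp
    then show ?thesis using pm[OF that] by (auto simp: minus_equation_iff)
  qed
  have "(\<Sum>x\<in>carrier G. R (x, inv x)) = 1"
    using R_trace[of \<one>] by simp
  moreover have "(\<Sum>x\<in>carrier G. R (x, inv x)) = (\<Sum>x\<in>Supp. R (x, inv x))"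
    by (rule sum.mono_neutral_right) (auto simp: R_outside Supp_carrier)
  ultimately have "(\<Sum>x\<in>Supp. beta x x) = of_nat (card Supp)"
    using card_Supp by (simp add: R_eq_beta e sum_divide_distrib[symmetric] field_simps)
  then have "(\<Sum>x\<in>Supp. 1 - Re (beta x x)) = 0"
    by (simp add: sum_subtractf flip: Re_sum)
  moreover have "\<forall>x\<in>Supp. 0 \<le> 1 - Re (beta x x)" using pm by force
  ultimately have "1 - Re (beta a a) = 0" using a finite_Supp by (subst (asm) sum_nonneg_eq_0_iff) auto
  then show ?thesis using pm[OF a] by auto
qed

end

section \<open>Characters of commutative finite-dimensional algebras\<close>

lemma linear_dependence:
  fixes w :: "'i \<Rightarrow> 'b \<Rightarrow> complex"
  assumes "finite B" "finite I" "card B < card I"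
  shows "\<exists>c. (\<exists>i\<in>I. c i \<noteq> 0) \<and> (\<forall>x\<in>B. (\<Sum>i\<in>I. c i * w i x) = 0)"
  using assms
proof (induction B arbitrary: I w rule: finite_induct)
  case empty
  then obtain i where "i \<in> I" by fastforce
  then show ?case by (intro exI[of _ "\<lambda>_. 1"]) auto
next
  case (insert x B)
  show ?case
  proof (cases "\<forall>i\<in>I. w i x = 0")
    case True
    have "card B < card I" using insert by simp
    from insert.IH[OF insert.prems(1) this, of w] True show ?thesis by auto
  next
    case False
    then obtain j where j: "j \<in> I" "w j x \<noteq> 0" by auto
    define w' where "w' i y = w i y - w i x / w j x * w j y" for i y
    have "card B < card (I - {j})" using insert j by simp
    then obtain c where c: "\<exists>i\<in>I - {j}. c i \<noteq> 0" 
      "\<And>y. y \<in> B \<Longrightarrow> (\<Sum>i\<in>I - {j}. c i * w' i y) = 0"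
      using insert.IH[of "I - {j}" w'] insert.prems(1) by auto
    define d where "d i = (if i = j then - (\<Sum>i\<in>I - {j}. c i * w i x / w j x) else c i)" for i
    have "(\<Sum>i\<in>I. d i * w i y) = (\<Sum>i\<in>I - {j}. c i * w' i y)" for y
    proof -
      have "(\<Sum>i\<in>I. d i * w i y) = d j * w j y + (\<Sum>i\<in>I - {j}. d i * w i y)"
        using insert.prems(1) j by (simp add: sum.remove)
      also have "(\<Sum>i\<in>I - {j}. d i * w i y) = (\<Sum>i\<in>I - {j}. c i * w i y)"
        by (intro sum.cong) (auto simp: d_def)
      also have "d j * w j y = - (\<Sum>i\<in>I - {j}. c i * (w i x / w j x * w j y))"
        by (simp add: d_def sum_distrib_right mult.assoc)
      finally show ?thesis
        by (simp add: w'_def right_diff_distrib sum_subtractf)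
    qed
    moreover have "(\<Sum>i\<in>I - {j}. c i * w' i x) = 0" using j by (simp add: w'_def)
    moreover have "\<exists>i\<in>I. d i \<noteq> 0" using c(1) by (auto simp: d_def)
    ultimately show ?thesis using c(2) by (intro exI[of _ d]) auto
  qed
qed

context
  fixes Q :: "('b, 'x) based_algebra_scheme"
  assumes fin: "finite (basis Q)" and mon: "Group.comm_monoid (mult_monoid Q)"
begin

interpretation M: Group.comm_monoid "mult_monoid Q" rewrites "carrier (mult_monoid Q) = vecs (basis Q)"
  and "\<one>\<^bsub>mult_monoid Q\<^esub> = unit_vec Q"
  using mon by (simp_all add: mult_monoid_def)

abbreviation qmult (infixl \<open>\<diamondop>\<close> 70) where "f \<diamondop> g \<equiv> f \<otimes>\<^bsub>mult_monoid Q\<^esub> g"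

lemma mult_monoid_at: "(f \<diamondop> g) z = (\<Sum>x\<in>basis Q. \<Sum>y\<in>basis Q. f x * g y * basis_mult Q x y z)"
  by (simp add: mult_monoid_def)

lemma mult_monoid_lincomb:
  "f \<diamondop> (\<lambda>x. \<Sum>i\<in>I. c i * g i x) = (\<lambda>z. \<Sum>i\<in>I. c i * (f \<diamondop> g i) z)"
proof (cases "finite I")
  case True
  then show ?thesis
  proof induction
    case (insert i I)
    have "(f \<diamondop> (\<lambda>x. c i * g i x + h x)) z = c i * (f \<diamondop> g i) z + (f \<diamondop> h) z" for h z
      by (simp add: mult_monoid_at sum_distrib_left sum.distrib[symmetric] algebra_simps)
    with insert show ?case by (simp add: fun_eq_iff)
  qed (simp add: mult_monoid_at)
qed (simp add: mult_monoid_at fun_eq_iff)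

lemma vecs_lincomb: "(\<And>i. i \<in> I \<Longrightarrow> g i \<in> vecs B) \<Longrightarrow> (\<lambda>x. \<Sum>i\<in>I. c i * g i x) \<in> vecs B"
  by (auto simp: vecs_def intro!: sum.neutral)

lemma single_mult_single:
  assumes "a \<in> basis Q" "b \<in> basis Q"
  shows "single a \<diamondop> single b = basis_mult Q a b"
proof
  fix z
  have "(single a \<diamondop> single b) z = (\<Sum>x\<in>basis Q. single a x * (\<Sum>y\<in>basis Q. single b y * basis_mult Q x y z))"
    by (simp add: mult_monoid_at sum_distrib_left mult_ac)
  then show "(single a \<diamondop> single b) z = basis_mult Q a b z"
    using assms by (simp add: sum_single(4)[OF fin])
qed

text \<open>  A nonzero polynomial of least degree in \<open>f\<close> that annihilates \<open>w\<close> has a root; splitting off the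
  corresponding linear factor leaves a polynomial which maps \<open>w\<close> to an eigenvector of \<open>f\<close>.  As the
  algebra is commutative, eigenvector equations of \<open>w\<close> are inherited.
\<close>

lemma eigenvector_step:
  assumes w: "w \<in> vecs (basis Q)" "w \<noteq> (\<lambda>_. 0)" and f: "f \<in> vecs (basis Q)"
  shows "\<exists>w' c. w' \<in> vecs (basis Q) \<and> w' \<noteq> (\<lambda>_. 0) \<and> f \<diamondop> w' = (\<lambda>x. c * w' x) \<and>
    (\<forall>g\<in>vecs (basis Q). \<forall>d. g \<diamondop> w = (\<lambda>x. d * w x) \<longrightarrow> g \<diamondop> w' = (\<lambda>x. d * w' x))"
proof -
  define W where "W k = ((\<lambda>v. f \<diamondop> v) ^^ k) w" for k
  have W0: "W 0 = w" and WS: "W (Suc k) = f \<diamondop> W k" for k by (auto simp: W_def)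
  have Wv: "W k \<in> vecs (basis Q)" for k by (induction k) (auto simp: W0 WS w f)
  define act where "act p = (\<lambda>x. \<Sum>k\<le>degree p. coeff p k * W k x)" for p :: "complex poly"
  have act: "act p x = (\<Sum>k\<le>N. coeff p k * W k x)" if "degree p \<le> N" for p N x
    unfolding act_def using that by (intro sum.mono_neutral_left) (auto simp: coeff_eq_0)
  have act_vec: "act p \<in> vecs (basis Q)" for p
    unfolding act_def by (rule vecs_lincomb) (rule Wv)
  have "\<exists>p. p \<noteq> 0 \<and> act p = (\<lambda>_. 0)"
  proof -
    let ?n = "card (basis Q)"
    obtain c where c: "\<exists>k\<le>?n. c k \<noteq> 0" "\<And>x. x \<in> basis Q \<Longrightarrow> (\<Sum>k\<le>?n. c k * W k x) = 0"
      using linear_dependence[OF fin, of "{..?n}" W] by auto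
    define p where "p = (\<Sum>k\<le>?n. monom (c k) k)"
    have co: "coeff p k = (if k \<le> ?n then c k else 0)" for k
      by (simp add: p_def coeff_sum)
    have "degree p \<le> ?n" by (rule degree_le) (simp add: co)
    then have ap: "act p x = (\<Sum>k\<le>?n. c k * W k x)" for x
      by (simp add: act co)
    have "act p x = 0" for x
      using c(2)[of x] ap[of x] Wv by (cases "x \<in> basis Q") (auto simp: vecs_def)
    moreover have "p \<noteq> 0" using c(1) co by (metis coeff_0)
    ultimately show ?thesis by auto
  qed
  then obtain p where p: "p \<noteq> 0" "act p = (\<lambda>_. 0)"
    and pmin: "\<And>q. q \<noteq> 0 \<Longrightarrow> act q = (\<lambda>_. 0) \<Longrightarrow> degree p \<le> degree q"
    using exists_least_iff[of "\<lambda>n. \<exists>p. p \<noteq> 0 \<and> act p = (\<lambda>_. 0) \<and> degree p = n"]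
    by (metis linorder_not_le)
  have "degree p \<noteq> 0"
  proof
    assume "degree p = 0"
    then have "act p = (\<lambda>x. coeff p 0 * w x)" "coeff p 0 \<noteq> 0"
      using p(1) leading_coeff_0_iff[of p] by (auto simp: act_def W0)
    then show False using p(2) w(2) by (auto simp: fun_eq_iff)
  qed
  then have "\<not> constant (poly p)" by (simp add: constant_degree)
  then obtain c where "poly p c = 0" using fundamental_theorem_of_algebra by blast
  then obtain q where q: "p = [:-c, 1:] * q" by (auto simp: poly_eq_0_iff_dvd)
  have q0: "q \<noteq> 0" using p(1) q by auto
  have dq: "degree p = Suc (degree q)" using q0 by (simp add: q degree_mult_eq del: mult_pCons_left)
  have nz: "act q \<noteq> (\<lambda>_. 0)" using pmin[OF q0] dq by auto
  have "act p x = (f \<diamondop> act q) x - c * act q x" for x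
  proof -
    have "coeff p k = coeff (pCons 0 q) k - c * coeff q k" for k by (simp add: q)
    then have "act p x = (\<Sum>k\<le>Suc (degree q). coeff (pCons 0 q) k * W k x) - (\<Sum>k\<le>Suc (degree q). c * (coeff q k * W k x))"
      unfolding act_def dq by (simp only: left_diff_distrib sum_subtractf mult.assoc)
    also have "(\<Sum>k\<le>Suc (degree q). c * (coeff q k * W k x)) = c * act q x"
      by (subst act[of q "Suc (degree q)"]) (simp, simp only: sum_distrib_left)
    also have "(\<Sum>k\<le>Suc (degree q). coeff (pCons 0 q) k * W k x) = (\<Sum>k\<le>degree q. coeff q k * W (Suc k) x)"
      by (subst sum.atMost_Suc_shift) simp
    also have "\<dots> = (f \<diamondop> act q) x"
      by (simp add: act_def mult_monoid_lincomb WS)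
    finally show ?thesis .
  qed
  then have ev: "f \<diamondop> act q = (\<lambda>x. c * act q x)" using p(2) by (auto simp: fun_eq_iff)
  have "g \<diamondop> act q = (\<lambda>x. d * act q x)"
    if g: "g \<in> vecs (basis Q)" "g \<diamondop> w = (\<lambda>x. d * w x)" for g d
  proof -
    have "g \<diamondop> W k = (\<lambda>x. d * W k x)" for k
    proof (induction k)
      case (Suc k)
      have "g \<diamondop> W (Suc k) = f \<diamondop> (g \<diamondop> W k)"
        unfolding WS by (rule M.m_lcomm) (use g f Wv in auto)
      also have "\<dots> = (\<lambda>x. d * (f \<diamondop> W k) x)"
        using mult_monoid_lincomb[where f=f and I="{()}" and c="\<lambda>_. d" and g="\<lambda>_. W k"] by (simp add: Suc)
      finally show ?case by (simp add: WS)
    qed (simp add: W0 g)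
    then show ?thesis by (simp add: act_def mult_monoid_lincomb sum_distrib_left mult_ac)
  qed
  then show ?thesis using nz ev act_vec by blast
qed

text \<open>  On a common eigenvector of all multiplication operators the algebra acts by a character.
\<close>

lemma character_exists:
  assumes one: "unit_vec Q \<noteq> (\<lambda>_. 0)"
  shows "\<exists>\<chi>. (\<Sum>x\<in>basis Q. unit_vec Q x * \<chi> x) = 1 \<and>
    (\<forall>a\<in>basis Q. \<forall>b\<in>basis Q. (\<Sum>x\<in>basis Q. basis_mult Q a b x * \<chi> x) = \<chi> a * \<chi> b)"
proof -
  have "\<exists>w \<chi>. w \<in> vecs (basis Q) \<and> w \<noteq> (\<lambda>_. 0) \<and> (\<forall>a\<in>S. single a \<diamondop> w = (\<lambda>x. \<chi> a * w x))"
    if "S \<subseteq> basis Q" for S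
    using finite_subset[OF that fin] that
  proof (induction S rule: finite_induct)
    case empty
    show ?case using one M.one_closed by (intro exI[of _ "unit_vec Q"]) auto
  next
    case (insert a S)
    then obtain w \<chi> where w: "w \<in> vecs (basis Q)" "w \<noteq> (\<lambda>_. 0)"
      and e: "\<And>a. a \<in> S \<Longrightarrow> single a \<diamondop> w = (\<lambda>x. \<chi> a * w x)" by auto
    from eigenvector_step[OF w single_in_vecs, of a] insert.prems obtain w' c where
      w': "w' \<in> vecs (basis Q)" "w' \<noteq> (\<lambda>_. 0)" "single a \<diamondop> w' = (\<lambda>x. c * w' x)"
      "\<And>g d. g \<in> vecs (basis Q) \<Longrightarrow> g \<diamondop> w = (\<lambda>x. d * w x) \<Longrightarrow> g \<diamondop> w' = (\<lambda>x. d * w' x)"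
      by auto
    have "single b \<diamondop> w' = (\<lambda>x. (\<chi>(a := c)) b * w' x)" if "b \<in> insert a S" for b
      using that w'(3) w'(4)[OF single_in_vecs e, of b] insert.prems insert.hyps by auto
    then show ?case using w' by blast
  qed
  from this[OF subset_refl] obtain w \<chi> where w: "w \<in> vecs (basis Q)" "w \<noteq> (\<lambda>_. 0)"
    and e: "\<And>a. a \<in> basis Q \<Longrightarrow> single a \<diamondop> w = (\<lambda>x. \<chi> a * w x)" by blast
  have lin: "f \<diamondop> w = (\<lambda>x. (\<Sum>a\<in>basis Q. f a * \<chi> a) * w x)" if f: "f \<in> vecs (basis Q)" for f
  proof -
    have "f = (\<lambda>x. \<Sum>a\<in>basis Q. f a * single a x)"
      using f by (auto simp: sum_single(1)[OF fin] vecs_def fun_eq_iff)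
    then have "f \<diamondop> w = w \<diamondop> (\<lambda>x. \<Sum>a\<in>basis Q. f a * single a x)"
      using M.m_comm[OF f w(1)] by simp
    also have "\<dots> = (\<lambda>z. \<Sum>a\<in>basis Q. f a * (single a \<diamondop> w) z)"
      unfolding mult_monoid_lincomb by (intro ext sum.cong refl) (simp add: M.m_comm[OF w(1) single_in_vecs])
    also have "\<dots> = (\<lambda>x. (\<Sum>a\<in>basis Q. f a * \<chi> a) * w x)"
      by (intro ext) (simp add: e sum_distrib_right mult.assoc)
    finally show ?thesis .
  qed
  from w(2) obtain x0 where x0: "w x0 \<noteq> 0" by auto
  have "(\<Sum>a\<in>basis Q. unit_vec Q a * \<chi> a) = 1"
    using fun_cong[OF lin[OF M.one_closed], of x0] x0 w(1) by simp
  moreover have "(\<Sum>x\<in>basis Q. basis_mult Q a b x * \<chi> x) = \<chi> a * \<chi> b" if ab: "a \<in> basis Q" "b \<in> basis Q" for a b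
  proof -
    have sv: "single a \<in> vecs (basis Q)" "single b \<in> vecs (basis Q)" using ab by (auto intro: single_in_vecs)
    have "(single a \<diamondop> single b) \<diamondop> w = single a \<diamondop> (single b \<diamondop> w)"
      by (rule M.m_assoc) (use sv w in auto)
    also have "\<dots> = (\<lambda>x. \<chi> b * (single a \<diamondop> w) x)"
      using mult_monoid_lincomb[where f="single a" and I="{()}" and c="\<lambda>_. \<chi> b" and g="\<lambda>_. w"] ab by (simp add: e)
    finally have "(single a \<diamondop> single b) \<diamondop> w = (\<lambda>x. \<chi> b * (\<chi> a * w x))"
      using ab by (simp add: e)
    moreover have "(single a \<diamondop> single b) \<diamondop> w = (\<lambda>x. (\<Sum>x\<in>basis Q. basis_mult Q a b x * \<chi> x) * w x)"
      using lin[OF M.m_closed[OF sv]] ab by (simp add: single_mult_single)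
    ultimately have "(\<Sum>x\<in>basis Q. basis_mult Q a b x * \<chi> x) * w x0 = \<chi> b * (\<chi> a * w x0)" by metis
    then show ?thesis using x0 by simp
  qed
  ultimately show ?thesis by blast
qed

end

section \<open>Symmetric invariant cocycles are coboundaries of normalising elements\<close>

context fin_group
begin

lemma diff_conv: "(\<lambda>x. f x - g x) \<star> h = (\<lambda>z. (f \<star> h) z - (g \<star> h) z)"
  using conv_add(2)[of 1 f "-1" g h] by simp

lemma zero_conv: "(\<lambda>x. 0) \<star> h = (\<lambda>z. 0)"
  by (simp add: conv_sum fun_eq_iff)

end

context fin_group_hopf
begin

lemma mult_inv_eq_one_iff: "x \<in> carrier G \<Longrightarrow> y \<in> carrier G \<Longrightarrow> x \<otimes> inv y = \<one> \<longleftrightarrow> y = x"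
  using mult_eq_one_iff[of x "inv y"] inv_inj[THEN inj_onD, of y x] by auto

lemma tensor_vec [simp]: "f \<in> vec \<Longrightarrow> g \<in> vec \<Longrightarrow> f \<boxtimes> g \<in> G2.vec"
  by (auto simp: vecs_def tensor_def)

lemmas tensor_vec' [simp] = tensor_vec[unfolded carrier_DirProd]

lemma tensor_conv: "(f \<boxtimes> g) \<star>\<^sub>2 (f' \<boxtimes> g') = (f \<star> f') \<boxtimes> (g \<star> g')"
proof (rule G2.vec_eqI)
  fix p assume "p \<in> carrier G2"
  then obtain a b where p: "p = (a, b)" "a \<in> carrier G" "b \<in> carrier G" by auto
  have "((f \<boxtimes> g) \<star>\<^sub>2 (f' \<boxtimes> g')) (a, b) = (\<Sum>x\<in>carrier G. \<Sum>y\<in>carrier G. (f x * f' (inv x \<otimes> a)) * (g y * g' (inv y \<otimes> b)))"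
    using p by (subst G2.conv_left)
      (auto simp: sum.cartesian_product inv_DirProd group_axioms split_def tensor_def mult_ac intro!: sum.cong)
  also have "\<dots> = ((f \<star> f') \<boxtimes> (g \<star> g')) (a, b)"
    using p by (simp add: tensor_def conv_left sum_product)
  finally show "((f \<boxtimes> g) \<star>\<^sub>2 (f' \<boxtimes> g')) p = ((f \<star> f') \<boxtimes> (g \<star> g')) p" by (simp add: p)
qed simp_all

lemma Delta_vec [simp]: "Delta f \<in> vecs (carrier G \<times> carrier G)"
  unfolding Delta_def by (rule push_closed) auto

lemma Delta_conv: "Delta (f \<star> g) = Delta f \<star>\<^sub>2 Delta g"
  unfolding Delta_def by (rule push_mult[OF fin_group_G fin_group_G2]) (auto simp: hom_def)

lemma Delta_scale: "Delta (\<lambda>x. a * f x) = (\<lambda>p. a * Delta f p)"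
  by (simp add: Delta_def push_def sum_distrib_left mult.assoc)

lemma Delta_single: "a \<in> carrier G \<Longrightarrow> Delta (single a) = single (a, a)"
  unfolding Delta_def by (simp add: push_single)

lemma Delta_at:
  assumes "f \<in> vec" shows "Delta f (a, b) = (if a = b then f a else 0)"
  using ga_comult[OF group_axioms fin assms] by (simp flip: comult_eq)

lemma grouplike:
  assumes y: "y \<in> vec" "Delta y = y \<boxtimes> y" "y \<noteq> (\<lambda>_. 0)"
  shows "\<exists>g\<in>carrier G. y = single g"
proof -
  from y(3) obtain g where g: "y g \<noteq> 0" by auto
  have e: "y a * y b = (if a = b then y a else 0)" for a b
    using fun_cong[OF y(2), of "(a, b)"] by (simp add: Delta_at[OF y(1)] tensor_def)
  have "y g = 1" using e[of g g] g by simp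
  moreover have "y a = 0" if "a \<noteq> g" for a using e[of a g] that g by simp
  ultimately have "y = single g" by (auto simp: single_def fun_eq_iff)
  then show ?thesis using g vec_outside[OF y(1)] by blast
qed

text \<open>
  The products of \<open>v\<close> with the basis elements, together with \<open>\<one>\<close>, are linearly dependent for
  reasons of dimension.  Injectivity forces \<open>\<one>\<close> to occur in the relation, which gives a left inverse.
\<close>

lemma conv_inverse:
  assumes v: "v \<in> vec" and inj: "\<And>w. w \<in> vec \<Longrightarrow> w \<star> v = (\<lambda>_. 0) \<Longrightarrow> w = (\<lambda>_. 0)"
  shows "\<exists>l\<in>vec. l \<star> v = single \<one> \<and> v \<star> l = single \<one>"
proof -
  \<comment> \<open>the index \<open>None\<close> stands for the additional vector \<open>\<one>\<close>\<close>
  define w where "w i = (case i of None \<Rightarrow> single \<one> | Some x \<Rightarrow> single x \<star> v)" for i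
  define J where "J = insert None (Some ` carrier G)"
  have "card J = Suc (card (carrier G))" by (simp add: J_def card_image)
  then obtain c where c: "\<exists>i\<in>J. c i \<noteq> 0" "\<And>z. z \<in> carrier G \<Longrightarrow> (\<Sum>i\<in>J. c i * w i z) = 0"
    using linear_dependence[of "carrier G" J w] by (auto simp: J_def)
  define l where "l x = (if x \<in> carrier G then c (Some x) else 0)" for x
  have l: "l \<in> vec" by (simp add: l_def vecs_def)
  have lv: "(l \<star> v) z = - c None * single \<one> z" for z
  proof (cases "z \<in> carrier G")
    case True
    have "0 = c None * single \<one> z + (\<Sum>x\<in>carrier G. c (Some x) * (single x \<star> v) z)"
      using c(2)[OF True] by (simp add: J_def w_def sum.reindex)
    also have "(\<Sum>x\<in>carrier G. c (Some x) * (single x \<star> v) z) = (\<Sum>x\<in>carrier G. l x * (single x \<star> v) z)"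
      by (auto simp: l_def intro!: sum.cong)
    also have "\<dots> = (l \<star> v) z"
      by (subst (2) vec_expand[OF l]) (rule conv_sum_left[symmetric])
    finally show ?thesis by (simp add: eq_neg_iff_add_eq_0 add.commute)
  next
    case False
    then show ?thesis using vec_outside[OF conv_closed False] by (auto simp: single_def)
  qed
  have c0: "c None \<noteq> 0"
  proof
    assume 0: "c None = 0"
    then have "l \<star> v = (\<lambda>_. 0)" using lv by auto
    then have "l = (\<lambda>_. 0)" using inj[OF l] by simp
    then have "c (Some x) = 0" if "x \<in> carrier G" for x
      using that by (metis l_def)
    then show False using c(1) 0 by (auto simp: J_def)
  qed
  define l' where "l' = (\<lambda>x. (- inverse (c None)) * l x)"
  have l': "l' \<in> vec" using l by (auto simp: vecs_def l'_def)
  have 1: "l' \<star> v = single \<one>" unfolding l'_def conv_scale using c0 by (simp add: lv fun_eq_iff)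
  have "(\<lambda>x. (v \<star> l') x - single \<one> x) \<star> v = (\<lambda>_. 0)"
    unfolding diff_conv by (simp add: conv_assoc 1 v)
  moreover have "(\<lambda>x. (v \<star> l') x - single \<one> x) \<in> vec"
    using conv_closed[of v l'] single_vec[OF one_closed] unfolding vecs_def by auto
  ultimately have "(\<lambda>x. (v \<star> l') x - single \<one> x) = (\<lambda>_. 0)" by (rule inj[rotated])
  then have "v \<star> l' = single \<one>" by (auto simp: fun_eq_iff)
  then show ?thesis using 1 l' by blast
qed

end

context invariant_cocycle
begin

text \<open>  Applying the counit to the middle leg of the cocycle identity shows that the two one-sided counits
  of \<open>\<Omega>\<close> agree and are a scalar \<open>\<kappa>\<close>; it is nonzero since \<open>\<Omega>\<close> is invertible.
\<close>

lemma \<Omega>_sums: 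
  obtains \<kappa> where "\<kappa> \<noteq> 0" "\<And>h. h \<in> carrier G \<Longrightarrow> (\<Sum>x\<in>carrier G. \<Omega> (x, h)) = (if h = \<one> then \<kappa> else 0)"
proof -
  have hom: "(\<lambda>p. (fst p, snd (snd p))) \<in> hom G3 G2" by (auto simp: hom_def)
  have "legs (\<lambda>x y. (\<one>, y)) \<Omega> \<star>\<^sub>2 legs Pair \<Omega> = legs (\<lambda>x y. (x, \<one>)) \<Omega> \<star>\<^sub>2 legs Pair \<Omega>"
    using arg_cong[OF cocycle, of "push G3 (\<lambda>p. (fst p, snd (snd p)))"]
    by (simp add: push_mult[OF fin_group_G3 fin_group_G2 hom] push_legs3)
  then have "legs (\<lambda>x y. (\<one>, y)) \<Omega> \<star>\<^sub>2 (\<Omega> \<star>\<^sub>2 \<Omega>i) = legs (\<lambda>x y. (x, \<one>)) \<Omega> \<star>\<^sub>2 (\<Omega> \<star>\<^sub>2 \<Omega>i)"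
    by (simp add: legs_id \<Omega>_vec G2.conv_assoc[symmetric] del: carrier_DirProd)
  then have e: "legs (\<lambda>x y. (\<one>, y)) \<Omega> = legs (\<lambda>x y. (x, \<one>)) \<Omega>"
    using legs_vec2[of "\<lambda>x y. (x, \<one>)" \<Omega>] legs_vec2[of "\<lambda>x y. (\<one>, y)" \<Omega>] by (simp add: \<Omega>_\<Omega>i)
  have 0: "(\<Sum>x\<in>carrier G. \<Omega> (x, h)) = 0" if h: "h \<in> carrier G" "h \<noteq> \<one>" for h
  proof -
    have "legs (\<lambda>x y. (\<one>, y)) \<Omega> (\<one>, h) = (\<Sum>x\<in>carrier G. \<Sum>y\<in>carrier G. \<Omega> (x, y) * single y h)"
      unfolding legs_def push_def by (subst sum.cartesian_product) (auto intro!: sum.cong simp: single_def)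
    also have "\<dots> = (\<Sum>x\<in>carrier G. \<Omega> (x, h))" using h by (simp add: sum_single(1))
    finally have "(\<Sum>x\<in>carrier G. \<Omega> (x, h)) = legs (\<lambda>x y. (x, \<one>)) \<Omega> (\<one>, h)" by (simp add: e)
    also have "\<dots> = 0" unfolding legs_def using h(2) by (intro push_outside) auto
    finally show ?thesis .
  qed
  define \<kappa> where "\<kappa> = (\<Sum>x\<in>carrier G. \<Omega> (x, \<one>))"
  have "(\<Sum>p\<in>carrier G2. \<Omega> p) * (\<Sum>p\<in>carrier G2. \<Omega>i p) = 1"
    using G2.conv_sum_mult[of \<Omega> \<Omega>i "\<lambda>_. 1"] by (simp add: \<Omega>_\<Omega>i sum_product sum_single(3)[where F="\<lambda>_. 1", simplified])
  then have "(\<Sum>p\<in>carrier G2. \<Omega> p) \<noteq> 0" by auto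
  moreover have "(\<Sum>p\<in>carrier G2. \<Omega> p) = (\<Sum>h\<in>carrier G. \<Sum>x\<in>carrier G. \<Omega> (x, h))"
    by (subst sum.swap) (simp add: sum.cartesian_product)
  moreover have "\<dots> = (\<Sum>h\<in>carrier G. if h = \<one> then \<kappa> else 0)"
    by (intro sum.cong refl) (auto simp: 0 \<kappa>_def)
  ultimately have "\<kappa> \<noteq> 0" by simp
  then show ?thesis
  proof (rule that)
    show "(\<Sum>x\<in>carrier G. \<Omega> (x, h)) = (if h = \<one> then \<kappa> else 0)" if "h \<in> carrier G" for h
      using 0[OF that] by (cases "h = \<one>") (simp_all add: \<kappa>_def)
  qed
qed

lemma cocycle_at:
  assumes abd: "a \<in> carrier G" "b \<in> carrier G" "d \<in> carrier G"
  shows "(\<Sum>y\<in>carrier G. \<Omega> (a \<otimes> inv y, b \<otimes> inv y) * \<Omega> (y, d)) = (\<Sum>y\<in>carrier G. \<Omega> (b \<otimes> inv y, d \<otimes> inv y) * \<Omega> (a, y))"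
proof -
  have 1: "(leg12 \<Omega> \<star>\<^sub>3 leg12_3 \<Omega>) (a, b, d) = (\<Sum>x\<in>carrier G. \<Sum>y\<in>carrier G. if y = d then \<Omega> (a \<otimes> inv x, b \<otimes> inv x) * \<Omega> (x, d) else 0)"
  proof -
    have "(leg12 \<Omega> \<star>\<^sub>3 leg12_3 \<Omega>) (a, b, d) =
      (\<Sum>x\<in>carrier G. \<Sum>y\<in>carrier G. \<Omega> (x, y) * (leg12 \<Omega> \<star>\<^sub>3 single (x, x, y)) (a, b, d))"
      unfolding legs_def[of "\<lambda>x y. (x, x, y)"] G3.conv_push carrier_DirProd
      by (subst sum.cartesian_product) (auto intro!: sum.cong)
    also have "\<dots> = (\<Sum>x\<in>carrier G. \<Sum>y\<in>carrier G. if y = d then \<Omega> (a \<otimes> inv x, b \<otimes> inv x) * \<Omega> (x, d) else 0)"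
      using abd by (intro sum.cong refl)
        (simp add: G3.conv_single inv_DirProd group_axioms DirProd_group legs_at[OF \<Omega>_vec] mult_inv_eq_one_iff)
    finally show ?thesis .
  qed
  have 2: "(leg23 \<Omega> \<star>\<^sub>3 leg1_23 \<Omega>) (a, b, d) = (\<Sum>x\<in>carrier G. \<Sum>y\<in>carrier G. if x = a then \<Omega> (b \<otimes> inv y, d \<otimes> inv y) * \<Omega> (a, y) else 0)"
  proof -
    have "(leg23 \<Omega> \<star>\<^sub>3 leg1_23 \<Omega>) (a, b, d) =
      (\<Sum>x\<in>carrier G. \<Sum>y\<in>carrier G. \<Omega> (x, y) * (leg23 \<Omega> \<star>\<^sub>3 single (x, y, y)) (a, b, d))"
      unfolding legs_def[of "\<lambda>x y. (x, y, y)"] G3.conv_push carrier_DirProd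
      by (subst sum.cartesian_product) (auto intro!: sum.cong)
    also have "\<dots> = (\<Sum>x\<in>carrier G. \<Sum>y\<in>carrier G. if x = a then \<Omega> (b \<otimes> inv y, d \<otimes> inv y) * \<Omega> (a, y) else 0)"
      using abd by (intro sum.cong refl)
        (simp add: G3.conv_single inv_DirProd group_axioms DirProd_group legs_at[OF \<Omega>_vec] mult_inv_eq_one_iff)
    finally show ?thesis .
  qed
  have "(\<Sum>x\<in>carrier G. \<Sum>y\<in>carrier G. if x = a then \<Omega> (b \<otimes> inv y, d \<otimes> inv y) * \<Omega> (a, y) else 0) =
      (\<Sum>y\<in>carrier G. \<Omega> (b \<otimes> inv y, d \<otimes> inv y) * \<Omega> (a, y))"
    using abd by (subst sum.swap) simp
  then show ?thesis using cocycle abd 1 2 by simp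
qed

lemma cocycle_shift:
  assumes abd: "a \<in> carrier G" "b \<in> carrier G" "d \<in> carrier G" and x: "x \<in> carrier G"
  shows "(\<Sum>y\<in>carrier G. \<Omega> (a \<otimes> inv y, b \<otimes> inv y) * \<Omega> (y \<otimes> inv x, d \<otimes> inv x)) =
    (\<Sum>y\<in>carrier G. \<Omega> (b \<otimes> inv y, d \<otimes> inv y) * \<Omega> (a \<otimes> inv x, y \<otimes> inv x))"
proof -
  have re: "(\<Sum>y\<in>carrier G. F y) = (\<Sum>y\<in>carrier G. F (y \<otimes> inv x))" for F :: "'a \<Rightarrow> complex"
    by (rule sum.reindex_bij_witness[where i="\<lambda>a. a \<otimes> inv x" and j="\<lambda>a. a \<otimes> x"]) (use x in \<open>auto simp: m_assoc\<close>)
  have c: "a \<otimes> inv x \<otimes> inv (y \<otimes> inv x) = a \<otimes> inv y" if "a \<in> carrier G" "y \<in> carrier G" for a y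
    using that x by (simp add: inv_mult_group m_assoc) (simp add: m_assoc[symmetric])
  have "(\<Sum>y\<in>carrier G. \<Omega> (a \<otimes> inv y, b \<otimes> inv y) * \<Omega> (y \<otimes> inv x, d \<otimes> inv x)) =
    (\<Sum>y\<in>carrier G. \<Omega> (a \<otimes> inv x \<otimes> inv y, b \<otimes> inv x \<otimes> inv y) * \<Omega> (y, d \<otimes> inv x))"
    using abd by (subst (2) re) (simp add: c)
  also have "\<dots> = (\<Sum>y\<in>carrier G. \<Omega> (b \<otimes> inv x \<otimes> inv y, d \<otimes> inv x \<otimes> inv y) * \<Omega> (a \<otimes> inv x, y))"
    by (rule cocycle_at) (use abd x in auto)
  also have "\<dots> = (\<Sum>y\<in>carrier G. \<Omega> (b \<otimes> inv y, d \<otimes> inv y) * \<Omega> (a \<otimes> inv x, y \<otimes> inv x))"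
    using abd by (subst re) (simp add: c)
  finally show ?thesis .
qed

text \<open>  The functions on the group with the product \<open>(f \<bullet> g)(x) = (f \<otimes> g)(\<Omega> \<Delta>(x))\<close>.  The coefficient
  of \<open>\<Omega> \<Delta>(x)\<close> at \<open>(a, b)\<close> is \<open>\<Omega> (a \<otimes> inv x, b \<otimes> inv x)\<close>.  The unit is the counit of the group
  algebra divided by the scalar \<open>\<kappa>\<close> of \<open>\<Omega>_sums\<close>.
\<close>

definition twisted_dual :: "'a based_algebra" where
  "twisted_dual = \<lparr>basis = carrier G,
     basis_mult = (\<lambda>a b x. if x \<in> carrier G then \<Omega> (a \<otimes> inv x, b \<otimes> inv x) else 0),
     unit_vec = (\<lambda>x. if x \<in> carrier G then inverse (\<Sum>x\<in>carrier G. \<Omega> (x, \<one>)) else 0)\<rparr>"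

abbreviation tmult (infixl \<open>\<bullet>\<close> 70) where "f \<bullet> g \<equiv> f \<otimes>\<^bsub>mult_monoid twisted_dual\<^esub> g"

lemma tmult_at: "(f \<bullet> g) x = (if x \<in> carrier G then (\<Sum>a\<in>carrier G. \<Sum>b\<in>carrier G. f a * g b * \<Omega> (a \<otimes> inv x, b \<otimes> inv x)) else 0)"
  by (simp add: mult_monoid_def twisted_dual_def)

text \<open>  Associativity is the cocycle identity, and commutativity is the symmetry of \<open>\<Omega>\<close>.
\<close>

lemma twisted_dual_comm_monoid:
  assumes sym: "flip \<Omega> = \<Omega>"
  shows "Group.comm_monoid (mult_monoid twisted_dual)"
proof (rule comm_monoidI)
  have S: "\<Omega> (x, y) = \<Omega> (y, x)" for x y
    using flip_at[OF \<Omega>_vec, of x y] by (simp add: sym)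
  have comm: "f \<bullet> g = g \<bullet> f" for f g
  proof
    fix x
    have "(\<Sum>a\<in>carrier G. \<Sum>b\<in>carrier G. f a * g b * \<Omega> (a \<otimes> inv x, b \<otimes> inv x)) =
        (\<Sum>b\<in>carrier G. \<Sum>a\<in>carrier G. f a * g b * \<Omega> (a \<otimes> inv x, b \<otimes> inv x))"
      by (rule sum.swap)
    also have "\<dots> = (\<Sum>b\<in>carrier G. \<Sum>a\<in>carrier G. g b * f a * \<Omega> (b \<otimes> inv x, a \<otimes> inv x))"
      by (intro sum.cong refl) (metis S mult.commute)
    finally show "(f \<bullet> g) x = (g \<bullet> f) x" by (simp add: tmult_at)
  qed
  show "f \<bullet> g = g \<bullet> f" for f g by (rule comm)
  show "f \<bullet> g \<in> carrier (mult_monoid twisted_dual)" for f g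
    by (simp add: mult_monoid_def twisted_dual_def vecs_def)
  show "\<one>\<^bsub>mult_monoid twisted_dual\<^esub> \<in> carrier (mult_monoid twisted_dual)"
    by (simp add: mult_monoid_def twisted_dual_def vecs_def)
  show "\<one>\<^bsub>mult_monoid twisted_dual\<^esub> \<bullet> f = f" if "f \<in> carrier (mult_monoid twisted_dual)" for f
  proof
    fix x
    obtain \<kappa> where k: "\<kappa> \<noteq> 0" "\<And>h. h \<in> carrier G \<Longrightarrow> (\<Sum>x\<in>carrier G. \<Omega> (x, h)) = (if h = \<one> then \<kappa> else 0)"
      using \<Omega>_sums by blast
    show "(\<one>\<^bsub>mult_monoid twisted_dual\<^esub> \<bullet> f) x = f x"
    proof (cases "x \<in> carrier G")
      case True
      have "(\<one>\<^bsub>mult_monoid twisted_dual\<^esub> \<bullet> f) x = (\<Sum>a\<in>carrier G. \<Sum>b\<in>carrier G. inverse \<kappa> * f b * \<Omega> (a \<otimes> inv x, b \<otimes> inv x))"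
        using True k(2)[of \<one>] by (simp add: tmult_at) (simp add: mult_monoid_def twisted_dual_def)
      also have "\<dots> = (\<Sum>b\<in>carrier G. inverse \<kappa> * f b * (\<Sum>a\<in>carrier G. \<Omega> (a \<otimes> inv x, b \<otimes> inv x)))"
        by (subst sum.swap) (simp add: sum_distrib_left)
      also have "\<dots> = (\<Sum>b\<in>carrier G. if b = x then f x else 0)"
      proof (intro sum.cong refl)
        fix b assume b: "b \<in> carrier G"
        have "(\<Sum>a\<in>carrier G. \<Omega> (a \<otimes> inv x, b \<otimes> inv x)) = (\<Sum>a\<in>carrier G. \<Omega> (a, b \<otimes> inv x))"
          by (rule sum.reindex_bij_witness[where i="\<lambda>a. a \<otimes> x" and j="\<lambda>a. a \<otimes> inv x"]) (use True in \<open>auto simp: m_assoc\<close>)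
        also have "\<dots> = (if b = x then \<kappa> else 0)"
          using k(2)[of "b \<otimes> inv x"] mult_inv_eq_one_iff[of b x] True b by auto
        finally show "inverse \<kappa> * f b * (\<Sum>a\<in>carrier G. \<Omega> (a \<otimes> inv x, b \<otimes> inv x)) = (if b = x then f x else 0)"
          using k(1) by simp
      qed
      also have "\<dots> = f x" using True by simp
      finally show ?thesis .
    next
      case False
      then show ?thesis using that by (simp add: tmult_at) (simp add: mult_monoid_def twisted_dual_def vecs_def)
    qed
  qed
  show "f \<bullet> g \<bullet> h = f \<bullet> (g \<bullet> h)" for f g h
  proof
    fix x
    show "(f \<bullet> g \<bullet> h) x = (f \<bullet> (g \<bullet> h)) x"
    proof (cases "x \<in> carrier G")
      case True
      let ?G = "carrier G"
      let ?L = "\<lambda>a b d y. f a * g b * h d * (\<Omega> (a \<otimes> inv y, b \<otimes> inv y) * \<Omega> (y \<otimes> inv x, d \<otimes> inv x))"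
      let ?R = "\<lambda>a b d y. f a * g b * h d * (\<Omega> (b \<otimes> inv y, d \<otimes> inv y) * \<Omega> (a \<otimes> inv x, y \<otimes> inv x))"
      have "(f \<bullet> g \<bullet> h) x = (\<Sum>y\<in>?G. \<Sum>d\<in>?G. \<Sum>a\<in>?G. \<Sum>b\<in>?G. ?L a b d y)"
        using True by (subst tmult_at) (simp add: tmult_at sum_distrib_left sum_distrib_right mult_ac)
      also have "\<dots> = (\<Sum>d\<in>?G. \<Sum>y\<in>?G. \<Sum>a\<in>?G. \<Sum>b\<in>?G. ?L a b d y)" by (rule sum.swap)
      also have "\<dots> = (\<Sum>d\<in>?G. \<Sum>a\<in>?G. \<Sum>y\<in>?G. \<Sum>b\<in>?G. ?L a b d y)" by (intro sum.cong refl sum.swap)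
      also have "\<dots> = (\<Sum>d\<in>?G. \<Sum>a\<in>?G. \<Sum>b\<in>?G. \<Sum>y\<in>?G. ?L a b d y)" by (rule sum.cong[OF refl], rule sum.cong[OF refl], rule sum.swap)
      also have "\<dots> = (\<Sum>d\<in>?G. \<Sum>a\<in>?G. \<Sum>b\<in>?G. \<Sum>y\<in>?G. ?R a b d y)"
        by (rule sum.cong[OF refl], rule sum.cong[OF refl], rule sum.cong[OF refl])
          (use True in \<open>simp only: sum_distrib_left[symmetric] cocycle_shift\<close>)
      also have "\<dots> = (\<Sum>a\<in>?G. \<Sum>d\<in>?G. \<Sum>b\<in>?G. \<Sum>y\<in>?G. ?R a b d y)" by (rule sum.swap)
      also have "\<dots> = (\<Sum>a\<in>?G. \<Sum>d\<in>?G. \<Sum>y\<in>?G. \<Sum>b\<in>?G. ?R a b d y)" by (rule sum.cong[OF refl], rule sum.cong[OF refl], rule sum.swap)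
      also have "\<dots> = (\<Sum>a\<in>?G. \<Sum>y\<in>?G. \<Sum>d\<in>?G. \<Sum>b\<in>?G. ?R a b d y)" by (rule sum.cong[OF refl], rule sum.swap)
      also have "\<dots> = (\<Sum>a\<in>?G. \<Sum>y\<in>?G. \<Sum>b\<in>?G. \<Sum>d\<in>?G. ?R a b d y)" by (rule sum.cong[OF refl], rule sum.cong[OF refl], rule sum.swap)
      also have "\<dots> = (f \<bullet> (g \<bullet> h)) x"
        using True by (simp add: tmult_at[of f] tmult_at[of g] sum_distrib_left sum_distrib_right mult_ac)
      finally show ?thesis .
    next
      case False
      then show ?thesis by (simp add: tmult_at)
    qed
  qed
qed

text \<open>  A character of the twisted dual is evaluation at an element \<open>v\<close> of the group algebra, and
  multiplicativity of the character is the displayed equation for \<open>v\<close>.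
\<close>

lemma symmetric_twist:
  assumes sym: "flip \<Omega> = \<Omega>"
  shows "\<exists>v\<in>vec. \<Omega> \<star>\<^sub>2 Delta v = v \<boxtimes> v \<and> (\<Sum>x\<in>carrier G. v x) \<noteq> 0"
proof -
  obtain \<kappa> where k: "\<kappa> \<noteq> 0" "\<And>h. h \<in> carrier G \<Longrightarrow> (\<Sum>x\<in>carrier G. \<Omega> (x, h)) = (if h = \<one> then \<kappa> else 0)"
    using \<Omega>_sums by blast
  have b: "basis twisted_dual = carrier G" by (simp add: twisted_dual_def)
  have u: "unit_vec twisted_dual = (\<lambda>x. if x \<in> carrier G then inverse \<kappa> else 0)"
    using k(2)[of \<one>] by (auto simp: twisted_dual_def fun_eq_iff)
  have "unit_vec twisted_dual \<noteq> (\<lambda>_. 0)" using k(1) by (auto simp: u fun_eq_iff)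
  then obtain \<chi> where \<chi>: "(\<Sum>x\<in>carrier G. unit_vec twisted_dual x * \<chi> x) = 1"
    "\<And>a b. a \<in> carrier G \<Longrightarrow> b \<in> carrier G \<Longrightarrow> (\<Sum>x\<in>carrier G. basis_mult twisted_dual a b x * \<chi> x) = \<chi> a * \<chi> b"
    using character_exists[OF _ twisted_dual_comm_monoid[OF sym]] by (auto simp: b)
  define v where "v x = (if x \<in> carrier G then \<chi> x else 0)" for x
  have v: "v \<in> vec" by (simp add: v_def vecs_def)
  have "\<Omega> \<star>\<^sub>2 Delta v = v \<boxtimes> v"
  proof (rule G2.vec_eqI)
    fix p assume "p \<in> carrier G2"
    then obtain a b where p: "p = (a, b)" "a \<in> carrier G" "b \<in> carrier G" by auto
    have "(\<Omega> \<star>\<^sub>2 Delta v) (a, b) = (\<Sum>x\<in>carrier G. v x * \<Omega> (a \<otimes> inv x, b \<otimes> inv x))"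
      unfolding Delta_def G2.conv_push
      using p by (intro sum.cong refl) (simp add: G2.conv_single inv_DirProd group_axioms)
    also have "\<dots> = (\<Sum>x\<in>carrier G. basis_mult twisted_dual a b x * \<chi> x)"
      by (intro sum.cong refl) (simp add: twisted_dual_def v_def mult.commute)
    also have "\<dots> = (v \<boxtimes> v) (a, b)" using p \<chi>(2) by (simp add: tensor_def v_def)
    finally show "(\<Omega> \<star>\<^sub>2 Delta v) p = (v \<boxtimes> v) p" by (simp add: p)
  qed (use v in simp_all)
  moreover have "inverse \<kappa> * (\<Sum>x\<in>carrier G. v x) = 1"
    using \<chi>(1) by (simp add: u v_def sum_distrib_left)
  then have "(\<Sum>x\<in>carrier G. v x) \<noteq> 0" by auto
  ultimately show ?thesis using v by blast
qed

text \<open>  Multiply \<open>\<Omega> \<Delta>(v) = v \<otimes> v\<close> on the right by the coproduct of the sum \<open>e\<close> of all group elements: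
  since \<open>v e\<close> is a nonzero multiple of \<open>e\<close>, this relates \<open>v \<otimes> v\<close> to the invertible \<open>\<Omega>\<close> and to
  \<open>\<Delta>(e)\<close>, from which \<open>w\<close> can be read off.
\<close>

lemma twist_injective:
  assumes v: "v \<in> vec" "\<Omega> \<star>\<^sub>2 Delta v = v \<boxtimes> v" "(\<Sum>x\<in>carrier G. v x) \<noteq> 0"
    and w: "w \<in> vec" "w \<star> v = (\<lambda>_. 0)"
  shows "w = (\<lambda>_. 0)"
proof -
  define e where "e x = (if x \<in> carrier G then 1 else 0 :: complex)" for x
  have e: "e \<in> vec" by (simp add: e_def vecs_def)
  have ve: "v \<star> e = (\<lambda>x. (\<Sum>x\<in>carrier G. v x) * e x)"
  proof (rule vec_eqI)
    show "(\<lambda>x. (\<Sum>x\<in>carrier G. v x) * e x) \<in> vec" by (simp add: vecs_def e_def)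
  qed (auto simp: conv_left e_def)
  let ?w = "w \<boxtimes> single \<one>"
  have "?w \<star>\<^sub>2 (v \<boxtimes> v) = (\<lambda>_. 0)"
    using v(1) by (simp add: tensor_conv w(2)) (simp add: tensor_def case_prod_unfold)
  then have "?w \<star>\<^sub>2 (\<Omega> \<star>\<^sub>2 Delta v) \<star>\<^sub>2 Delta e = (\<lambda>_. 0)"
    by (simp add: v(2) G2.zero_conv)
  moreover have "Delta v \<star>\<^sub>2 Delta e = (\<lambda>p. (\<Sum>x\<in>carrier G. v x) * Delta e p)"
    unfolding Delta_conv[symmetric] ve by (rule Delta_scale)
  ultimately have "(\<lambda>p. (\<Sum>x\<in>carrier G. v x) * (?w \<star>\<^sub>2 (\<Omega> \<star>\<^sub>2 Delta e)) p) = (\<lambda>_. 0)"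
    by (simp add: G2.conv_assoc G2.conv_scale)
  then have "?w \<star>\<^sub>2 (\<Omega> \<star>\<^sub>2 Delta e) = (\<lambda>_. 0)" using v(3) by (simp add: fun_eq_iff)
  moreover have "\<Omega> \<star>\<^sub>2 Delta e = Delta e \<star>\<^sub>2 \<Omega>"
    unfolding Delta_def by (rule G2.commute_push) (use \<Omega>_inv in \<open>simp add: diag_invariant_def\<close>)
  ultimately have "?w \<star>\<^sub>2 Delta e \<star>\<^sub>2 \<Omega> \<star>\<^sub>2 \<Omega>i = (\<lambda>_. 0)"
    by (simp add: G2.conv_assoc[symmetric] G2.zero_conv)
  then have z: "?w \<star>\<^sub>2 Delta e = (\<lambda>_. 0)" by (simp add: G2.conv_assoc \<Omega>_\<Omega>i)
  have "w x = 0" if x: "x \<in> carrier G" for x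
  proof -
    have "(?w \<star>\<^sub>2 Delta e) (x, \<one>) = (\<Sum>h\<in>carrier G. e h * ?w (x \<otimes> inv h, inv h))"
      unfolding Delta_def G2.conv_push
      using x by (intro sum.cong refl) (simp add: G2.conv_single inv_DirProd group_axioms)
    also have "\<dots> = (\<Sum>h\<in>carrier G. if h = \<one> then w x else 0)"
      using x by (intro sum.cong refl) (auto simp: e_def tensor_def single_def)
    finally show ?thesis using z by simp
  qed
  then show ?thesis using vec_outside[OF w(1)] by blast
qed

text \<open>  Invariance of \<open>\<Omega>\<close> makes the conjugates of group elements by \<open>v\<close> grouplike, so \<open>v\<close> normalises
  the group.  It is central only up to an automorphism of the group.
\<close>

lemma symmetric_coboundary:
  assumes sym: "flip \<Omega> = \<Omega>"
  shows "\<exists>v\<in>vec. \<exists>vi\<in>vec. v \<star> vi = single \<one> \<and> vi \<star> v = single \<one> \<and> \<Omega> = (v \<boxtimes> v) \<star>\<^sub>2 Delta vi \<and>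
    (\<forall>g\<in>carrier G. \<exists>g'\<in>carrier G. vi \<star> single g \<star> v = single g')"
proof -
  obtain v where v: "v \<in> vec" "\<Omega> \<star>\<^sub>2 Delta v = v \<boxtimes> v" "(\<Sum>x\<in>carrier G. v x) \<noteq> 0"
    using symmetric_twist[OF sym] by blast
  obtain vi where vi: "vi \<in> vec" "vi \<star> v = single \<one>" "v \<star> vi = single \<one>"
    using conv_inverse[OF v(1) twist_injective[OF v]] by blast
  have D1: "Delta v \<star>\<^sub>2 Delta vi = single (\<one>, \<one>)"
    by (simp add: Delta_conv[symmetric] vi Delta_single)
  have V1: "(vi \<boxtimes> vi) \<star>\<^sub>2 (v \<boxtimes> v) = single (\<one>, \<one>)"
    by (simp add: tensor_conv vi tensor_single)
  have \<Omega>: "\<Omega> = (v \<boxtimes> v) \<star>\<^sub>2 Delta vi"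
    by (simp add: v(2)[symmetric] G2.conv_assoc D1 one2[OF \<Omega>_vec])
  have Dvi: "(vi \<boxtimes> vi) \<star>\<^sub>2 \<Omega> = Delta vi"
    by (simp add: \<Omega> G2.conv_assoc[symmetric] V1)
  have "\<exists>g'\<in>carrier G. vi \<star> single g \<star> v = single g'" if g: "g \<in> carrier G" for g
  proof (rule grouplike)
    let ?y = "vi \<star> single g \<star> v"
    have "Delta ?y = (vi \<boxtimes> vi) \<star>\<^sub>2 (\<Omega> \<star>\<^sub>2 single (g, g)) \<star>\<^sub>2 Delta v"
      by (simp add: Delta_conv Delta_single g Dvi[symmetric] G2.conv_assoc)
    also have "\<Omega> \<star>\<^sub>2 single (g, g) = single (g, g) \<star>\<^sub>2 \<Omega>"
      using \<Omega>_inv g by (simp add: diag_invariant_def)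
    also have "(vi \<boxtimes> vi) \<star>\<^sub>2 (single (g, g) \<star>\<^sub>2 \<Omega>) \<star>\<^sub>2 Delta v =
        (vi \<boxtimes> vi) \<star>\<^sub>2 (single g \<boxtimes> single g) \<star>\<^sub>2 (v \<boxtimes> v)"
      by (simp add: v(2) G2.conv_assoc tensor_single)
    also have "\<dots> = ?y \<boxtimes> ?y" by (simp add: tensor_conv)
    finally show "Delta ?y = ?y \<boxtimes> ?y" .
    show "?y \<noteq> (\<lambda>_. 0)"
    proof
      assume "?y = (\<lambda>_. 0)"
      then have "v \<star> ?y \<star> vi = (\<lambda>_. 0)" by (simp add: conv_sum fun_eq_iff)
      moreover have "v \<star> ?y \<star> vi = (v \<star> vi) \<star> single g \<star> (v \<star> vi)" by (simp add: conv_assoc)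
      ultimately have "single g = (\<lambda>_. 0)" using g by (simp add: vi)
      then show False by (auto simp: single_def fun_eq_iff split: if_splits)
    qed
  qed simp
  then show ?thesis using v(1) vi \<Omega> by blast
qed

end

section \<open>Coboundaries of normalising units\<close>

context fin_group_hopf
begin

abbreviation ainv :: "('a \<Rightarrow> complex) \<Rightarrow> 'a \<Rightarrow> complex" where "ainv v \<equiv> inv\<^bsub>alg\<^esub> v"

text \<open>  Conjugation by such a unit is an automorphism of the group that preserves conjugacy classes.  The
  coboundary of the unit is an invariant cocycle even if the unit is not central.
\<close>

definition normalisers :: "('a \<Rightarrow> complex) set" where
  "normalisers = {v \<in> Units alg. \<forall>g\<in>carrier G. \<exists>g'\<in>carrier G. ainv v \<star> single g \<star> v = single g'}"

abbreviation cob :: "('a \<Rightarrow> complex) \<Rightarrow> 'a \<times> 'a \<Rightarrow> complex" where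
  "cob \<equiv> coboundary (group_algebra G)"

lemma cob_eq: "cob v = (v \<boxtimes> v) \<star>\<^sub>2 Delta (ainv v)"
  by (simp add: coboundary_def comult_eq mult_monoid_tensor_group_algebra)

lemma unit_simps:
  assumes "v \<in> Units alg"
  shows "v \<in> vec" "ainv v \<in> vec" "v \<star> ainv v = single \<one>" "ainv v \<star> v = single \<one>" "ainv v \<in> Units alg"
  using assms A.Units_closed A.Units_inv_closed A.Units_r_inv A.Units_l_inv A.Units_inv_Units by auto

lemma unitI:
  assumes "v \<in> vec" "w \<in> vec" "v \<star> w = single \<one>" "w \<star> v = single \<one>"
  shows "v \<in> Units alg" "ainv v = w"
proof -
  show 1: "v \<in> Units alg" using assms by (auto simp: Units_def ga_basis[OF group_axioms fin])
  show "ainv v = w" using assms by (intro A.inv_unique'[symmetric]) auto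
qed

lemma unit_single: "g \<in> carrier G \<Longrightarrow> single g \<in> Units alg" "g \<in> carrier G \<Longrightarrow> ainv (single g) = single (inv g)"
  using unitI[of "single g" "single (inv g)"] by (simp_all add: single_conv_single)

lemma unit_mult: 
  assumes "v \<in> Units alg" "w \<in> Units alg"
  shows "v \<star> w \<in> Units alg" "ainv (v \<star> w) = ainv w \<star> ainv v"
proof -
  note v = unit_simps[OF assms(1)] and w = unit_simps[OF assms(2)]
  have "v \<star> w \<star> (ainv w \<star> ainv v) = v \<star> (w \<star> ainv w) \<star> ainv v" by (simp only: conv_assoc)
  then have 1: "v \<star> w \<star> (ainv w \<star> ainv v) = single \<one>" using v w by simp
  have "ainv w \<star> ainv v \<star> (v \<star> w) = ainv w \<star> (ainv v \<star> v) \<star> w" by (simp only: conv_assoc)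
  then have 2: "ainv w \<star> ainv v \<star> (v \<star> w) = single \<one>" using v w by simp
  show "v \<star> w \<in> Units alg" "ainv (v \<star> w) = ainv w \<star> ainv v"
    using unitI[OF _ _ 1 2] by auto
qed

lemma normalisers_unit: "v \<in> normalisers \<Longrightarrow> v \<in> Units alg"
  by (simp add: normalisers_def)

lemma normalisersD:
  assumes "v \<in> normalisers" "g \<in> carrier G"
  obtains g' where "g' \<in> carrier G" "ainv v \<star> single g \<star> v = single g'"
  using assms by (auto simp: normalisers_def)

lemma normalisers_mult:
  assumes v: "v \<in> normalisers" and w: "w \<in> normalisers"
  shows "v \<star> w \<in> normalisers"
proof -
  note u = unit_mult[OF normalisers_unit[OF v] normalisers_unit[OF w]]
  have "\<exists>g'\<in>carrier G. ainv (v \<star> w) \<star> single g \<star> (v \<star> w) = single g'" if g: "g \<in> carrier G" for g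
  proof -
    obtain h where h: "h \<in> carrier G" "ainv v \<star> single g \<star> v = single h" using normalisersD[OF v g] .
    obtain k where k: "k \<in> carrier G" "ainv w \<star> single h \<star> w = single k" using normalisersD[OF w h(1)] .
    have "ainv (v \<star> w) \<star> single g \<star> (v \<star> w) = ainv w \<star> (ainv v \<star> single g \<star> v) \<star> w"
      by (simp add: u conv_assoc)
    then show ?thesis using h k by auto
  qed
  then show ?thesis using u by (simp add: normalisers_def)
qed

lemma normalisers_inv:
  assumes v: "v \<in> normalisers"
  shows "ainv v \<in> normalisers"
proof -
  note s = unit_simps[OF normalisers_unit[OF v]]
  have e: "v \<star> (ainv v \<star> single g \<star> v) \<star> ainv v = single g" if g: "g \<in> carrier G" for g
  proof -
    have "v \<star> (ainv v \<star> single g \<star> v) \<star> ainv v = (v \<star> ainv v) \<star> single g \<star> (v \<star> ainv v)"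
      by (simp only: conv_assoc)
    then show ?thesis using g s by simp
  qed
  have "\<forall>g\<in>carrier G. \<exists>g'. g' \<in> carrier G \<and> ainv v \<star> single g \<star> v = single g'"
    using v by (auto simp: normalisers_def)
  then obtain \<alpha> where \<alpha>: "\<And>g. g \<in> carrier G \<Longrightarrow> \<alpha> g \<in> carrier G \<and> ainv v \<star> single g \<star> v = single (\<alpha> g)"
    by metis
  have "inj_on \<alpha> (carrier G)"
  proof (rule inj_onI)
    fix g h assume gh: "g \<in> carrier G" "h \<in> carrier G" "\<alpha> g = \<alpha> h"
    then have "single g = single h" using e[of g] e[of h] \<alpha>[of g] \<alpha>[of h] by simp
    from fun_cong[OF this, of g] show "g = h" by (auto simp: single_def split: if_splits)
  qed
  then have surj: "\<alpha> ` carrier G = carrier G"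
    using \<alpha> by (intro endo_inj_surj) auto
  have "\<exists>g\<in>carrier G. v \<star> single h \<star> ainv v = single g" if "h \<in> carrier G" for h
  proof -
    obtain g where g: "g \<in> carrier G" "h = \<alpha> g" using \<open>h \<in> carrier G\<close> surj by auto
    then have "v \<star> single h \<star> ainv v = single g" using e[of g] \<alpha>[of g] by simp
    then show ?thesis using g by blast
  qed
  then show ?thesis using s unitI(2)[OF s(2,1,4,3)] by (simp add: normalisers_def)
qed

lemma normalisers_single: "g \<in> carrier G \<Longrightarrow> single g \<in> normalisers"
  by (auto simp: normalisers_def unit_single single_conv_single)

lemma A1_iff: "v \<in> A1 (group_algebra G) \<longleftrightarrow> v \<in> Units alg \<and> (\<forall>a\<in>vec. v \<star> a = a \<star> v)"
  by (simp add: A1_def ga_basis[OF group_axioms fin])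

lemma A1_I:
  assumes "v \<in> Units alg" "\<And>g. g \<in> carrier G \<Longrightarrow> v \<star> single g = single g \<star> v"
  shows "v \<in> A1 (group_algebra G)"
  using assms commute_all[of v] by (auto simp: A1_iff)

lemma A1_normalisers: "v \<in> A1 (group_algebra G) \<Longrightarrow> v \<in> normalisers"
proof -
  assume v: "v \<in> A1 (group_algebra G)"
  then have u: "v \<in> Units alg" by (simp add: A1_iff)
  note s = unit_simps[OF u]
  have "ainv v \<star> single g \<star> v = single g" if g: "g \<in> carrier G" for g
  proof -
    have "single g \<star> v = v \<star> single g" using v g by (simp add: A1_iff)
    then have "ainv v \<star> single g \<star> v = (ainv v \<star> v) \<star> single g" by (simp only: conv_assoc)
    then show ?thesis using s g by simp
  qed
  then show ?thesis using u by (auto simp: normalisers_def)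
qed

lemma A1_mult:
  assumes "v \<in> A1 (group_algebra G)" "w \<in> A1 (group_algebra G)"
  shows "v \<star> w \<in> A1 (group_algebra G)"
proof (rule A1_I)
  show "v \<star> w \<in> Units alg" using assms by (simp add: A1_iff unit_mult)
  fix g assume g: "g \<in> carrier G"
  have c: "v \<star> single g = single g \<star> v" "w \<star> single g = single g \<star> w"
    using assms g by (simp_all add: A1_iff)
  have "v \<star> w \<star> single g = (v \<star> single g) \<star> w" by (simp only: conv_assoc c(2))
  then show "v \<star> w \<star> single g = single g \<star> (v \<star> w)" by (simp only: conv_assoc c(1))
qed

lemma A1_inv:
  assumes v: "v \<in> A1 (group_algebra G)"
  shows "ainv v \<in> A1 (group_algebra G)"
proof (rule A1_I)
  have u: "v \<in> Units alg" using v by (simp add: A1_iff)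
  note s = unit_simps[OF u]
  show "ainv v \<in> Units alg" by (rule s)
  fix g assume g: "g \<in> carrier G"
  have "ainv v \<star> single g = ainv v \<star> (single g \<star> v) \<star> ainv v"
    using g s by (simp add: conv_assoc)
  also have "single g \<star> v = v \<star> single g" using v g by (simp add: A1_iff)
  also have "ainv v \<star> (v \<star> single g) \<star> ainv v = (ainv v \<star> v) \<star> single g \<star> ainv v" by (simp add: conv_assoc)
  finally show "ainv v \<star> single g = single g \<star> ainv v" using g s by simp
qed

lemma one_A1: "single \<one> \<in> A1 (group_algebra G)"
  by (rule A1_I) (simp_all add: unit_single)

lemma tensor_one_conv [simp]:
  "Z \<in> vecs (carrier G \<times> carrier G) \<Longrightarrow> single (\<one>, \<one>) \<star>\<^sub>2 Z = Z"
  "Z \<in> vecs (carrier G \<times> carrier G) \<Longrightarrow> Z \<star>\<^sub>2 single (\<one>, \<one>) = Z"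
  using G2.A.l_one[of Z] G2.A.r_one[of Z] by auto

lemma Delta_unit:
  assumes "v \<in> Units alg"
  shows "Delta v \<star>\<^sub>2 Delta (ainv v) = single (\<one>, \<one>)" "Delta (ainv v) \<star>\<^sub>2 Delta v = single (\<one>, \<one>)"
  using unit_simps[OF assms] by (simp_all add: Delta_single flip: Delta_conv)

lemma tensor_unit:
  assumes "v \<in> Units alg"
  shows "(v \<boxtimes> v) \<star>\<^sub>2 (ainv v \<boxtimes> ainv v) = single (\<one>, \<one>)" "(ainv v \<boxtimes> ainv v) \<star>\<^sub>2 (v \<boxtimes> v) = single (\<one>, \<one>)"
  using unit_simps[OF assms] by (simp_all add: tensor_conv tensor_single)

lemma cob_unit:
  assumes v: "v \<in> Units alg"
  shows "cob v \<in> Units G2.alg"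
proof -
  let ?i = "Delta v \<star>\<^sub>2 (ainv v \<boxtimes> ainv v)"
  have "cob v \<star>\<^sub>2 ?i = (v \<boxtimes> v) \<star>\<^sub>2 (Delta (ainv v) \<star>\<^sub>2 Delta v) \<star>\<^sub>2 (ainv v \<boxtimes> ainv v)"
    by (simp add: cob_eq G2.conv_assoc)
  then have 1: "cob v \<star>\<^sub>2 ?i = single (\<one>, \<one>)"
    using unit_simps[OF v] by (simp add: Delta_unit[OF v] tensor_unit[OF v])
  have "?i \<star>\<^sub>2 cob v = Delta v \<star>\<^sub>2 ((ainv v \<boxtimes> ainv v) \<star>\<^sub>2 (v \<boxtimes> v)) \<star>\<^sub>2 Delta (ainv v)"
    by (simp add: cob_eq G2.conv_assoc)
  then have 2: "?i \<star>\<^sub>2 cob v = single (\<one>, \<one>)"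
    by (simp add: Delta_unit[OF v] tensor_unit[OF v])
  have "cob v \<in> G2.vec" by (simp add: cob_eq)
  with 1 2 show ?thesis
    by (auto simp: Units_def ga_basis[OF G2.group_axioms G2.fin] intro!: bexI[of _ ?i])
qed

lemma push_tensor_legs:
  assumes \<phi>: "\<And>x y x' y'. \<lbrakk>x \<in> carrier G; y \<in> carrier G; x' \<in> carrier G; y' \<in> carrier G\<rbrakk>
    \<Longrightarrow> \<phi> x y \<in> carrier G3 \<and> \<phi> (x \<otimes> x') (y \<otimes> y') = \<phi> x y \<otimes>\<^bsub>G3\<^esub> \<phi> x' y'"
    and vw: "v \<in> vec" "w \<in> vec"
  shows "legs \<phi> (v \<boxtimes> w) = push G (\<lambda>x. \<phi> x \<one>) v \<star>\<^sub>3 push G (\<lambda>x. \<phi> \<one> x) w"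
proof -
  have c: "\<phi> x y \<in> carrier G3" if "x \<in> carrier G" "y \<in> carrier G" for x y
    using \<phi>[OF that that] by simp
  have "push G (\<lambda>x. \<phi> x \<one>) v \<star>\<^sub>3 push G (\<lambda>x. \<phi> \<one> x) w =
      (\<lambda>z. \<Sum>x\<in>carrier G. v x * (\<Sum>y\<in>carrier G. w y * (single (\<phi> x \<one>) \<star>\<^sub>3 single (\<phi> \<one> y)) z))"
    by (subst G3.push_conv) (simp only: G3.conv_push)
  also have "\<dots> = (\<lambda>z. \<Sum>x\<in>carrier G. \<Sum>y\<in>carrier G. v x * w y * single (\<phi> x y) z)"
  proof (rule ext, rule sum.cong[OF refl])
    fix z x assume x: "x \<in> carrier G"
    have "single (\<phi> x \<one>) \<star>\<^sub>3 single (\<phi> \<one> y) = single (\<phi> x y)" if y: "y \<in> carrier G" for y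
      using G3.single_conv_single[OF c c, of x \<one> \<one> y] x y \<phi>[of x \<one> \<one> y] by simp
    then show "v x * (\<Sum>y\<in>carrier G. w y * (single (\<phi> x \<one>) \<star>\<^sub>3 single (\<phi> \<one> y)) z) =
        (\<Sum>y\<in>carrier G. v x * w y * single (\<phi> x y) z)"
      by (simp add: sum_distrib_left mult.assoc)
  qed
  also have "\<dots> = legs \<phi> (v \<boxtimes> w)"
    unfolding legs_def push_def tensor_def carrier_DirProd
    by (simp only: sum.cartesian_product) (simp add: case_prod_unfold)
  finally show ?thesis ..
qed

lemma push_commute3:
  assumes "\<And>x y. x \<in> carrier G \<Longrightarrow> y \<in> carrier G \<Longrightarrow> \<phi> x \<in> carrier G3 \<and> \<psi> y \<in> carrier G3 \<and> \<phi> x \<otimes>\<^bsub>G3\<^esub> \<psi> y = \<psi> y \<otimes>\<^bsub>G3\<^esub> \<phi> x"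
  shows "push G \<phi> f \<star>\<^sub>3 push G \<psi> g = push G \<psi> g \<star>\<^sub>3 push G \<phi> f"
proof (rule G3.commute_push)
  fix y assume y: "y \<in> carrier G"
  show "push G \<phi> f \<star>\<^sub>3 single (\<psi> y) = single (\<psi> y) \<star>\<^sub>3 push G \<phi> f"
    by (rule G3.commute_push[symmetric]) (use assms y in \<open>metis G3.single_conv_single\<close>)
qed

lemma legs_Delta: "legs \<phi> (Delta f) = push G (\<lambda>x. \<phi> x x) f"
  unfolding legs_def Delta_def by (subst push_push) auto

lemma cob_cocycle:
  assumes v: "v \<in> Units alg"
  shows "two_cocycle (group_algebra G) (cob v)"
proof -
  note s = unit_simps[OF v]
  let ?p = "\<lambda>\<phi> f. push G \<phi> f :: 'a \<times> 'a \<times> 'a \<Rightarrow> complex"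
  let ?e1 = "?p (\<lambda>x. (x, \<one>, \<one>)) v" and ?e2 = "?p (\<lambda>x. (\<one>, x, \<one>)) v" and ?e3 = "?p (\<lambda>x. (\<one>, \<one>, x)) v"
  let ?d = "?p (\<lambda>x. (x, x, x)) (ainv v)"
  note tl = push_tensor_legs[OF _ s(1) s(1)]
  have inv: "?p \<phi> (ainv v) \<star>\<^sub>3 ?p \<phi> v = single (\<one>, \<one>, \<one>)" if "\<phi> \<in> hom G G3" for \<phi>
    using push_mult[OF fin_group_G fin_group_G3 that, of "ainv v" v] push_one[OF fin_group_G fin_group_G3 that] by (simp add: s)
  have one: "single (\<one>, \<one>, \<one>) \<star>\<^sub>3 ?p (\<lambda>x. (x, x, x)) f = ?p (\<lambda>x. (x, x, x)) f" for f
    using G3.A.l_one[of "?p (\<lambda>x. (x, x, x)) f"] push_closed[of G "\<lambda>x. (x, x, x)" "carrier G3" f] by simp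
  have l1: "leg23 (cob v) = ?e2 \<star>\<^sub>3 ?e3 \<star>\<^sub>3 ?p (\<lambda>x. (\<one>, x, x)) (ainv v)"
    unfolding cob_eq by (subst legs_mult3, simp, subst tl) (auto simp: legs_Delta)
  have l2: "leg1_23 (cob v) = ?e1 \<star>\<^sub>3 ?p (\<lambda>x. (\<one>, x, x)) v \<star>\<^sub>3 ?d"
    unfolding cob_eq by (subst legs_mult3, simp, subst tl) (auto simp: legs_Delta)
  have l3: "leg12 (cob v) = ?e1 \<star>\<^sub>3 ?e2 \<star>\<^sub>3 ?p (\<lambda>x. (x, x, \<one>)) (ainv v)"
    unfolding cob_eq by (subst legs_mult3, simp, subst tl) (auto simp: legs_Delta)
  have l4: "leg12_3 (cob v) = ?p (\<lambda>x. (x, x, \<one>)) v \<star>\<^sub>3 ?e3 \<star>\<^sub>3 ?d"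
    unfolding cob_eq by (subst legs_mult3, simp, subst tl) (auto simp: legs_Delta)
  have c1: "?p (\<lambda>x. (\<one>, x, x)) (ainv v) \<star>\<^sub>3 ?e1 = ?e1 \<star>\<^sub>3 ?p (\<lambda>x. (\<one>, x, x)) (ainv v)"
    by (rule push_commute3) auto
  have c2: "?e3 \<star>\<^sub>3 ?e1 = ?e1 \<star>\<^sub>3 ?e3" by (rule push_commute3) auto
  have c3: "?e2 \<star>\<^sub>3 ?e1 = ?e1 \<star>\<^sub>3 ?e2" by (rule push_commute3) auto
  have i1: "?p (\<lambda>x. (\<one>, x, x)) (ainv v) \<star>\<^sub>3 ?p (\<lambda>x. (\<one>, x, x)) v = single (\<one>, \<one>, \<one>)"
    by (rule inv) (auto simp: hom_def)
  have i2: "?p (\<lambda>x. (x, x, \<one>)) (ainv v) \<star>\<^sub>3 ?p (\<lambda>x. (x, x, \<one>)) v = single (\<one>, \<one>, \<one>)"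
    by (rule inv) (auto simp: hom_def)
  have e3: "?e3 \<in> G3.vec" by (rule push_closed) auto
  have "leg23 (cob v) \<star>\<^sub>3 leg1_23 (cob v) =
      ?e2 \<star>\<^sub>3 ?e3 \<star>\<^sub>3 (?p (\<lambda>x. (\<one>, x, x)) (ainv v) \<star>\<^sub>3 ?e1) \<star>\<^sub>3 ?p (\<lambda>x. (\<one>, x, x)) v \<star>\<^sub>3 ?d"
    by (simp only: l1 l2 G3.conv_assoc)
  also have "\<dots> = ?e2 \<star>\<^sub>3 (?e3 \<star>\<^sub>3 ?e1) \<star>\<^sub>3 ((?p (\<lambda>x. (\<one>, x, x)) (ainv v) \<star>\<^sub>3 ?p (\<lambda>x. (\<one>, x, x)) v) \<star>\<^sub>3 ?d)"
    by (simp only: c1 G3.conv_assoc)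
  also have "\<dots> = (?e2 \<star>\<^sub>3 ?e1) \<star>\<^sub>3 (?e3 \<star>\<^sub>3 ?d)"
    by (simp only: c2 i1 one G3.conv_assoc)
  finally have L: "leg23 (cob v) \<star>\<^sub>3 leg1_23 (cob v) = ?e1 \<star>\<^sub>3 ?e2 \<star>\<^sub>3 (?e3 \<star>\<^sub>3 ?d)"
    by (simp only: c3)
  have "leg12 (cob v) \<star>\<^sub>3 leg12_3 (cob v) =
      ?e1 \<star>\<^sub>3 ?e2 \<star>\<^sub>3 ((?p (\<lambda>x. (x, x, \<one>)) (ainv v) \<star>\<^sub>3 ?p (\<lambda>x. (x, x, \<one>)) v) \<star>\<^sub>3 ?e3 \<star>\<^sub>3 ?d)"
    by (simp only: l3 l4 G3.conv_assoc)
  also have "\<dots> = ?e1 \<star>\<^sub>3 ?e2 \<star>\<^sub>3 (?e3 \<star>\<^sub>3 ?d)"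
    using G3.A.l_one[OF e3] by (simp add: i2)
  finally show ?thesis using L cob_unit[OF v] by (simp add: two_cocycle_legs)
qed

lemma cob_invariant:
  assumes v: "v \<in> normalisers"
  shows "diag_invariant (cob v)"
  unfolding diag_invariant_def
proof (intro conjI ballI)
  note u = normalisers_unit[OF v]
  note s = unit_simps[OF u]
  show "cob v \<in> G2.vec" by (simp add: cob_eq)
  fix g assume g: "g \<in> carrier G"
  obtain h where h: "h \<in> carrier G" "ainv v \<star> single g \<star> v = single h" using normalisersD[OF v g] .
  have "ainv v \<star> single g = ainv v \<star> single g \<star> (v \<star> ainv v)" using s by simp
  also have "\<dots> = single h \<star> ainv v" by (simp add: h(2)[symmetric] conv_assoc)
  finally have 1: "ainv v \<star> single g = single h \<star> ainv v" .
  have "v \<star> single h = (v \<star> ainv v) \<star> single g \<star> v" by (simp only: h(2)[symmetric] conv_assoc)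
  then have 2: "v \<star> single h = single g \<star> v" using s g by simp
  have "cob v \<star>\<^sub>2 single (g, g) = (v \<boxtimes> v) \<star>\<^sub>2 Delta (ainv v \<star> single g)"
    using g by (simp add: cob_eq Delta_conv Delta_single G2.conv_assoc)
  also have "\<dots> = (v \<boxtimes> v) \<star>\<^sub>2 (single h \<boxtimes> single h) \<star>\<^sub>2 Delta (ainv v)"
    using h(1) by (simp add: 1 Delta_conv Delta_single tensor_single G2.conv_assoc)
  also have "\<dots> = (single g \<boxtimes> single g) \<star>\<^sub>2 (v \<boxtimes> v) \<star>\<^sub>2 Delta (ainv v)"
    by (simp add: tensor_conv 2)
  also have "\<dots> = single (g, g) \<star>\<^sub>2 cob v"
    by (simp add: cob_eq tensor_single G2.conv_assoc)
  finally show "cob v \<star>\<^sub>2 single (g, g) = single (g, g) \<star>\<^sub>2 cob v" .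
qed

text \<open>  Invariance lets \<open>cob w\<close> pass through the coproduct of \<open>ainv v\<close>.
\<close>

lemma cob_mult:
  assumes v: "v \<in> Units alg" and w: "w \<in> normalisers"
  shows "cob (v \<star> w) = cob v \<star>\<^sub>2 cob w"
proof -
  note u = unit_mult[OF v normalisers_unit[OF w]]
  have c: "cob w \<star>\<^sub>2 Delta (ainv v) = Delta (ainv v) \<star>\<^sub>2 cob w"
    unfolding Delta_def by (rule G2.commute_push) (use cob_invariant[OF w] in \<open>simp add: diag_invariant_def\<close>)
  have "cob v \<star>\<^sub>2 cob w = (v \<boxtimes> v) \<star>\<^sub>2 (cob w \<star>\<^sub>2 Delta (ainv v))"
    unfolding c by (simp add: cob_eq G2.conv_assoc)
  also have "\<dots> = (v \<boxtimes> v) \<star>\<^sub>2 (w \<boxtimes> w) \<star>\<^sub>2 Delta (ainv w \<star> ainv v)"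
    by (simp add: cob_eq G2.conv_assoc Delta_conv)
  also have "\<dots> = cob (v \<star> w)" by (simp add: cob_eq u tensor_conv)
  finally show ?thesis ..
qed

lemma cob_single: "g \<in> carrier G \<Longrightarrow> cob (single g) = single (\<one>, \<one>)"
  by (simp add: cob_eq unit_single Delta_single tensor_single G2.single_conv_single)

lemma cob_trivial:
  assumes v: "v \<in> Units alg" "cob v = single (\<one>, \<one>)"
  shows "\<exists>g\<in>carrier G. v = single g"
proof (rule grouplike)
  note s = unit_simps[OF v(1)]
  show "v \<in> vec" by (rule s)
  have "v \<boxtimes> v = cob v \<star>\<^sub>2 Delta v"
    using s by (simp add: cob_eq G2.conv_assoc Delta_unit[OF v(1)])
  then show "Delta v = v \<boxtimes> v" using v(2) by simp
  show "v \<noteq> (\<lambda>_. 0)"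
  proof
    assume "v = (\<lambda>_. 0)"
    then have "single \<one> = (\<lambda>_. 0)" using s(3) zero_conv[of "ainv v"] by simp
    then show False by (auto simp: single_def fun_eq_iff split: if_splits)
  qed
qed

text \<open>  If \<open>v\<close> and a central \<open>c\<close> have the same coboundary, then \<open>ainv c \<star> v\<close> has trivial coboundary and
  is therefore grouplike.  So \<open>v\<close> acts by an inner automorphism.
\<close>

lemma cob_inner:
  assumes v: "v \<in> normalisers" and c: "c \<in> A1 (group_algebra G)" "cob v = cob c"
  shows "\<exists>g\<in>carrier G. \<forall>x\<in>carrier G. ainv v \<star> single x \<star> v = single (inv g \<otimes> x \<otimes> g)"
proof -
  have cu: "c \<in> Units alg" and ci: "ainv c \<in> Units alg"
    using c A1_inv by (auto simp: A1_iff)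
  note s = unit_simps[OF cu]
  have "cob (ainv c \<star> v) = cob (ainv c) \<star>\<^sub>2 cob c" using cob_mult[OF ci v] c(2) by simp
  also have "\<dots> = cob (ainv c \<star> c)" by (rule cob_mult[symmetric]) (use ci A1_normalisers[OF c(1)] in auto)
  finally have "cob (ainv c \<star> v) = single (\<one>, \<one>)" by (simp add: s cob_single)
  then obtain g where g: "g \<in> carrier G" "ainv c \<star> v = single g"
    using cob_trivial[OF unit_mult(1)[OF ci normalisers_unit[OF v]]] by blast
  have "c \<star> (ainv c \<star> v) = v" using s unit_simps[OF normalisers_unit[OF v]] by (simp add: conv_assoc[symmetric])
  then have vg: "v = c \<star> single g" using g by simp
  have "ainv v \<star> single x \<star> v = single (inv g \<otimes> x \<otimes> g)" if x: "x \<in> carrier G" for x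
  proof -
    have "ainv v \<star> single x \<star> v = single (inv g) \<star> ainv c \<star> (single x \<star> c) \<star> single g"
      using g by (simp add: vg unit_mult[OF cu unit_single(1)] unit_single conv_assoc)
    also have "single x \<star> c = c \<star> single x" using c(1) x by (simp add: A1_iff)
    also have "single (inv g) \<star> ainv c \<star> (c \<star> single x) \<star> single g = single (inv g) \<star> (ainv c \<star> c) \<star> single x \<star> single g"
      by (simp add: conv_assoc)
    also have "\<dots> = single (inv g \<otimes> x \<otimes> g)" using g x by (simp add: s single_conv_single)
    finally show ?thesis .
  qed
  then show ?thesis using g by blast
qed

end

lemma index_two_quotient:
  assumes A: "group A" and N: "subgroup N A" and a: "a \<in> carrier A" "a \<notin> N"
    and two: "\<And>x y. \<lbrakk>x \<in> carrier A; x \<notin> N; y \<in> carrier A; y \<notin> N\<rbrakk> \<Longrightarrow> x \<otimes>\<^bsub>A\<^esub> y \<in> N"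
  shows "A Mod N \<cong> integer_mod_group 2"
proof -
  interpret A: group A by fact
  interpret N: subgroup N A by fact
  define \<psi> where "\<psi> x = (if x \<in> N then 0 else 1 :: int)" for x
  have nn: "x \<otimes>\<^bsub>A\<^esub> y \<in> N \<longleftrightarrow> (x \<in> N \<longleftrightarrow> y \<in> N)" if xy: "x \<in> carrier A" "y \<in> carrier A" for x y
  proof (cases "x \<in> N"; cases "y \<in> N")
    assume x: "x \<in> N" and y: "y \<notin> N"
    have "x \<otimes>\<^bsub>A\<^esub> y \<notin> N"
    proof
      assume "x \<otimes>\<^bsub>A\<^esub> y \<in> N"
      then have "inv\<^bsub>A\<^esub> x \<otimes>\<^bsub>A\<^esub> (x \<otimes>\<^bsub>A\<^esub> y) \<in> N" using x by blast
      then show False using y xy by (simp add: A.m_assoc[symmetric])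
    qed
    then show ?thesis using x y by simp
  next
    assume x: "x \<notin> N" and y: "y \<in> N"
    have "x \<otimes>\<^bsub>A\<^esub> y \<notin> N"
    proof
      assume "x \<otimes>\<^bsub>A\<^esub> y \<in> N"
      then have "(x \<otimes>\<^bsub>A\<^esub> y) \<otimes>\<^bsub>A\<^esub> inv\<^bsub>A\<^esub> y \<in> N" using y by blast
      then show False using x xy by (simp add: A.m_assoc)
    qed
    then show ?thesis using x y by simp
  qed (use xy two in auto)
  have hom: "\<psi> \<in> hom A (integer_mod_group 2)"
    by (rule homI) (auto simp: \<psi>_def nn carrier_integer_mod_group)
  interpret h: group_hom A "integer_mod_group 2" \<psi>
    by (intro group_hom.intro group_hom_axioms.intro A group_integer_mod_group hom)
  have ker: "kernel A (integer_mod_group 2) \<psi> = N"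
    using N.subset by (auto simp: kernel_def \<psi>_def)
  have "\<psi> ` carrier A = carrier (integer_mod_group 2)"
  proof
    have "\<psi> \<one>\<^bsub>A\<^esub> = 0" "\<psi> a = 1" using a N.one_closed by (auto simp: \<psi>_def)
    moreover have "carrier (integer_mod_group 2) = {0, 1}" by (auto simp: carrier_integer_mod_group)
    ultimately show "carrier (integer_mod_group 2) \<subseteq> \<psi> ` carrier A"
      using a by (metis A.one_closed empty_subsetI image_eqI insert_subset)
  qed (auto simp: \<psi>_def carrier_integer_mod_group)
  from h.FactGroup_iso[OF this] show ?thesis by (simp add: ker)
qed

context fin_group_hopf
begin

text \<open>  Since \<open>cob\<close> is multiplicative, the cohomology group is the group of automorphisms induced by
  normalising units modulo inner automorphisms.  The assumptions on \<open>v0\<close> leave exactly two classes.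
\<close>

lemma H2_inv_order_two:
  assumes all: "\<And>\<Omega>. two_cocycle (group_algebra G) \<Omega> \<Longrightarrow> invariant (group_algebra G) \<Omega> \<Longrightarrow> \<exists>v\<in>normalisers. \<Omega> = cob v"
    and v0: "v0 \<in> normalisers" "cob v0 \<notin> cob ` A1 (group_algebra G)" "v0 \<star> v0 \<in> A1 (group_algebra G)"
    and two: "\<And>v. v \<in> normalisers \<Longrightarrow> cob v \<in> cob ` A1 (group_algebra G) \<or> (\<exists>c\<in>A1 (group_algebra G). cob v = cob v0 \<star>\<^sub>2 cob c)"
  shows "H2_inv (group_algebra G) \<cong> integer_mod_group 2"
proof -
  let ?A = "A2 (group_algebra G)" and ?Z = "A1 (group_algebra G)"
  have car: "carrier ?A = cob ` normalisers"
    using all cob_cocycle[OF normalisers_unit] cob_invariant invariant_diag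
    by (auto simp: A2_def cob_eq simp del: carrier_DirProd)
  have mul: "x \<otimes>\<^bsub>?A\<^esub> y = x \<star>\<^sub>2 y" for x y
    by (simp add: A2_def mult_monoid_tensor_group_algebra)
  have one: "\<one>\<^bsub>?A\<^esub> = single (\<one>, \<one>)"
    by (simp add: A2_def mult_monoid_tensor_group_algebra ga_basis[OF G2.group_axioms G2.fin])
  have m: "cob v \<otimes>\<^bsub>?A\<^esub> cob w = cob (v \<star> w)" if "v \<in> normalisers" "w \<in> normalisers" for v w
    using cob_mult[OF normalisers_unit[OF that(1)] that(2)] by (simp add: mul)
  have one1: "\<one>\<^bsub>?A\<^esub> = cob (single \<one>)" by (simp add: one cob_single)
  have inv: "cob (ainv v) \<otimes>\<^bsub>?A\<^esub> cob v = \<one>\<^bsub>?A\<^esub>" if v: "v \<in> normalisers" for v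
    using v unit_simps[OF normalisers_unit[OF v]] by (simp add: m normalisers_inv one1)
  have A: "group ?A"
  proof (rule groupI)
    show "x \<otimes>\<^bsub>?A\<^esub> y \<in> carrier ?A" if "x \<in> carrier ?A" "y \<in> carrier ?A" for x y
      using that normalisers_mult by (auto simp: car m)
    show "\<one>\<^bsub>?A\<^esub> \<in> carrier ?A" using normalisers_single[OF one_closed] by (auto simp: car one1)
    show "x \<otimes>\<^bsub>?A\<^esub> y \<otimes>\<^bsub>?A\<^esub> z = x \<otimes>\<^bsub>?A\<^esub> (y \<otimes>\<^bsub>?A\<^esub> z)" for x y z
      by (simp add: mul G2.conv_assoc)
    show "\<one>\<^bsub>?A\<^esub> \<otimes>\<^bsub>?A\<^esub> x = x" if "x \<in> carrier ?A" for x
      using that by (auto simp: car mul one cob_eq)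
    show "\<exists>y\<in>carrier ?A. y \<otimes>\<^bsub>?A\<^esub> x = \<one>\<^bsub>?A\<^esub>" if "x \<in> carrier ?A" for x
      using that inv normalisers_inv by (auto simp: car)
  qed
  interpret A: group ?A by (rule A)
  have Z: "c \<in> normalisers" if "c \<in> ?Z" for c using A1_normalisers[OF that] .
  have N: "subgroup (cob ` ?Z) ?A"
  proof (rule A.subgroupI)
    show "cob ` ?Z \<subseteq> carrier ?A" using Z by (auto simp: car)
    show "cob ` ?Z \<noteq> {}" using one_A1 by blast
    show "inv\<^bsub>?A\<^esub> x \<in> cob ` ?Z" if "x \<in> cob ` ?Z" for x
    proof -
      from that obtain c where c: "c \<in> ?Z" "x = cob c" by blast
      have "inv\<^bsub>?A\<^esub> x = cob (ainv c)"
        using inv[OF Z[OF c(1)]] c Z[OF c(1)] normalisers_inv[OF Z[OF c(1)]] by (intro A.inv_equality) (auto simp: car)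
      then show ?thesis using A1_inv[OF c(1)] by blast
    qed
    show "x \<otimes>\<^bsub>?A\<^esub> y \<in> cob ` ?Z" if "x \<in> cob ` ?Z" "y \<in> cob ` ?Z" for x y
      using that Z A1_mult by (auto simp: m)
  qed
  have tw: "x \<otimes>\<^bsub>?A\<^esub> y \<in> cob ` ?Z"
    if x: "x \<in> carrier ?A" "x \<notin> cob ` ?Z" and y: "y \<in> carrier ?A" "y \<notin> cob ` ?Z" for x y
  proof -
    obtain c where c: "c \<in> ?Z" "x = cob v0 \<star>\<^sub>2 cob c" using x two by (auto simp: car)
    obtain d where d: "d \<in> ?Z" "y = cob v0 \<star>\<^sub>2 cob d" using y two by (auto simp: car)
    have "x \<otimes>\<^bsub>?A\<^esub> y = cob (v0 \<star> c) \<otimes>\<^bsub>?A\<^esub> cob (v0 \<star> d)"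
      using c d m[OF v0(1) Z] by (simp add: mul)
    also have "\<dots> = cob (v0 \<star> (c \<star> v0) \<star> d)"
      using c d v0(1) by (simp add: m normalisers_mult Z conv_assoc)
    also have "c \<star> v0 = v0 \<star> c"
      using c unit_simps[OF normalisers_unit[OF v0(1)]] by (simp add: A1_iff)
    also have "v0 \<star> (v0 \<star> c) \<star> d = (v0 \<star> v0) \<star> (c \<star> d)" by (simp add: conv_assoc)
    finally show ?thesis using A1_mult[OF v0(3) A1_mult[OF c(1) d(1)]] by blast
  qed
  show ?thesis unfolding H2_inv_def
    by (rule index_two_quotient[OF A N _ v0(2) tw]) (use v0(1) in \<open>auto simp: car\<close>)
qed

end

section \<open>From symmetric cocycles to normalising units\<close>

context invariant_cocycle
begin

text \<open>  A trivial \<open>R\<close> means that \<open>\<Omega>\<close> is symmetric.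
\<close>

lemma trivial_support_coboundary:
  assumes "Supp = {\<one>}"
  shows "\<exists>v\<in>normalisers. \<Omega> = cob v"
proof -
  have "R = single (\<one>, \<one>)"
  proof
    fix p :: "'a \<times> 'a"
    obtain x y where p: "p = (x, y)" by (cases p)
    show "R p = single (\<one>, \<one>) p"
      using R_outside[of x y] R_one_Supp[of \<one>] assms by (auto simp: p single_def)
  qed
  then have "flip \<Omega> = \<Omega>" using \<Omega>_R \<Omega>_vec by simp
  then obtain v w where v: "v \<in> vec" "w \<in> vec" "v \<star> w = single \<one>" "w \<star> v = single \<one>"
    "\<Omega> = (v \<boxtimes> v) \<star>\<^sub>2 Delta w" "\<forall>g\<in>carrier G. \<exists>g'\<in>carrier G. w \<star> single g \<star> v = single g'"
    using symmetric_coboundary by blast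
  note u = unitI[OF v(1-4)]
  show ?thesis
    by (rule bexI[of _ v]) (use u v in \<open>simp_all add: cob_eq normalisers_def\<close>)
qed

end

context fin_group_hopf
begin

lemma invariant_cocycleI:
  assumes "two_cocycle (group_algebra G) \<Omega>" "invariant (group_algebra G) \<Omega>"
  shows "invariant_cocycle G \<Omega> (inv\<^bsub>G2.alg\<^esub> \<Omega>)"
proof -
  have u: "\<Omega> \<in> Units G2.alg" using assms(1) by (simp add: two_cocycle_def mult_monoid_tensor_group_algebra)
  have v: "\<Omega> \<in> G2.vec" by (rule G2.A.Units_closed[OF u])
  show ?thesis
    using assms u v G2.A.Units_inv_closed[OF u] G2.A.Units_r_inv[OF u] G2.A.Units_l_inv[OF u]
    by unfold_locales (auto simp: two_cocycle_legs invariant_diag simp del: carrier_DirProd)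
qed

lemma conj_class:
  assumes v: "v \<in> normalisers" and x: "x \<in> carrier G" and y: "y \<in> carrier G" "ainv v \<star> single x \<star> v = single y"
  shows "\<exists>k\<in>carrier G. y = k \<otimes> x \<otimes> inv k"
proof -
  note s = unit_simps[OF normalisers_unit[OF v]]
  define C where "C = {k \<otimes> x \<otimes> inv k | k. k \<in> carrier G}"
  define F where "F p = (if p \<in> C then 1 else 0 :: complex)" for p
  have C: "h \<otimes> p \<otimes> inv h \<in> C" if "p \<in> C" "h \<in> carrier G" for p h
  proof -
    from that obtain k where k: "k \<in> carrier G" "p = k \<otimes> x \<otimes> inv k" by (auto simp: C_def)
    have "h \<otimes> p \<otimes> inv h = (h \<otimes> k) \<otimes> x \<otimes> inv (h \<otimes> k)"
      using k that(2) x by (simp add: inv_mult_group m_assoc)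
    then show ?thesis using k that(2) unfolding C_def by blast
  qed
  have C2: "b \<otimes> a \<in> C" if "a \<otimes> b \<in> C" "a \<in> carrier G" "b \<in> carrier G" for a b
  proof -
    have "b \<otimes> (a \<otimes> b) \<otimes> inv b = b \<otimes> a" using that by (simp add: m_assoc)
    then show ?thesis using C[OF that(1,3)] by simp
  qed
  have F: "F (a \<otimes> b) = F (b \<otimes> a)" if "a \<in> carrier G" "b \<in> carrier G" for a b
    using C2[of a b] C2[of b a] that by (auto simp: F_def)
  have "F y = (\<Sum>p\<in>carrier G. (ainv v \<star> single x \<star> v) p * F p)"
    using y by (simp add: sum_single(4))
  also have "\<dots> = (\<Sum>p\<in>carrier G. (v \<star> (ainv v \<star> single x)) p * F p)"
    by (rule class_function_trace[where F=F]) (rule F)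
  also have "v \<star> (ainv v \<star> single x) = single x" using s x by (simp add: conv_assoc[symmetric])
  also have "(\<Sum>p\<in>carrier G. single x p * F p) = F x" using x by (simp add: sum_single(4))
  also have "F x = 1" using x by (auto simp: F_def C_def intro!: exI[of _ \<one>])
  finally show ?thesis by (auto simp: F_def C_def split: if_splits)
qed

end

section \<open>Coordinates on the group\<close>

text \<open>  The element \<open>el i m\<close> is the product of \<open>u\<^sup>i\<close> and the automorphism \<open>x \<mapsto> m x\<close>; it lies in the group exactly
  for odd \<open>m\<close>, and both coordinates only matter modulo 8.  Thus \<open>u = el 1 1\<close>, \<open>s = el 0 3\<close>,
  \<open>t = el 0 5\<close>, and \<open>z = el 4 1\<close> is the central involution \<open>u\<^sup>4\<close>.
\<close>

definition el :: "int \<Rightarrow> int \<Rightarrow> int \<times> (int \<Rightarrow> int)" where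
  "el i m = (i mod 8, \<lambda>x\<in>{0..<8}. (m * x) mod 8)"

abbreviation "GG \<equiv> Z8_rtimes_Aut"
abbreviation GG_mult (infixl \<open>\<cdot>\<close> 70) where "x \<cdot> y \<equiv> x \<otimes>\<^bsub>GG\<^esub> y"
abbreviation GG_conv (infixl \<open>\<star>\<^sub>G\<close> 70) where "f \<star>\<^sub>G g \<equiv> f \<star>\<^bsub>GG\<^esub> g"

lemma el_eq_iff: "el i m = el j n \<longleftrightarrow> i mod 8 = j mod 8 \<and> m mod 8 = n mod 8"
proof
  assume e: "el i m = el j n"
  then have "(\<lambda>x\<in>{0..<8}. (m * x) mod 8) 1 = (\<lambda>x\<in>{0..<8}. (n * x) mod 8) (1 :: int)" by (simp add: el_def)
  then show "i mod 8 = j mod 8 \<and> m mod 8 = n mod 8" using e by (simp add: el_def)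
next
  assume "i mod 8 = j mod 8 \<and> m mod 8 = n mod 8"
  then show "el i m = el j n" unfolding el_def
    by (auto simp: restrict_def fun_eq_iff) (metis mod_mult_left_eq)
qed

lemma carrier_Z8: "carrier (integer_mod_group 8) = {0..<8}"
  by (simp add: carrier_integer_mod_group)

lemma el_auto:
  assumes "odd m"
  shows "snd (el i m) \<in> auto (integer_mod_group 8)"
proof -
  let ?f = "\<lambda>x\<in>{0..<8}. (m * x) mod 8"
  have "m mod 8 = 1 \<or> m mod 8 = 3 \<or> m mod 8 = 5 \<or> m mod 8 = 7" using assms by presburger
  then have "(m mod 8 * (m mod 8)) mod 8 = 1" by auto
  then have mm: "(m * m) mod 8 = 1" by (simp add: mod_simps)
  have m2: "(m * (m * x mod 8)) mod 8 = x" if "x \<in> {0..<8}" for x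
  proof -
    have "(m * (m * x mod 8)) mod 8 = ((m * m) mod 8 * x) mod 8" by (simp add: mod_simps mult.assoc)
    then show ?thesis using that by (simp add: mm)
  qed
  have "bij_betw ?f {0..<8} {0..<8}"
    by (rule bij_betwI[where g="?f"]) (use m2 in auto)
  moreover have "?f \<in> hom (integer_mod_group 8) (integer_mod_group 8)"
    by (auto simp: hom_def carrier_Z8 mult_integer_mod_group distrib_left mod_simps)
  ultimately show "snd (el i m) \<in> auto (integer_mod_group 8)"
    by (auto simp: auto_def Bij_def carrier_Z8 el_def)
qed

lemma el_closed [simp]: "odd m \<Longrightarrow> el i m \<in> carrier GG"
  using el_auto[of m i] by (simp add: Z8_rtimes_Aut_def semidirect_product_def AutoGroup_def carrier_Z8 el_def)

lemma carrierE:
  assumes "g \<in> carrier GG"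
  obtains i m where "g = el i m" "0 \<le> i" "i < 8" "m = 1 \<or> m = 3 \<or> m = 5 \<or> m = 7"
proof -
  obtain i \<alpha> where g: "g = (i, \<alpha>)" "0 \<le> i" "i < 8" "\<alpha> \<in> auto (integer_mod_group 8)"
    using assms by (auto simp: Z8_rtimes_Aut_def semidirect_product_def AutoGroup_def carrier_Z8)
  have ext: "\<alpha> \<in> extensional {0..<8}" and bij: "bij_betw \<alpha> {0..<8} {0..<8}"
    and hom: "\<And>x y. x \<in> {0..<8} \<Longrightarrow> y \<in> {0..<8} \<Longrightarrow> \<alpha> ((x + y) mod 8) = (\<alpha> x + \<alpha> y) mod 8"
    using g(4) by (auto simp: auto_def Bij_def hom_def carrier_Z8 mult_integer_mod_group)
  have rng: "\<alpha> x \<in> {0..<8}" if "x \<in> {0..<8}" for x using bij that by (auto simp: bij_betw_def)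
  define m where "m = \<alpha> 1"
  have 0: "\<alpha> 0 = 0" using hom[of 0 0] rng[of 0] by (simp, presburger)
  have lin: "\<alpha> (int k) = (m * int k) mod 8" if "k < 8" for k
    using that
  proof (induction k)
    case (Suc k)
    have "\<alpha> ((int k + 1) mod 8) = (\<alpha> (int k) + m) mod 8" using Suc.prems hom[of "int k" 1] by (simp add: m_def)
    then show ?case using Suc by (simp add: mod_simps algebra_simps)
  qed (simp add: 0)
  have lin': "\<alpha> x = (m * x) mod 8" if "x \<in> {0..<8}" for x using lin[of "nat x"] that by (simp add: nat_less_iff)
  have "\<alpha> 4 \<noteq> \<alpha> 0" using inj_on_eq_iff[OF bij_betw_imp_inj_on[OF bij], of 4 0] by simp
  then have "(m * 4) mod 8 \<noteq> 0" using lin'[of 4] 0 by simp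
  then have "m = 1 \<or> m = 3 \<or> m = 5 \<or> m = 7" using rng[of 1] by (auto simp: m_def) presburger
  moreover have "g = el i m"
    unfolding g(1) el_def using g(2,3) ext lin' by (auto simp: extensional_def restrict_def fun_eq_iff)
  ultimately show ?thesis using that g by blast
qed

lemma carrier_oddE:
  assumes "g \<in> carrier GG"
  obtains i m where "g = el i m" "odd m"
proof (rule carrierE[OF assms])
  fix i m assume "g = el i m" "m = 1 \<or> m = 3 \<or> m = 5 \<or> m = 7"
  moreover from this(2) have "odd m" by auto
  ultimately show ?thesis using that by blast
qed

lemma el_mult:
  assumes "odd m" "odd n"
  shows "el i m \<cdot> el j n = el (i + m * j) (m * n)"
proof -
  have B: "snd (el i m) \<in> Bij {0..<8}" "snd (el j n) \<in> Bij {0..<8}"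
    using el_auto assms by (auto simp: auto_def carrier_Z8)
  have "snd (el i m \<cdot> el j n) = compose {0..<8} (snd (el i m)) (snd (el j n))"
    using B by (simp add: Z8_rtimes_Aut_def semidirect_product_def AutoGroup_def BijGroup_def carrier_Z8 split_def)
  also have "\<dots> = snd (el (i + m * j) (m * n))"
    by (auto simp: el_def compose_def restrict_def fun_eq_iff mod_simps mult.assoc)
  finally have 1: "snd (el i m \<cdot> el j n) = snd (el (i + m * j) (m * n))" .
  have "fst (el i m \<cdot> el j n) = fst (el (i + m * j) (m * n))"
    by (simp add: Z8_rtimes_Aut_def semidirect_product_def mult_integer_mod_group split_def el_def mod_simps)
  with 1 show ?thesis by (simp add: prod_eq_iff)
qed

lemma el_one: "\<one>\<^bsub>GG\<^esub> = el 0 1"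
  by (auto simp: el_def Z8_rtimes_Aut_def semidirect_product_def AutoGroup_def BijGroup_def carrier_Z8 restrict_def fun_eq_iff)

interpretation G: fin_group_hopf GG
  using group_Z8_rtimes_Aut finite_Z8_rtimes_Aut
  by (simp add: fin_group_hopf_def fin_group_def fin_group_axioms_def)

lemma odd_square_mod8: "odd (m :: int) \<Longrightarrow> (m * m) mod 8 = 1"
proof -
  assume "odd m"
  then have "m mod 8 = 1 \<or> m mod 8 = 3 \<or> m mod 8 = 5 \<or> m mod 8 = 7" by presburger
  then have "(m mod 8 * (m mod 8)) mod 8 = 1" by auto
  then show ?thesis by (simp add: mod_simps)
qed

lemma el_inv: "odd m \<Longrightarrow> inv\<^bsub>GG\<^esub> (el i m) = el (- (m * i)) m"
  by (rule G.inv_equality) (simp_all add: el_mult el_one el_eq_iff odd_square_mod8)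

lemma generation:
  assumes S: "\<And>x y. x \<in> S \<Longrightarrow> y \<in> S \<Longrightarrow> x \<cdot> y \<in> S"
    and gen: "el 1 1 \<in> S" "el 0 3 \<in> S" "el 0 5 \<in> S" and g: "g \<in> carrier GG"
  shows "g \<in> S"
proof -
  have p: "el (int k + 1) 1 \<in> S" for k
  proof (induction k)
    case (Suc k)
    then show ?case using S[OF Suc gen(1)] by (simp add: el_mult add_ac)
  qed (use gen in simp)
  have q: "el i 1 \<in> S" for i
  proof -
    have "el i 1 = el (int (nat ((i - 1) mod 8)) + 1) 1" by (simp add: el_eq_iff mod_simps)
    then show ?thesis using p[of "nat ((i - 1) mod 8)"] by metis
  qed
  have r: "el 0 7 \<in> S"
    using S[OF gen(2,3)] el_eq_iff[of 0 15 0 7] by (simp add: el_mult)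
  from g obtain i m where im: "g = el i m" "m = 1 \<or> m = 3 \<or> m = 5 \<or> m = 7" by (rule carrierE)
  have "el 0 m \<in> S" using im(2) q[of 0] r gen by auto
  then have "el i 1 \<cdot> el 0 m \<in> S" using S q by blast
  then show ?thesis using im by (auto simp: el_mult)
qed

section \<open>The R-matrix in the group of order 32\<close>

lemma mod8_cases:
  fixes i :: int
  obtains q r where "i = 8 * q + r" "r = 0 \<or> r = 1 \<or> r = 2 \<or> r = 3 \<or> r = 4 \<or> r = 5 \<or> r = 6 \<or> r = 7"
proof -
  have "0 \<le> i mod 8" "i mod 8 < 8" by simp_all
  then show ?thesis using that[of "i div 8" "i mod 8"] by simp linarith
qed

lemma mult_mod8: "(k * (8 * q + r)) mod 8 = (k * r) mod (8 :: int)"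
proof -
  have "k * (8 * q + r) = k * r + 8 * (k * q)" by (simp add: algebra_simps)
  then show ?thesis by (simp only: mod_mult_self2)
qed

lemma mod8_multiple_four:
  fixes i :: int
  assumes "i mod 8 \<noteq> 0" shows "i mod 8 = 4 \<or> (2 * i) mod 8 = 4 \<or> (4 * i) mod 8 = 4"
proof -
  obtain q r where qr: "i = 8 * q + r" and r: "r = 0 \<or> r = 1 \<or> r = 2 \<or> r = 3 \<or> r = 4 \<or> r = 5 \<or> r = 6 \<or> r = 7"
    by (rule mod8_cases)
  show ?thesis using r assms mult_mod8[of 1 q r] unfolding qr mult_mod8 by auto
qed

text \<open>  Suppose the support is nontrivial.  Being normal, it contains \<open>z\<close>, and by nondegeneracy some \<open>c\<close>
  pairs nontrivially with \<open>z\<close>.  An alternating bicharacter is 1 on \<open>(z, c)\<close> whenever \<open>z\<close> is a power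
  of \<open>c\<close>, and \<open>c\<close> commutes with its commutator with \<open>u\<close>.  This leaves \<open>c = t\<close> and \<open>c = z t\<close>, and the
  support must be the normal Klein four-group of \<open>z\<close> and \<open>t\<close>.  That group does carry an invariant
  nondegenerate alternating form, but the trace formula at \<open>u s\<close> refutes it: \<open>(u s)\<^sup>2 = z\<close>, whereas
  the sum over the support equals 1.
\<close>

lemma Supp_trivial:
  assumes "invariant_cocycle GG \<Omega> \<Omega>i"
  shows "invariant_cocycle.Supp GG \<Omega> \<Omega>i = {\<one>\<^bsub>GG\<^esub>}"
proof (rule ccontr)
  interpret C: invariant_cocycle GG \<Omega> \<Omega>i by fact
  assume "C.Supp \<noteq> {\<one>\<^bsub>GG\<^esub>}"
  then obtain a where a: "a \<in> C.Supp" "a \<noteq> \<one>\<^bsub>GG\<^esub>" using C.Supp_one by blast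
  note mul = C.Supp_mult
  have dbl: "el (2 * i) 1 \<in> C.Supp" if "el i 1 \<in> C.Supp" for i
    using mul[OF that that] by (simp add: el_mult)
  \<comment> \<open>the commutator of \<open>u\<close> with \<open>el i m\<close>\<close>
  have comm: "el (1 - m) 1 \<in> C.Supp" if h: "el i m \<in> C.Supp" "odd m" for i m
  proof -
    have "el 1 1 \<cdot> el i m \<cdot> inv\<^bsub>GG\<^esub> (el 1 1) \<cdot> inv\<^bsub>GG\<^esub> (el i m) \<in> C.Supp"
      by (intro mul C.Supp_normal C.Supp_inv h(1)) simp
    also have "el 1 1 \<cdot> el i m \<cdot> inv\<^bsub>GG\<^esub> (el 1 1) \<cdot> inv\<^bsub>GG\<^esub> (el i m) = el (1 + i - m - (m * m) * i) (m * m)"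
      using h(2) by (simp add: el_inv el_mult algebra_simps)
    also have "\<dots> = el (1 - m) 1"
    proof -
      obtain q where q: "m * m = 8 * q + 1"
        using odd_square_mod8[OF h(2)] by (metis mult_div_mod_eq)
      have "1 + i - m - (m * m) * i = (1 - m) + 8 * (- (q * i))" by (simp add: q algebra_simps)
      then show ?thesis using odd_square_mod8[OF h(2)] by (simp only: el_eq_iff mod_mult_self2) simp
    qed
    finally show ?thesis .
  qed
  have r4: "el 4 1 \<in> C.Supp" if h: "el i 1 \<in> C.Supp" "i mod 8 \<noteq> 0" for i
  proof -
    have "i mod 8 = 4 \<or> (2 * i) mod 8 = 4 \<or> (2 * (2 * i)) mod 8 = 4"
      using mod8_multiple_four[OF h(2)] by simp
    then consider "el i 1 = el 4 1" | "el (2 * i) 1 = el 4 1" | "el (2 * (2 * i)) 1 = el 4 1"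
      unfolding el_eq_iff by fastforce
    then show ?thesis
    proof cases
      case 1 show ?thesis using h(1) unfolding 1 .
    next
      case 2 show ?thesis using dbl[OF h(1)] unfolding 2 .
    next
      case 3 show ?thesis using dbl[OF dbl[OF h(1)]] unfolding 3 .
    qed
  qed
  have z: "el 4 1 \<in> C.Supp"
  proof -
    obtain i m where im: "a = el i m" "0 \<le> i" "i < 8" "m = 1 \<or> m = 3 \<or> m = 5 \<or> m = 7"
      using carrierE[OF C.Supp_carrier[OF a(1)]] .
    show ?thesis
    proof (cases "m = 1")
      case True
      then show ?thesis using r4[of i] a im by (auto simp: el_one el_eq_iff)
    next
      case False
      then have "odd m" "(1 - m) mod 8 \<noteq> 0" using im(4) by auto
      then show ?thesis using r4[OF comm[of i m]] a(1) im(1) by simp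
    qed
  qed
  have no37: "m = 1 \<or> m = 5" if h: "el i m \<in> C.Supp" "m = 1 \<or> m = 3 \<or> m = 5 \<or> m = 7" for i m
  proof -
    have o: "odd m" using h(2) by auto
    have "el (1 - m) 1 \<cdot> el i m = el i m \<cdot> el (1 - m) 1"
      by (rule C.Supp_comm[OF comm[OF h(1) o] h(1)])
    then have "(1 - m + i) mod 8 = (i + m * (1 - m)) mod 8" using o by (simp add: el_mult el_eq_iff)
    then have "8 dvd (1 - m + i) - (i + m * (1 - m))" by (simp only: mod_eq_dvd_iff)
    then show ?thesis using h(2) by auto
  qed
  obtain c where c: "c \<in> C.Supp" "C.beta (el 4 1) c \<noteq> 1"
    using C.beta_nondegenerate[OF z] by (auto simp: el_one el_eq_iff)
  obtain i m where im: "c = el i m" "0 \<le> i" "i < 8" "m = 1 \<or> m = 3 \<or> m = 5 \<or> m = 7"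
    using carrierE[OF C.Supp_carrier[OF c(1)]] .
  have npow: "el 4 1 \<noteq> c" "el 4 1 \<noteq> c \<cdot> c" "el 4 1 \<noteq> (c \<cdot> c) \<cdot> (c \<cdot> c)"
    using c C.beta_alternating[OF c(1)] C.beta_mult_left[of c c c] C.beta_mult_left[of "c \<cdot> c" "c \<cdot> c" c] mul[OF c(1) c(1)]
    by auto
  have n0: "c \<noteq> el 0 1" using c(2) C.beta_one_right[OF z] by (auto simp: el_one)
  have m5: "m = 5 \<and> (i = 0 \<or> i = 4)"
  proof (cases "m = 1")
    case True
    then have "i mod 8 \<noteq> 0" "i mod 8 \<noteq> 4" "(i + i) mod 8 \<noteq> 4" "(i + i + (i + i)) mod 8 \<noteq> 4"
      using npow n0 by (auto simp: im(1) el_mult el_eq_iff)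
    moreover have "i = 0 \<or> i = 1 \<or> i = 2 \<or> i = 3 \<or> i = 4 \<or> i = 5 \<or> i = 6 \<or> i = 7" using im(2,3) by arith
    ultimately have False by auto
    then show ?thesis ..
  next
    case False
    then have 5: "m = 5" using no37[of i m] c(1) im by auto
    then have "(i + 5 * i) mod 8 \<noteq> 4" "(i + 5 * i + 25 * (i + 5 * i)) mod 8 \<noteq> 4"
      using npow by (auto simp: im(1) el_mult el_eq_iff)
    moreover have "i = 0 \<or> i = 1 \<or> i = 2 \<or> i = 3 \<or> i = 4 \<or> i = 5 \<or> i = 6 \<or> i = 7" using im(2,3) by arith
    ultimately have "i = 0 \<or> i = 4" by auto
    then show ?thesis using 5 by simp
  qed
  have t: "el 0 5 \<in> C.Supp \<and> C.beta (el 4 1) (el 0 5) \<noteq> 1"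
  proof (cases "i = 0")
    case True
    then show ?thesis using c im m5 by simp
  next
    case False
    then have c4: "c = el 4 5" using m5 im(1) by simp
    have e: "el 4 1 \<cdot> c = el 0 5" by (simp add: c4 el_mult el_eq_iff)
    then show ?thesis
      using mul[OF z c(1)] C.beta_mult_right[OF z z c(1)] C.beta_alternating[OF z] c(2) by simp
  qed
  have tt: "el 0 5 \<cdot> el 0 5 = el 0 1" by (simp add: el_mult el_eq_iff)
  have no2: "i mod 8 = 0 \<or> i mod 8 = 4" if h: "el i 1 \<in> C.Supp" for i
  proof -
    have "el i 1 \<cdot> el 0 5 = el 0 5 \<cdot> el i 1"
      using C.Supp_comm[OF h] t by blast
    then have ev: "i mod 8 = (5 * i) mod 8" by (simp add: el_mult el_eq_iff)
    have "el i 1 \<cdot> el i 1 \<noteq> el 4 1"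
    proof
      assume e: "el i 1 \<cdot> el i 1 = el 4 1"
      have "C.beta (el 4 1) (el 0 5) = C.beta (el i 1) (el 0 5) * C.beta (el i 1) (el 0 5)"
        using C.beta_mult_left[OF h h] t e by metis
      also have "\<dots> = C.beta (el i 1) (el 0 5 \<cdot> el 0 5)"
        using C.beta_mult_right[OF h] t by simp
      also have "\<dots> = 1" using C.beta_one_right[OF h] by (simp add: tt el_one)
      finally show False using t by simp
    qed
    then have n4: "(2 * i) mod 8 \<noteq> 4" by (simp add: el_mult el_eq_iff)
    obtain q r where qr: "i = 8 * q + r" and r: "r = 0 \<or> r = 1 \<or> r = 2 \<or> r = 3 \<or> r = 4 \<or> r = 5 \<or> r = 6 \<or> r = 7"
      by (rule mod8_cases)
    have i: "i mod 8 = r mod 8" using mult_mod8[of 1 q r] by (simp only: qr mult_1)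
    have a: "(5 * i) mod 8 = (5 * r) mod 8" unfolding qr by (rule mult_mod8)
    have "r mod 8 = (5 * r) mod 8" by (rule trans[OF i[symmetric] trans[OF ev a]])
    moreover have "(2 * r) mod 8 \<noteq> 4" using n4 unfolding qr mult_mod8 .
    ultimately have "r = 0 \<or> r = 4" using r by (elim disjE) simp_all
    then show ?thesis unfolding i by auto
  qed
  have Supp: "C.Supp = {el 0 1, el 4 1, el 0 5, el 4 5}"
  proof
    show "{el 0 1, el 4 1, el 0 5, el 4 5} \<subseteq> C.Supp"
      using z t C.Supp_one mul[OF z, of "el 0 5"] by (simp add: el_one el_mult)
    show "C.Supp \<subseteq> {el 0 1, el 4 1, el 0 5, el 4 5}"
    proof
      fix d assume d: "d \<in> C.Supp"
      then obtain j n where jn: "d = el j n" "0 \<le> j" "j < 8" "n = 1 \<or> n = 3 \<or> n = 5 \<or> n = 7"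
        using carrierE[OF C.Supp_carrier] by metis
      have "n = 1 \<or> n = 5" using no37[of j n] d jn by blast
      then have "el j 1 \<in> C.Supp \<and> (n = 1 \<or> n = 5)"
      proof
        assume n: "n = 5"
        have "d \<cdot> el 0 5 \<in> C.Supp" using mul d t by blast
        also have "d \<cdot> el 0 5 = el j 1" by (simp add: jn(1) n el_mult el_eq_iff)
        finally show ?thesis using n by simp
      qed (use d jn in simp)
      then show "d \<in> {el 0 1, el 4 1, el 0 5, el 4 5}" using no2[of j] jn by auto
    qed
  qed
  \<comment> \<open>the element \<open>u s\<close>; \<open>?r\<close> exchanges \<open>\<one>\<close> and \<open>z\<close> and fixes \<open>t\<close> and \<open>z t\<close>\<close>
  let ?g = "el 1 3"
  let ?r = "\<lambda>a. inv\<^bsub>GG\<^esub> ?g \<cdot> inv\<^bsub>GG\<^esub> a \<cdot> inv\<^bsub>GG\<^esub> ?g"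
  have r: "?r (el 0 1) = el 4 1" "?r (el 4 1) = el 0 1" "?r (el 0 5) = el 0 5" "?r (el 4 5) = el 4 5"
    by (simp_all add: el_inv el_mult el_eq_iff)
  have "(\<Sum>a\<in>carrier GG. C.R (a, ?r a)) = 0"
    by (subst C.R_trace) (simp_all add: el_mult el_one el_eq_iff)
  moreover have "(\<Sum>a\<in>carrier GG. C.R (a, ?r a)) = (\<Sum>a\<in>C.Supp. C.R (a, ?r a))"
    by (rule sum.mono_neutral_right) (auto simp: C.R_outside C.Supp_carrier)
  moreover have "\<dots> = C.R (el 0 1, el 4 1) + (C.R (el 4 1, el 0 1) + (C.R (el 0 5, el 0 5) + C.R (el 4 5, el 4 5)))"
    unfolding Supp by (simp add: r el_eq_iff)
  moreover have "C.beta (el 0 1) (el 4 1) = 1" "C.beta (el 4 1) (el 0 1) = 1"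
    using C.beta_one_left[OF z] C.beta_one_right[OF z] by (simp_all add: el_one)
  moreover have "C.beta (el 0 5) (el 0 5) = 1" "C.beta (el 4 5) (el 4 5) = 1"
    using C.beta_alternating Supp by auto
  ultimately show False using C.card_Supp by (simp add: C.R_eq_beta)
qed

section \<open>The outer class-preserving automorphism\<close>

text \<open>  Twice the element that is 1 where \<open>z\<close> acts as 1, and \<open>u + u\<^sup>3\<close> where \<open>z\<close> acts as \<open>-1\<close>.  The latter
  commutes with \<open>u\<close> and with \<open>s\<close>, which exchanges its two terms, and anticommutes with \<open>t\<close>.  Its
  square there is \<open>-2\<close>, so \<open>v0\<close> is invertible with central square.  It acts as the automorphism that fixes
  \<open>u\<close> and \<open>s\<close> and maps \<open>t\<close> to \<open>z t\<close>.
\<close>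

definition v0 :: "int \<times> (int \<Rightarrow> int) \<Rightarrow> complex" where
  "v0 = (\<lambda>x. \<Sum>k\<in>{0..<8::int}. (if k \<in> {0, 1, 3, 4} then 1 else if k \<in> {5, 7} then -1 else 0) * single (el k 1) x)"

definition v0_inv :: "int \<times> (int \<Rightarrow> int) \<Rightarrow> complex" where
  "v0_inv = (\<lambda>x. \<Sum>k\<in>{0..<8::int}. (if k \<in> {0, 4} then 1/4 else if k \<in> {1, 3} then -1/8 else if k \<in> {5, 7} then 1/8 else 0) * single (el k 1) x)"

lemma sum8: "(\<Sum>k\<in>{0..<8::int}. f k) = f 0 + f 1 + f 2 + f 3 + f 4 + f 5 + f 6 + (f 7 :: complex)"
proof -
  have "{0..<8::int} = {0, 1, 2, 3, 4, 5, 6, 7}" by auto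
  then show ?thesis by (simp add: add_ac)
qed

lemma el_reduce: "el 8 1 = el 0 1" "el 9 1 = el 1 1" "el 10 1 = el 2 1" "el 11 1 = el 3 1" "el 12 1 = el 4 1" 
  "el 13 1 = el 5 1" "el 14 1 = el 6 1"
  by (simp_all add: el_eq_iff)

lemma lincomb_conv:
  "((\<lambda>x. \<Sum>j\<in>{0..<8::int}. c j * single (el j 1) x) \<star>\<^sub>G (\<lambda>x. \<Sum>k\<in>{0..<8::int}. d k * single (el k 1) x)) z =
   (\<Sum>j\<in>{0..<8::int}. c j * (\<Sum>k\<in>{0..<8::int}. d k * single (el (j + k) 1) z))"
  by (simp add: G.conv_sum_left G.conv_sum_right G.single_conv_single el_mult)

lemma v0_v0: "(v0 \<star>\<^sub>G v0) x = -2 * single (el 0 1) x + 6 * single (el 4 1) x"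
  unfolding v0_def lincomb_conv by (unfold sum8, simp add: el_reduce)

lemma v0_v0_inv: "v0 \<star>\<^sub>G v0_inv = single (el 0 1)" "v0_inv \<star>\<^sub>G v0 = single (el 0 1)"
proof -
  show "v0 \<star>\<^sub>G v0_inv = single (el 0 1)"
    by (rule ext, unfold v0_def v0_inv_def lincomb_conv, unfold sum8, simp add: el_reduce)
  show "v0_inv \<star>\<^sub>G v0 = single (el 0 1)"
    by (rule ext, unfold v0_def v0_inv_def lincomb_conv, unfold sum8, simp add: el_reduce, simp add: field_simps)
qed

lemma v0_commutes:
  "v0 \<star>\<^sub>G single (el 1 1) = single (el 1 1) \<star>\<^sub>G v0"
  "v0 \<star>\<^sub>G single (el 0 3) = single (el 0 3) \<star>\<^sub>G v0"
  "v0 \<star>\<^sub>G single (el 4 5) = single (el 0 5) \<star>\<^sub>G v0"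
proof -
  have l: "(v0 \<star>\<^sub>G single (el i m)) x = (\<Sum>k\<in>{0..<8::int}. (if k \<in> {0, 1, 3, 4} then 1 else if k \<in> {5, 7} then -1 else 0) * single (el (k + i) m) x)"
    if "odd m" for i m x using that unfolding v0_def by (simp add: G.conv_sum_left G.single_conv_single el_mult)
  have r: "(single (el i m) \<star>\<^sub>G v0) x = (\<Sum>k\<in>{0..<8::int}. (if k \<in> {0, 1, 3, 4} then 1 else if k \<in> {5, 7} then -1 else 0) * single (el (i + m * k) m) x)"
    if "odd m" for i m x using that unfolding v0_def by (simp add: G.conv_sum_right G.single_conv_single el_mult)
  have e: "el 9 3 = el 1 3" "el 15 3 = el 7 3" "el 21 3 = el 5 3" "el 12 3 = el 4 3"
    "el 15 5 = el 7 5" "el 20 5 = el 4 5" "el 25 5 = el 1 5" "el 35 5 = el 3 5" "el 8 5 = el 0 5" "el 9 5 = el 1 5" "el 11 5 = el 3 5"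
    by (simp_all add: el_eq_iff)
  show "v0 \<star>\<^sub>G single (el 1 1) = single (el 1 1) \<star>\<^sub>G v0"
    by (rule ext, subst l, simp, subst r, simp, unfold sum8, simp)
  show "v0 \<star>\<^sub>G single (el 0 3) = single (el 0 3) \<star>\<^sub>G v0"
    by (rule ext, subst l, simp, subst r, simp, unfold sum8, simp add: e)
  show "v0 \<star>\<^sub>G single (el 4 5) = single (el 0 5) \<star>\<^sub>G v0"
    by (rule ext, subst l, simp, subst r, simp, unfold sum8, simp add: e)
qed

lemma v0_vec: "v0 \<in> vecs (carrier GG)" "v0_inv \<in> vecs (carrier GG)"
proof -
  have "(\<lambda>x. \<Sum>k\<in>{0..<8::int}. c k * single (el k 1) x) \<in> vecs (carrier GG)" for c
    using el_closed by (auto simp: vecs_def single_def intro!: sum.neutral)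
  note V = this
  show "v0 \<in> vecs (carrier GG)" unfolding v0_def by (rule V)
  show "v0_inv \<in> vecs (carrier GG)" unfolding v0_inv_def by (rule V)
qed

lemma v0_unit: "v0 \<in> Units G.alg" "G.ainv v0 = v0_inv"
  using G.unitI[OF v0_vec] v0_v0_inv by (simp_all add: el_one)

lemma v0_conj:
  assumes "x \<in> carrier GG" "y \<in> carrier GG" "v0 \<star>\<^sub>G single y = single x \<star>\<^sub>G v0"
  shows "G.ainv v0 \<star>\<^sub>G single x \<star>\<^sub>G v0 = single y"
proof -
  have "G.ainv v0 \<star>\<^sub>G single x \<star>\<^sub>G v0 = (G.ainv v0 \<star>\<^sub>G v0) \<star>\<^sub>G single y"
    by (simp only: G.conv_assoc assms(3))
  then show ?thesis using assms(2) G.unit_simps[OF v0_unit(1)] by simp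
qed

lemma v0_normaliser: "v0 \<in> G.normalisers"
proof -
  let ?S = "{x \<in> carrier GG. \<exists>y\<in>carrier GG. v0 \<star>\<^sub>G single y = single x \<star>\<^sub>G v0}"
  have "g \<in> ?S" if "g \<in> carrier GG" for g
  proof (rule generation[OF _ _ _ _ that])
    fix x x' assume "x \<in> ?S" "x' \<in> ?S"
    then obtain y y' where y: "x \<in> carrier GG" "y \<in> carrier GG" "v0 \<star>\<^sub>G single y = single x \<star>\<^sub>G v0"
      and y': "x' \<in> carrier GG" "y' \<in> carrier GG" "v0 \<star>\<^sub>G single y' = single x' \<star>\<^sub>G v0" by auto
    have "v0 \<star>\<^sub>G single (y \<cdot> y') = (v0 \<star>\<^sub>G single y) \<star>\<^sub>G single y'"
      using y(2) y'(2) by (simp add: G.conv_assoc G.single_conv_single)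
    also have "\<dots> = single x \<star>\<^sub>G (single x' \<star>\<^sub>G v0)" by (simp only: y(3) y'(3) G.conv_assoc)
    also have "\<dots> = single (x \<cdot> x') \<star>\<^sub>G v0"
      using y(1) y'(1) by (simp add: G.conv_assoc[symmetric] G.single_conv_single)
    finally show "x \<cdot> x' \<in> ?S" using y y' by blast
  next
    show "el 1 1 \<in> ?S" using v0_commutes(1) by (auto intro!: bexI[of _ "el 1 1"])
    show "el 0 3 \<in> ?S" using v0_commutes(2) by (auto intro!: bexI[of _ "el 0 3"])
    show "el 0 5 \<in> ?S" using v0_commutes(3) by (auto intro!: bexI[of _ "el 4 5"])
  qed
  then show ?thesis using v0_unit v0_conj unfolding G.normalisers_def by blast
qed

text \<open>  An inner automorphism that fixes \<open>u\<close> and \<open>s\<close> is conjugation by a power of \<open>z\<close>, so it fixes \<open>t\<close>.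
\<close>

lemma v0_outer:
  assumes g: "g \<in> carrier GG"
  shows "\<not> (\<forall>x\<in>carrier GG. G.ainv v0 \<star>\<^sub>G single x \<star>\<^sub>G v0 = single (inv\<^bsub>GG\<^esub> g \<cdot> x \<cdot> g))"
proof
  assume h: "\<forall>x\<in>carrier GG. G.ainv v0 \<star>\<^sub>G single x \<star>\<^sub>G v0 = single (inv\<^bsub>GG\<^esub> g \<cdot> x \<cdot> g)"
  have c: "g \<cdot> y = x \<cdot> g"
    if xy: "x \<in> carrier GG" "y \<in> carrier GG" "v0 \<star>\<^sub>G single y = single x \<star>\<^sub>G v0" for x y
  proof -
    have "single y = single (inv\<^bsub>GG\<^esub> g \<cdot> x \<cdot> g)" using v0_conj[OF xy] h xy(1) by simp
    from fun_cong[OF this, of y] have "y = inv\<^bsub>GG\<^esub> g \<cdot> x \<cdot> g" by (auto simp: single_def split: if_splits)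
    then show ?thesis using g xy(1) by (simp add: G.m_assoc) (simp add: G.m_assoc[symmetric])
  qed
  from g obtain j n where jn: "g = el j n" "0 \<le> j" "j < 8" "n = 1 \<or> n = 3 \<or> n = 5 \<or> n = 7" by (rule carrierE)
  have o: "odd n" using jn(4) by auto
  have "(j + n) mod 8 = (1 + j) mod 8"
    using c[OF _ _ v0_commutes(1)] o by (simp add: jn(1) el_mult el_eq_iff)
  then have "8 dvd (j + n) - (1 + j)" by (simp only: mod_eq_dvd_iff)
  then have n: "n = 1" using jn(4) by auto
  have 3: "j mod 8 = (3 * j) mod 8"
    using c[OF _ _ v0_commutes(2)] by (simp add: jn(1) n el_mult el_eq_iff)
  have 5: "(j + 4) mod 8 = (5 * j) mod 8"
    using c[OF _ _ v0_commutes(3)] by (simp add: jn(1) n el_mult el_eq_iff)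
  have "j = 0 \<or> j = 1 \<or> j = 2 \<or> j = 3 \<or> j = 4 \<or> j = 5 \<or> j = 6 \<or> j = 7" using jn(2,3) by arith
  then show False using 3 5 by auto
qed

lemma v0_square_central: "v0 \<star>\<^sub>G v0 \<in> A1 (group_algebra GG)"
proof (rule G.A1_I)
  show "v0 \<star>\<^sub>G v0 \<in> Units G.alg" using v0_unit by (simp add: G.unit_mult)
  fix g assume g: "g \<in> carrier GG"
  then obtain j n where jn: "g = el j n" "n = 1 \<or> n = 3 \<or> n = 5 \<or> n = 7" by (rule carrierE)
  have o: "odd n" using jn(2) by auto
  have z: "el 4 1 \<cdot> g = g \<cdot> el 4 1"
  proof -
    have "8 dvd (4 + j) - (j + n * 4)" using jn(2) by auto
    then have "(4 + j) mod 8 = (j + n * 4) mod 8" by (simp only: mod_eq_dvd_iff)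
    then show ?thesis unfolding jn(1) using o by (simp only: el_mult odd_one el_eq_iff mult_1 mult_1_right simp_thms)
  qed
  have e: "v0 \<star>\<^sub>G v0 = (\<lambda>x. -2 * single \<one>\<^bsub>GG\<^esub> x + 6 * single (el 4 1) x)"
    by (rule ext) (simp add: v0_v0 el_one)
  show "v0 \<star>\<^sub>G v0 \<star>\<^sub>G single g = single g \<star>\<^sub>G (v0 \<star>\<^sub>G v0)"
    unfolding e G.conv_add using g z by (simp add: G.single_conv_single)
qed

section \<open>Normalising units of the group algebra\<close>

lemma commuting_generators:
  assumes w: "w \<in> Units G.alg"
    and c: "w \<star>\<^sub>G single (el 1 1) = single (el 1 1) \<star>\<^sub>G w" "w \<star>\<^sub>G single (el 0 3) = single (el 0 3) \<star>\<^sub>G w"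
      "w \<star>\<^sub>G single (el 0 5) = single (el 0 5) \<star>\<^sub>G w"
  shows "w \<in> A1 (group_algebra GG)"
proof (rule G.A1_I[OF w])
  let ?S = "{x \<in> carrier GG. w \<star>\<^sub>G single x = single x \<star>\<^sub>G w}"
  fix g assume g: "g \<in> carrier GG"
  have "g \<in> ?S"
  proof (rule generation[OF _ _ _ _ g])
    fix x y assume "x \<in> ?S" "y \<in> ?S"
    then have x: "x \<in> carrier GG" "w \<star>\<^sub>G single x = single x \<star>\<^sub>G w"
      and y: "y \<in> carrier GG" "w \<star>\<^sub>G single y = single y \<star>\<^sub>G w" by auto
    have "w \<star>\<^sub>G (single x \<star>\<^sub>G single y) = (single x \<star>\<^sub>G single y) \<star>\<^sub>G w"
      by (simp add: G.conv_assoc y(2)[symmetric]) (simp add: G.conv_assoc[symmetric] x(2))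
    then show "x \<cdot> y \<in> ?S" using x y by (simp add: G.single_conv_single)
  qed (use c in auto)
  then show "w \<star>\<^sub>G single g = single g \<star>\<^sub>G w" by simp
qed

lemma intertwine_quotient:
  assumes w: "w \<in> Units G.alg" and v: "v \<in> G.vec"
    and "w \<star>\<^sub>G single y = single x \<star>\<^sub>G w" "v \<star>\<^sub>G single y = single x \<star>\<^sub>G v"
    and xy: "x \<in> carrier GG" "y \<in> carrier GG"
  shows "G.ainv w \<star>\<^sub>G v \<star>\<^sub>G single y = single y \<star>\<^sub>G (G.ainv w \<star>\<^sub>G v)"
proof -
  note s = G.unit_simps[OF w]
  have "single y \<star>\<^sub>G G.ainv w = G.ainv w \<star>\<^sub>G (w \<star>\<^sub>G single y) \<star>\<^sub>G G.ainv w"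
    using s xy by (simp add: G.conv_assoc[symmetric])
  also have "\<dots> = G.ainv w \<star>\<^sub>G single x"
    using s xy by (simp add: assms(3) G.conv_assoc)
  finally have "single y \<star>\<^sub>G G.ainv w = G.ainv w \<star>\<^sub>G single x" .
  then have "single y \<star>\<^sub>G (G.ainv w \<star>\<^sub>G v) = G.ainv w \<star>\<^sub>G (single x \<star>\<^sub>G v)"
    by (simp add: G.conv_assoc[symmetric])
  then show ?thesis by (simp add: assms(4)[symmetric] G.conv_assoc)
qed

lemma normaliser_intertwines:
  assumes v: "v \<in> G.normalisers" and x: "x \<in> carrier GG"
  obtains k where "k \<in> carrier GG"
    "v \<star>\<^sub>G single (k \<cdot> x \<cdot> inv\<^bsub>GG\<^esub> k) = single x \<star>\<^sub>G v"
proof -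
  note s = G.unit_simps[OF G.normalisers_unit[OF v]]
  obtain y where y: "y \<in> carrier GG" "G.ainv v \<star>\<^sub>G single x \<star>\<^sub>G v = single y"
    using G.normalisersD[OF v x] .
  obtain k where k: "k \<in> carrier GG" "y = k \<cdot> x \<cdot> inv\<^bsub>GG\<^esub> k"
    using G.conj_class[OF v x y] by blast
  have "v \<star>\<^sub>G single y = (v \<star>\<^sub>G G.ainv v) \<star>\<^sub>G single x \<star>\<^sub>G v"
    by (simp only: y(2)[symmetric] G.conv_assoc)
  then have "v \<star>\<^sub>G single y = single x \<star>\<^sub>G v" using s x by simp
  then show ?thesis using that k by blast
qed

lemma normaliser_adjust:
  assumes v: "v \<in> G.normalisers" and k: "k \<in> carrier GG" and x: "x \<in> carrier GG"  and y: "y \<in> carrier GG"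
    and e: "v \<star>\<^sub>G single y = single x \<star>\<^sub>G v"
  shows "v \<star>\<^sub>G single k \<star>\<^sub>G single (inv\<^bsub>GG\<^esub> k \<cdot> y \<cdot> k) = single x \<star>\<^sub>G (v \<star>\<^sub>G single k)"
proof -
  have "single k \<star>\<^sub>G single (inv\<^bsub>GG\<^esub> k \<cdot> y \<cdot> k) = single y \<star>\<^sub>G single k"
    using k y by (simp add: G.single_conv_single G.m_assoc) (simp add: G.m_assoc[symmetric])
  then have "v \<star>\<^sub>G single k \<star>\<^sub>G single (inv\<^bsub>GG\<^esub> k \<cdot> y \<cdot> k) = (v \<star>\<^sub>G single y) \<star>\<^sub>G single k"
    by (simp only: G.conv_assoc)
  then show ?thesis by (simp only: e G.conv_assoc)
qed

text \<open>  The conjugation action of \<open>v\<close> preserves conjugacy classes.  As \<open>u\<close> and then \<open>s\<close> can be moved back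
  by inner automorphisms, which do not affect the coboundary, only the image of \<open>t\<close> is left: it is
  \<open>t\<close>, and \<open>v\<close> is central, or \<open>z t\<close>, and \<open>v\<close> agrees with \<open>v0\<close> up to a central unit.
\<close>

lemma normalisers_classification:
  assumes v: "v \<in> G.normalisers"
  shows "G.cob v \<in> G.cob ` A1 (group_algebra GG) \<or>
    (\<exists>c\<in>A1 (group_algebra GG). G.cob v = G.cob v0 \<star>\<^bsub>GG \<times>\<times> GG\<^esub> G.cob c)"
proof -
  let ?u = "el 1 1" and ?s = "el 0 3" and ?t = "el 0 5"
  obtain k where k: "k \<in> carrier GG" "v \<star>\<^sub>G single (k \<cdot> ?u \<cdot> inv\<^bsub>GG\<^esub> k) = single ?u \<star>\<^sub>G v"
    using normaliser_intertwines[OF v, of ?u] by auto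
  \<comment> \<open>\<open>v1\<close> commutes with \<open>u\<close>\<close>
  define v1 where "v1 = v \<star>\<^sub>G single k"
  have v1: "v1 \<in> G.normalisers" unfolding v1_def by (intro G.normalisers_mult v G.normalisers_single k)
  have cob1: "G.cob v1 = G.cob v"
    using G.cob_mult[OF G.normalisers_unit[OF v] G.normalisers_single[OF k(1)]]
    by (simp add: v1_def G.cob_single k) (simp add: G.cob_eq)
  have u1: "v1 \<star>\<^sub>G single ?u = single ?u \<star>\<^sub>G v1"
  proof -
    have "inv\<^bsub>GG\<^esub> k \<cdot> (k \<cdot> ?u \<cdot> inv\<^bsub>GG\<^esub> k) \<cdot> k = ?u"
      using k(1) by (simp add: G.m_assoc) (simp add: G.m_assoc[symmetric])
    then show ?thesis using normaliser_adjust[OF v k(1) _ _ k(2)] k(1) by (simp add: v1_def)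
  qed
  have conj: "h \<cdot> el 0 n \<cdot> inv\<^bsub>GG\<^esub> h = el (j - n * j) n"
    if h: "h = el j m" "odd m" and n: "odd n" for h j m n
  proof -
    have "h \<cdot> el 0 n \<cdot> inv\<^bsub>GG\<^esub> h = el (j - (m * m) * (n * j)) ((m * m) * n)"
      using h n by (simp add: el_inv el_mult mult_ac)
    also have "\<dots> = el (j - n * j) n"
    proof -
      obtain q where q: "m * m = 8 * q + 1"
        using odd_square_mod8[OF h(2)] by (metis mult_div_mod_eq)
      have "j - (m * m) * (n * j) = (j - n * j) + 8 * (- (q * (n * j)))" "(m * m) * n = n + 8 * (q * n)"
        by (simp_all add: q algebra_simps)
      then show ?thesis by (simp only: el_eq_iff mod_mult_self2)
    qed
    finally show ?thesis .
  qed
  obtain h where h: "h \<in> carrier GG" "v1 \<star>\<^sub>G single (h \<cdot> ?s \<cdot> inv\<^bsub>GG\<^esub> h) = single ?s \<star>\<^sub>G v1"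
    using normaliser_intertwines[OF v1, of ?s] by auto
  obtain j m where jm: "h = el j m" "odd m" using carrier_oddE[OF h(1)] .
  have s1: "v1 \<star>\<^sub>G single (el (j - 3 * j) 3) = single ?s \<star>\<^sub>G v1"
    using h(2) conj[OF jm, of 3] by simp
  \<comment> \<open>conjugation by \<open>u\<^sup>j\<close> fixes \<open>u\<close> and moves \<open>s\<close> through its whole class; \<open>v2\<close> commutes with \<open>u\<close> and \<open>s\<close>\<close>
  define v2 where "v2 = v1 \<star>\<^sub>G single (el j 1)"
  have v2: "v2 \<in> G.normalisers" unfolding v2_def by (intro G.normalisers_mult v1 G.normalisers_single) simp
  have cob2: "G.cob v2 = G.cob v"
    using G.cob_mult[OF G.normalisers_unit[OF v1] G.normalisers_single[of "el j 1"]]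
    by (simp add: v2_def G.cob_single cob1) (simp add: G.cob_eq)
  have u2: "v2 \<star>\<^sub>G single ?u = single ?u \<star>\<^sub>G v2"
    using normaliser_adjust[OF v1 _ _ _ u1, of "el j 1"] by (simp add: v2_def el_inv el_mult)
  have s2: "v2 \<star>\<^sub>G single ?s = single ?s \<star>\<^sub>G v2"
    using normaliser_adjust[OF v1 _ _ _ s1, of "el j 1"] by (simp add: v2_def el_inv el_mult)
  obtain h' where h': "h' \<in> carrier GG" "v2 \<star>\<^sub>G single (h' \<cdot> ?t \<cdot> inv\<^bsub>GG\<^esub> h') = single ?t \<star>\<^sub>G v2"
    using normaliser_intertwines[OF v2, of ?t] by auto
  obtain j' m' where jm': "h' = el j' m'" "odd m'" using carrier_oddE[OF h'(1)] .
  have t2: "v2 \<star>\<^sub>G single (el (j' - 5 * j') 5) = single ?t \<star>\<^sub>G v2"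
    using h'(2) conj[OF jm', of 5] by simp
  have "el (j' - 5 * j') 5 = ?t \<or> el (j' - 5 * j') 5 = el 4 5"
  proof (cases "even j'")
    case True
    then obtain q where "j' = 2 * q" by (rule evenE)
    then show ?thesis by (simp add: el_eq_iff)
  next
    case False
    then obtain q where "j' = 2 * q + 1" by (rule oddE)
    then have "j' - 5 * j' = 4 + 8 * (- q - 1)" by simp
    then show ?thesis by (simp only: el_eq_iff mod_mult_self2) simp
  qed
  then show ?thesis
  proof
    assume "el (j' - 5 * j') 5 = ?t"
    then have "v2 \<in> A1 (group_algebra GG)"
      using commuting_generators[OF G.normalisers_unit[OF v2] u2 s2] t2 by simp
    then show ?thesis using cob2 by (metis image_eqI)
  next
    assume "el (j' - 5 * j') 5 = el 4 5"
    then have t2: "v2 \<star>\<^sub>G single (el 4 5) = single ?t \<star>\<^sub>G v2" using t2 by simp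
    define w where "w = G.ainv v0 \<star>\<^sub>G v2"
    have v2v: "v2 \<in> G.vec" using G.unit_simps[OF G.normalisers_unit[OF v2]] by simp
    have wu: "w \<in> Units G.alg" unfolding w_def
      by (rule G.unit_mult) (use G.unit_simps[OF v0_unit(1)] G.normalisers_unit[OF v2] in auto)
    have cu: "w \<star>\<^sub>G single ?u = single ?u \<star>\<^sub>G w" unfolding w_def
      by (rule intertwine_quotient[OF v0_unit(1) v2v v0_commutes(1) u2]) simp_all
    have cs: "w \<star>\<^sub>G single ?s = single ?s \<star>\<^sub>G w" unfolding w_def
      by (rule intertwine_quotient[OF v0_unit(1) v2v v0_commutes(2) s2]) simp_all
    have czt: "w \<star>\<^sub>G single (el 4 5) = single (el 4 5) \<star>\<^sub>G w" unfolding w_def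
      by (rule intertwine_quotient[OF v0_unit(1) v2v v0_commutes(3) t2]) simp_all
    have prod: "w \<star>\<^sub>G single (x \<cdot> y) = single (x \<cdot> y) \<star>\<^sub>G w"
      if "x \<in> carrier GG" "y \<in> carrier GG" "w \<star>\<^sub>G single x = single x \<star>\<^sub>G w" "w \<star>\<^sub>G single y = single y \<star>\<^sub>G w" for x y
    proof -
      have "w \<star>\<^sub>G (single x \<star>\<^sub>G single y) = (single x \<star>\<^sub>G single y) \<star>\<^sub>G w"
        by (simp add: G.conv_assoc that(4)[symmetric]) (simp add: G.conv_assoc[symmetric] that(3))
      then show ?thesis using that by (simp add: G.single_conv_single)
    qed
    have c2: "w \<star>\<^sub>G single (el 2 1) = single (el 2 1) \<star>\<^sub>G w"
      using prod[OF _ _ cu cu] by (simp add: el_mult)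
    have c4: "w \<star>\<^sub>G single (el 4 1) = single (el 4 1) \<star>\<^sub>G w"
      using prod[OF _ _ c2 c2] by (simp add: el_mult)
    have "el 8 5 = ?t" by (simp add: el_eq_iff)
    then have ct: "w \<star>\<^sub>G single ?t = single ?t \<star>\<^sub>G w"
      using prod[OF _ _ c4 czt] by (simp add: el_mult)
    have wA: "w \<in> A1 (group_algebra GG)" by (rule commuting_generators[OF wu cu cs ct])
    have "v0 \<star>\<^sub>G w = v2"
      using G.unit_simps[OF v0_unit(1)] v2v by (simp add: w_def G.conv_assoc[symmetric])
    then have "G.cob v = G.cob v0 \<star>\<^bsub>GG \<times>\<times> GG\<^esub> G.cob w"
      using G.cob_mult[OF v0_unit(1) G.A1_normalisers[OF wA]] cob2 by simp
    then show ?thesis using wA by blast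
  qed
qed

theorem mainTheorem2:
  shows "H2_inv (group_algebra Z8_rtimes_Aut) \<cong> integer_mod_group 2"
proof (rule G.H2_inv_order_two)
  show "\<exists>v\<in>G.normalisers. \<Omega> = G.cob v"
    if "two_cocycle (group_algebra GG) \<Omega>" "invariant (group_algebra GG) \<Omega>" for \<Omega>
  proof -
    note c = G.invariant_cocycleI[OF that]
    show ?thesis by (rule invariant_cocycle.trivial_support_coboundary[OF c Supp_trivial[OF c]])
  qed
  show "G.cob v0 \<notin> G.cob ` A1 (group_algebra GG)"
    using G.cob_inner[OF v0_normaliser] v0_outer by blast
  show "v0 \<in> G.normalisers" by (rule v0_normaliser)
  show "v0 \<star>\<^sub>G v0 \<in> A1 (group_algebra GG)" by (rule v0_square_central)
  show "G.cob v \<in> G.cob ` A1 (group_algebra GG) \<or>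
      (\<exists>c\<in>A1 (group_algebra GG). G.cob v = G.cob v0 \<star>\<^bsub>GG \<times>\<times> GG\<^esub> G.cob c)"
    if "v \<in> G.normalisers" for v
    using that by (rule normalisers_classification)
qed

end
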